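(* Let $K$ be a commutative ring and let $A$ be an associative unital $K$-algebra which is projective as a $K$-module. Consider the following statements. (1) $\mathrm{HH}^0(Z(A),M)=M$ for all $M\in\mathsf{Mod}(A^{\mathrm{ev}})$. (2) $Z(A)=Z_M(A)$ for all $M\in\mathsf{Mod}(A^{\mathrm{ev}})$. (3) $Z(A)=Z_{A\otimes A}(A)$. (4) The monoidal category $(\mathsf{Mod}(Z(A)^{\mathrm{ev}}),\otimes_{Z(A)},Z(A))$ is braided monoidal (admits a braiding). (5) $[-,-]_M$ vanishes for all $M\in\mathsf{Mod}(A^{\mathrm{ev}})$. Then $(1)\Longleftrightarrow(2)\Longleftrightarrow(3)\Longleftrightarrow(4)\Longrightarrow(5)$.
   Context: Write $\otimes=\otimes_K$ and $A^{\mathrm{ev}}=A\otimes A^{\mathrm{op}}$; $A^{\mathrm{ev}}$-modules are $A$-bimodules with symmetric $K$-action. $Z(A)$ is the center of $A$, and an $A^{\mathrm{ev}}$-module is regarded as a $Z(A)^{\mathrm{ev}}$-module by restriction; $\mathrm{HH}^0(Z(A),M)=\{m\in M\mid zm=mz\text{ for all }z\in Z(A)\}$. The $M$-relative center is $Z_M(A)=\{z\in Z(A)\mid zm=mz\text{ for all }m\in M\}$. The bimodule $A\otimes A$ carries the outer structure $a(x\otimes y)b=ax\otimes yb$. $\mathrm{HH}^*(A,M)$ is the cohomology of the standard Hochschild cochain complex $\mathrm{Hom}_K(A^{\otimes *},M)$, and $[-,-]_M:\mathrm{HH}^n(A,M)\times Z_M(A)\to\mathrm{HH}^{n-1}(A,M)$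 ($n\ge0$, $\mathrm{HH}^{-1}=0$) is the well-defined map induced on cocycles by $(f,z)\mapsto f\bullet z$, where $$(f\bullet z)(a_1\otimes\cdots\otimes a_{n-1})=\sum_{i=1}^n(-1)^{i-1}f(a_1\otimes\cdots\otimes a_{i-1}\otimes z\otimes a_i\otimes\cdots\otimes a_{n-1}).$$ *)

theory Defs
  imports "HOL-Algebra.Module" "HOL-Algebra.Free_Abelian_Groups"
begin

section \<open>Algebras and projective modules\<close>

locale assoc_algebra = module K A + A: ring A
  for K (structure) and A (structure) +
  assumes smult_mult_left:
      "\<lbrakk>k \<in> carrier K; x \<in> carrier A; y \<in> carrier A\<rbrakk>
        \<Longrightarrow> (k \<odot>\<^bsub>A\<^esub> x) \<otimes>\<^bsub>A\<^esub> y = k \<odot>\<^bsub>A\<^esub> (x \<otimes>\<^bsub>A\<^esub> y)"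
    and smult_mult_right:
      "\<lbrakk>k \<in> carrier K; x \<in> carrier A; y \<in> carrier A\<rbrakk>
        \<Longrightarrow> x \<otimes>\<^bsub>A\<^esub> (k \<odot>\<^bsub>A\<^esub> y) = k \<odot>\<^bsub>A\<^esub> (x \<otimes>\<^bsub>A\<^esub> y)"

definition center :: "('k, 'a) module \<Rightarrow> ('k, 'a) module" where
  "center A = A\<lparr>carrier := {z \<in> carrier A. \<forall>a\<in>carrier A. z \<otimes>\<^bsub>A\<^esub> a = a \<otimes>\<^bsub>A\<^esub> z}\<rparr>"

definition module_maps :: "'k ring \<Rightarrow> ('k, 'a) module \<Rightarrow> ('k, 'b) module \<Rightarrow> ('a \<Rightarrow> 'b) set" where
  "module_maps K M N = {f \<in> carrier M \<rightarrow> carrier N.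
     (\<forall>x\<in>carrier M. \<forall>y\<in>carrier M. f (x \<oplus>\<^bsub>M\<^esub> y) = f x \<oplus>\<^bsub>N\<^esub> f y) \<and>
     (\<forall>k\<in>carrier K. \<forall>x\<in>carrier M. f (k \<odot>\<^bsub>M\<^esub> x) = k \<odot>\<^bsub>N\<^esub> f x)}"

text \<open>The lifting property, tested on the surjections between modules whose carriers are sets of
  elements of the type \<open>'u\<close>. If \<open>'u\<close> is infinite and at least as large as \<open>K\<close> and \<open>P\<close>, then a free
  module mapping onto \<open>P\<close> is among them, and this is projectivity in the absolute sense.\<close>

definition projective_module :: "'u itself \<Rightarrow> 'k ring \<Rightarrow> ('k, 'a) module \<Rightarrow> bool" where
  "projective_module _ K P \<longleftrightarrow> module K P \<and>
     (\<forall>(N :: ('k, 'u) module) (N' :: ('k, 'u) module) g f.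
        module K N \<and> module K N' \<and> g \<in> module_maps K N N' \<and> g ` carrier N = carrier N' \<and>
        f \<in> module_maps K P N'
        \<longrightarrow> (\<exists>h \<in> module_maps K P N. \<forall>x\<in>carrier P. g (h x) = f x))"


section \<open>Bimodules\<close>

text \<open>Only \<open>carrier\<close>, \<open>add\<close> and \<open>zero\<close> of the underlying ring record are used, as in
  the \<^theory>\<open>HOL-Algebra.Module\<close> theory.\<close>

record ('l, 'r, 'm) bimod = "'m ring" +
  lact :: "'l \<Rightarrow> 'm \<Rightarrow> 'm"
  ract :: "'m \<Rightarrow> 'r \<Rightarrow> 'm"

locale bimodule = L: ring L + R: ring R + abelian_group M
  for L :: "('l, 'c) ring_scheme" (structure) and R :: "('r, 'd) ring_scheme" (structure)
    and M :: "('l, 'r, 'm) bimod" (structure) +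
  assumes lact_closed: "\<lbrakk>a \<in> carrier L; x \<in> carrier M\<rbrakk> \<Longrightarrow> lact M a x \<in> carrier M"
    and ract_closed: "\<lbrakk>b \<in> carrier R; x \<in> carrier M\<rbrakk> \<Longrightarrow> ract M x b \<in> carrier M"
    and lact_add_left: "\<lbrakk>a \<in> carrier L; a' \<in> carrier L; x \<in> carrier M\<rbrakk>
      \<Longrightarrow> lact M (a \<oplus>\<^bsub>L\<^esub> a') x = lact M a x \<oplus>\<^bsub>M\<^esub> lact M a' x"
    and lact_add_right: "\<lbrakk>a \<in> carrier L; x \<in> carrier M; y \<in> carrier M\<rbrakk>
      \<Longrightarrow> lact M a (x \<oplus>\<^bsub>M\<^esub> y) = lact M a x \<oplus>\<^bsub>M\<^esub> lact M a y"
    and ract_add_right: "\<lbrakk>b \<in> carrier R; b' \<in> carrier R; x \<in> carrier M\<rbrakk>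
      \<Longrightarrow> ract M x (b \<oplus>\<^bsub>R\<^esub> b') = ract M x b \<oplus>\<^bsub>M\<^esub> ract M x b'"
    and ract_add_left: "\<lbrakk>b \<in> carrier R; x \<in> carrier M; y \<in> carrier M\<rbrakk>
      \<Longrightarrow> ract M (x \<oplus>\<^bsub>M\<^esub> y) b = ract M x b \<oplus>\<^bsub>M\<^esub> ract M y b"
    and lact_mult: "\<lbrakk>a \<in> carrier L; a' \<in> carrier L; x \<in> carrier M\<rbrakk>
      \<Longrightarrow> lact M (a \<otimes>\<^bsub>L\<^esub> a') x = lact M a (lact M a' x)"
    and ract_mult: "\<lbrakk>b \<in> carrier R; b' \<in> carrier R; x \<in> carrier M\<rbrakk>
      \<Longrightarrow> ract M x (b \<otimes>\<^bsub>R\<^esub> b') = ract M (ract M x b) b'"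
    and lact_one: "x \<in> carrier M \<Longrightarrow> lact M \<one>\<^bsub>L\<^esub> x = x"
    and ract_one: "x \<in> carrier M \<Longrightarrow> ract M x \<one>\<^bsub>R\<^esub> = x"
    and lact_ract: "\<lbrakk>a \<in> carrier L; b \<in> carrier R; x \<in> carrier M\<rbrakk>
      \<Longrightarrow> ract M (lact M a x) b = lact M a (ract M x b)"

text \<open>Modules over the enveloping algebra of a \<open>K\<close>-algebra \<open>A\<close>: the \<open>A\<close>-bimodules on which the two
  actions of \<open>K\<close>, through \<open>k \<mapsto> k \<odot> \<one>\<close>, agree.\<close>

definition ev_module :: "'k ring \<Rightarrow> ('k, 'a) module \<Rightarrow> ('a, 'a, 'm) bimod \<Rightarrow> bool" where
  "ev_module K A M \<longleftrightarrow> bimodule A A M \<and>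
     (\<forall>k\<in>carrier K. \<forall>x\<in>carrier M.
        lact M (k \<odot>\<^bsub>A\<^esub> \<one>\<^bsub>A\<^esub>) x = ract M x (k \<odot>\<^bsub>A\<^esub> \<one>\<^bsub>A\<^esub>))"

definition bimod_hom ::
  "('k, 'a) module \<Rightarrow> ('a, 'a, 'm) bimod \<Rightarrow> ('a, 'a, 'n) bimod \<Rightarrow> ('m \<Rightarrow> 'n) set" where
  "bimod_hom A M N = {f \<in> carrier M \<rightarrow>\<^sub>E carrier N.
     (\<forall>x\<in>carrier M. \<forall>y\<in>carrier M. f (x \<oplus>\<^bsub>M\<^esub> y) = f x \<oplus>\<^bsub>N\<^esub> f y) \<and>
     (\<forall>a\<in>carrier A. \<forall>x\<in>carrier M. f (lact M a x) = lact N a (f x)) \<and>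
     (\<forall>a\<in>carrier A. \<forall>x\<in>carrier M. f (ract M x a) = ract N (f x) a)}"

definition regular_bimod :: "('k, 'a) module \<Rightarrow> ('a, 'a, 'a) bimod" where
  "regular_bimod A = \<lparr>carrier = carrier A, monoid.mult = monoid.mult A, one = \<one>\<^bsub>A\<^esub>, ring.zero = \<zero>\<^bsub>A\<^esub>,
     add = add A, lact = monoid.mult A, ract = monoid.mult A\<rparr>"

text \<open>For an \<open>A\<close>-bimodule \<open>M\<close>, restricted to the center \<open>Z\<close> of \<open>A\<close>, the set \<open>HH0 Z M\<close> is the zeroth
  Hochschild cohomology of \<open>Z\<close>; restricting the scalars does not change the record \<open>M\<close>.\<close>

definition HH0 :: "('k, 'a) module \<Rightarrow> ('a, 'a, 'm) bimod \<Rightarrow> 'm set" where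
  "HH0 Z M = {x \<in> carrier M. \<forall>z\<in>carrier Z. lact M z x = ract M x z}"

definition relative_center :: "('k, 'a) module \<Rightarrow> ('a, 'a, 'm) bimod \<Rightarrow> 'a set" where
  "relative_center A M = {z \<in> carrier (center A). \<forall>x\<in>carrier M. lact M z x = ract M x z}"


section \<open>Tensor products\<close>

text \<open>The tensor product over \<open>R\<close> of an \<open>(L,R)\<close>-bimodule \<open>M\<close> and an \<open>(R,S)\<close>-bimodule \<open>N\<close> is the
  quotient of the free abelian group on \<open>M \<times> N\<close> by the relations of biadditivity and balance,
  with the outer actions of \<open>L\<close> and \<open>S\<close>.\<close>

definition tensor_free ::
  "('l, 'r, 'm) bimod \<Rightarrow> ('r, 's, 'n) bimod \<Rightarrow> ('m \<times> 'n \<Rightarrow>\<^sub>0 int) monoid" where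
  "tensor_free M N = free_Abelian_group (carrier M \<times> carrier N)"

definition tensor_rels ::
  "'r set \<Rightarrow> ('l, 'r, 'm) bimod \<Rightarrow> ('r, 's, 'n) bimod \<Rightarrow> ('m \<times> 'n \<Rightarrow>\<^sub>0 int) set" where
  "tensor_rels R M N = generate (tensor_free M N)
    ({frag_of (x \<oplus>\<^bsub>M\<^esub> x', y) - frag_of (x, y) - frag_of (x', y) | x x' y.
        x \<in> carrier M \<and> x' \<in> carrier M \<and> y \<in> carrier N} \<union>
     {frag_of (x, y \<oplus>\<^bsub>N\<^esub> y') - frag_of (x, y) - frag_of (x, y') | x y y'.
        x \<in> carrier M \<and> y \<in> carrier N \<and> y' \<in> carrier N} \<union>
     {frag_of (ract M x r, y) - frag_of (x, lact N r y) | x r y.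
        x \<in> carrier M \<and> r \<in> R \<and> y \<in> carrier N})"

definition tensor ::
  "'r set \<Rightarrow> ('l, 'r, 'm) bimod \<Rightarrow> ('r, 's, 'n) bimod \<Rightarrow> ('l, 's, ('m \<times> 'n \<Rightarrow>\<^sub>0 int) set) bimod" where
  "tensor R M N =
    (let F = tensor_free M N; H = tensor_rels R M N; Q = F Mod H in
      \<lparr>carrier = carrier Q, monoid.mult = undefined, one = undefined,
       ring.zero = \<one>\<^bsub>Q\<^esub>, add = monoid.mult Q,
       lact = (\<lambda>a X. \<Union>t\<in>X. H #>\<^bsub>F\<^esub> frag_extend (\<lambda>(x, y). frag_of (lact M a x, y)) t),
       ract = (\<lambda>X b. \<Union>t\<in>X. H #>\<^bsub>F\<^esub> frag_extend (\<lambda>(x, y). frag_of (x, ract N y b)) t)\<rparr>)"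

definition pure_tensor ::
  "'r set \<Rightarrow> ('l, 'r, 'm) bimod \<Rightarrow> ('r, 's, 'n) bimod \<Rightarrow> 'm \<Rightarrow> 'n \<Rightarrow> ('m \<times> 'n \<Rightarrow>\<^sub>0 int) set" where
  "pure_tensor R M N x y = tensor_rels R M N #>\<^bsub>tensor_free M N\<^esub> frag_of (x, y)"

text \<open>\<open>A \<otimes>\<^sub>K A\<close> with its outer structure: the left factor is an \<open>(A,K)\<close>-bimodule and the right factor
  a \<open>(K,A)\<close>-bimodule.\<close>

definition outer_bimod ::
  "'k ring \<Rightarrow> ('k, 'a) module \<Rightarrow> ('a, 'a, ('a \<times> 'a \<Rightarrow>\<^sub>0 int) set) bimod" where
  "outer_bimod K A = tensor (carrier K)
     \<lparr>carrier = carrier A, monoid.mult = monoid.mult A, one = \<one>\<^bsub>A\<^esub>, ring.zero = \<zero>\<^bsub>A\<^esub>, add = add A,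
      lact = monoid.mult A, ract = (\<lambda>x k. k \<odot>\<^bsub>A\<^esub> x)\<rparr>
     \<lparr>carrier = carrier A, monoid.mult = monoid.mult A, one = \<one>\<^bsub>A\<^esub>, ring.zero = \<zero>\<^bsub>A\<^esub>, add = add A,
      lact = smult A, ract = monoid.mult A\<rparr>"


section \<open>Braided monoidal categories\<close>

text \<open>\<open>Comp C X Y Z g f\<close> is the composite of \<open>f : X \<rightarrow> Y\<close> and \<open>g : Y \<rightarrow> Z\<close>, and
  \<open>TArr C X X' Y Y' f g\<close> is the tensor product of \<open>f : X \<rightarrow> X'\<close> and \<open>g : Y \<rightarrow> Y'\<close>.\<close>

record ('o, 'm) category =
  Obj :: "'o set"
  Hom :: "'o \<Rightarrow> 'o \<Rightarrow> 'm set"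
  Id :: "'o \<Rightarrow> 'm"
  Comp :: "'o \<Rightarrow> 'o \<Rightarrow> 'o \<Rightarrow> 'm \<Rightarrow> 'm \<Rightarrow> 'm"

locale category =
  fixes C :: "('o, 'm, 'x) category_scheme"
  assumes Id_closed: "X \<in> Obj C \<Longrightarrow> Id C X \<in> Hom C X X"
    and Comp_closed: "\<lbrakk>X \<in> Obj C; Y \<in> Obj C; Z \<in> Obj C; f \<in> Hom C X Y; g \<in> Hom C Y Z\<rbrakk>
      \<Longrightarrow> Comp C X Y Z g f \<in> Hom C X Z"
    and Comp_Id_left: "\<lbrakk>X \<in> Obj C; Y \<in> Obj C; f \<in> Hom C X Y\<rbrakk>
      \<Longrightarrow> Comp C X Y Y (Id C Y) f = f"
    and Comp_Id_right: "\<lbrakk>X \<in> Obj C; Y \<in> Obj C; f \<in> Hom C X Y\<rbrakk>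
      \<Longrightarrow> Comp C X X Y f (Id C X) = f"
    and Comp_assoc: "\<lbrakk>W \<in> Obj C; X \<in> Obj C; Y \<in> Obj C; Z \<in> Obj C;
        f \<in> Hom C W X; g \<in> Hom C X Y; h \<in> Hom C Y Z\<rbrakk>
      \<Longrightarrow> Comp C W Y Z h (Comp C W X Y g f) = Comp C W X Z (Comp C X Y Z h g) f"

definition inverse_arrows ::
  "('o, 'm, 'x) category_scheme \<Rightarrow> 'o \<Rightarrow> 'o \<Rightarrow> 'm \<Rightarrow> 'm \<Rightarrow> bool" where
  "inverse_arrows C X Y f g \<longleftrightarrow> f \<in> Hom C X Y \<and> g \<in> Hom C Y X \<and>
     Comp C X Y X g f = Id C X \<and> Comp C Y X Y f g = Id C Y"

definition iso_arrow :: "('o, 'm, 'x) category_scheme \<Rightarrow> 'o \<Rightarrow> 'o \<Rightarrow> 'm \<Rightarrow> bool" where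
  "iso_arrow C X Y f \<longleftrightarrow> (\<exists>g. inverse_arrows C X Y f g)"

definition inv_arrow :: "('o, 'm, 'x) category_scheme \<Rightarrow> 'o \<Rightarrow> 'o \<Rightarrow> 'm \<Rightarrow> 'm" where
  "inv_arrow C X Y f = (THE g. inverse_arrows C X Y f g)"

record ('o, 'm) monoidal_category = "('o, 'm) category" +
  TObj :: "'o \<Rightarrow> 'o \<Rightarrow> 'o"
  TArr :: "'o \<Rightarrow> 'o \<Rightarrow> 'o \<Rightarrow> 'o \<Rightarrow> 'm \<Rightarrow> 'm \<Rightarrow> 'm"
  Unit :: "'o"
  Assoc :: "'o \<Rightarrow> 'o \<Rightarrow> 'o \<Rightarrow> 'm"
  LUnit :: "'o \<Rightarrow> 'm"
  RUnit :: "'o \<Rightarrow> 'm"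

locale monoidal_category = category C for C :: "('o, 'm) monoidal_category" +
  assumes TObj_closed: "\<lbrakk>X \<in> Obj C; Y \<in> Obj C\<rbrakk> \<Longrightarrow> TObj C X Y \<in> Obj C"
    and TArr_closed: "\<lbrakk>X \<in> Obj C; X' \<in> Obj C; Y \<in> Obj C; Y' \<in> Obj C;
        f \<in> Hom C X X'; g \<in> Hom C Y Y'\<rbrakk>
      \<Longrightarrow> TArr C X X' Y Y' f g \<in> Hom C (TObj C X Y) (TObj C X' Y')"
    and TArr_Id: "\<lbrakk>X \<in> Obj C; Y \<in> Obj C\<rbrakk>
      \<Longrightarrow> TArr C X X Y Y (Id C X) (Id C Y) = Id C (TObj C X Y)"
    and TArr_Comp: "\<lbrakk>X \<in> Obj C; X' \<in> Obj C; X'' \<in> Obj C; Y \<in> Obj C; Y' \<in> Obj C; Y'' \<in> Obj C;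
        f \<in> Hom C X X'; f' \<in> Hom C X' X''; g \<in> Hom C Y Y'; g' \<in> Hom C Y' Y''\<rbrakk>
      \<Longrightarrow> TArr C X X'' Y Y'' (Comp C X X' X'' f' f) (Comp C Y Y' Y'' g' g) =
          Comp C (TObj C X Y) (TObj C X' Y') (TObj C X'' Y'')
            (TArr C X' X'' Y' Y'' f' g') (TArr C X X' Y Y' f g)"
    and Unit_closed: "Unit C \<in> Obj C"
    and Assoc_iso: "\<lbrakk>X \<in> Obj C; Y \<in> Obj C; Z \<in> Obj C\<rbrakk>
      \<Longrightarrow> iso_arrow C (TObj C (TObj C X Y) Z) (TObj C X (TObj C Y Z)) (Assoc C X Y Z)"
    and Assoc_natural: "\<lbrakk>X \<in> Obj C; X' \<in> Obj C; Y \<in> Obj C; Y' \<in> Obj C; Z \<in> Obj C; Z' \<in> Obj C;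
        f \<in> Hom C X X'; g \<in> Hom C Y Y'; h \<in> Hom C Z Z'\<rbrakk>
      \<Longrightarrow> Comp C (TObj C (TObj C X Y) Z) (TObj C (TObj C X' Y') Z') (TObj C X' (TObj C Y' Z'))
            (Assoc C X' Y' Z')
            (TArr C (TObj C X Y) (TObj C X' Y') Z Z' (TArr C X X' Y Y' f g) h) =
          Comp C (TObj C (TObj C X Y) Z) (TObj C X (TObj C Y Z)) (TObj C X' (TObj C Y' Z'))
            (TArr C X X' (TObj C Y Z) (TObj C Y' Z') f (TArr C Y Y' Z Z' g h))
            (Assoc C X Y Z)"
    and LUnit_iso: "X \<in> Obj C \<Longrightarrow> iso_arrow C (TObj C (Unit C) X) X (LUnit C X)"
    and LUnit_natural: "\<lbrakk>X \<in> Obj C; Y \<in> Obj C; f \<in> Hom C X Y\<rbrakk>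
      \<Longrightarrow> Comp C (TObj C (Unit C) X) (TObj C (Unit C) Y) Y
            (LUnit C Y) (TArr C (Unit C) (Unit C) X Y (Id C (Unit C)) f) =
          Comp C (TObj C (Unit C) X) X Y f (LUnit C X)"
    and RUnit_iso: "X \<in> Obj C \<Longrightarrow> iso_arrow C (TObj C X (Unit C)) X (RUnit C X)"
    and RUnit_natural: "\<lbrakk>X \<in> Obj C; Y \<in> Obj C; f \<in> Hom C X Y\<rbrakk>
      \<Longrightarrow> Comp C (TObj C X (Unit C)) (TObj C Y (Unit C)) Y
            (RUnit C Y) (TArr C X Y (Unit C) (Unit C) f (Id C (Unit C))) =
          Comp C (TObj C X (Unit C)) X Y f (RUnit C X)"
    and pentagon: "\<lbrakk>W \<in> Obj C; X \<in> Obj C; Y \<in> Obj C; Z \<in> Obj C\<rbrakk>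
      \<Longrightarrow> Comp C (TObj C (TObj C (TObj C W X) Y) Z) (TObj C (TObj C W X) (TObj C Y Z))
            (TObj C W (TObj C X (TObj C Y Z)))
            (Assoc C W X (TObj C Y Z)) (Assoc C (TObj C W X) Y Z) =
          Comp C (TObj C (TObj C (TObj C W X) Y) Z) (TObj C W (TObj C (TObj C X Y) Z))
            (TObj C W (TObj C X (TObj C Y Z)))
            (TArr C W W (TObj C (TObj C X Y) Z) (TObj C X (TObj C Y Z)) (Id C W) (Assoc C X Y Z))
            (Comp C (TObj C (TObj C (TObj C W X) Y) Z) (TObj C (TObj C W (TObj C X Y)) Z)
              (TObj C W (TObj C (TObj C X Y) Z))
              (Assoc C W (TObj C X Y) Z)
              (TArr C (TObj C (TObj C W X) Y) (TObj C W (TObj C X Y)) Z Z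
                (Assoc C W X Y) (Id C Z)))"
    and triangle: "\<lbrakk>X \<in> Obj C; Y \<in> Obj C\<rbrakk>
      \<Longrightarrow> Comp C (TObj C (TObj C X (Unit C)) Y) (TObj C X (TObj C (Unit C) Y)) (TObj C X Y)
            (TArr C X X (TObj C (Unit C) Y) Y (Id C X) (LUnit C Y))
            (Assoc C X (Unit C) Y) =
          TArr C (TObj C X (Unit C)) X Y Y (RUnit C X) (Id C Y)"

locale braided_monoidal_category = monoidal_category C for C :: "('o, 'm) monoidal_category" +
  fixes c :: "'o \<Rightarrow> 'o \<Rightarrow> 'm"
  assumes braid_iso: "\<lbrakk>X \<in> Obj C; Y \<in> Obj C\<rbrakk>
      \<Longrightarrow> iso_arrow C (TObj C X Y) (TObj C Y X) (c X Y)"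
    and braid_natural: "\<lbrakk>X \<in> Obj C; X' \<in> Obj C; Y \<in> Obj C; Y' \<in> Obj C;
        f \<in> Hom C X X'; g \<in> Hom C Y Y'\<rbrakk>
      \<Longrightarrow> Comp C (TObj C X Y) (TObj C X' Y') (TObj C Y' X') (c X' Y') (TArr C X X' Y Y' f g) =
          Comp C (TObj C X Y) (TObj C Y X) (TObj C Y' X') (TArr C Y Y' X X' g f) (c X Y)"
    and hexagon1: "\<lbrakk>X \<in> Obj C; Y \<in> Obj C; Z \<in> Obj C\<rbrakk>
      \<Longrightarrow> Comp C (TObj C (TObj C X Y) Z) (TObj C (TObj C Y Z) X) (TObj C Y (TObj C Z X))
            (Assoc C Y Z X)
            (Comp C (TObj C (TObj C X Y) Z) (TObj C X (TObj C Y Z)) (TObj C (TObj C Y Z) X)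
              (c X (TObj C Y Z)) (Assoc C X Y Z)) =
          Comp C (TObj C (TObj C X Y) Z) (TObj C Y (TObj C X Z)) (TObj C Y (TObj C Z X))
            (TArr C Y Y (TObj C X Z) (TObj C Z X) (Id C Y) (c X Z))
            (Comp C (TObj C (TObj C X Y) Z) (TObj C (TObj C Y X) Z) (TObj C Y (TObj C X Z))
              (Assoc C Y X Z)
              (TArr C (TObj C X Y) (TObj C Y X) Z Z (c X Y) (Id C Z)))"
    and hexagon2: "\<lbrakk>X \<in> Obj C; Y \<in> Obj C; Z \<in> Obj C\<rbrakk>
      \<Longrightarrow> Comp C (TObj C X (TObj C Y Z)) (TObj C Z (TObj C X Y)) (TObj C (TObj C Z X) Y)
            (inv_arrow C (TObj C (TObj C Z X) Y) (TObj C Z (TObj C X Y)) (Assoc C Z X Y))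
            (Comp C (TObj C X (TObj C Y Z)) (TObj C (TObj C X Y) Z) (TObj C Z (TObj C X Y))
              (c (TObj C X Y) Z)
              (inv_arrow C (TObj C (TObj C X Y) Z) (TObj C X (TObj C Y Z)) (Assoc C X Y Z))) =
          Comp C (TObj C X (TObj C Y Z)) (TObj C (TObj C X Z) Y) (TObj C (TObj C Z X) Y)
            (TArr C (TObj C X Z) (TObj C Z X) Y Y (c X Z) (Id C Y))
            (Comp C (TObj C X (TObj C Y Z)) (TObj C X (TObj C Z Y)) (TObj C (TObj C X Z) Y)
              (inv_arrow C (TObj C (TObj C X Z) Y) (TObj C X (TObj C Z Y)) (Assoc C X Z Y))
              (TArr C X X (TObj C Y Z) (TObj C Z Y) (Id C X) (c Y Z)))"


section \<open>The monoidal category of bimodules\<close>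

text \<open>The objects of the category are the bimodules whose carriers are sets of elements of a fixed
  type \<open>'u\<close>. The tensor product constructed above has a different type, so an isomorphic copy of it
  is transported into \<open>'u\<close> along an injection; one exists if \<open>'u\<close> is infinite, because the tensor
  product is a quotient of a free abelian group on a set of pairs. The unit object is transported
  in the same way. The choice of the injections does not matter up to monoidal equivalence.\<close>

definition to_univ :: "('l, 'r, 'm) bimod \<Rightarrow> 'm \<Rightarrow> 'u" where
  "to_univ M = (SOME e. inj_on e (carrier M))"

definition univ_copy :: "('l, 'r, 'm) bimod \<Rightarrow> ('l, 'r, 'u) bimod" where
  "univ_copy M =
    (let e = to_univ M; d = inv_into (carrier M) e in
      \<lparr>carrier = e ` carrier M, monoid.mult = undefined, one = undefined,
       ring.zero = e \<zero>\<^bsub>M\<^esub>, add = (\<lambda>x y. e (d x \<oplus>\<^bsub>M\<^esub> d y)),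
       lact = (\<lambda>a x. e (lact M a (d x))), ract = (\<lambda>x b. e (ract M (d x) b))\<rparr>)"

definition utensor ::
  "('k, 'a) module \<Rightarrow> ('a, 'a, 'u) bimod \<Rightarrow> ('a, 'a, 'u) bimod \<Rightarrow> ('a, 'a, 'u) bimod" where
  "utensor R M N = univ_copy (tensor (carrier R) M N)"

definition upure ::
  "('k, 'a) module \<Rightarrow> ('a, 'a, 'u) bimod \<Rightarrow> ('a, 'a, 'u) bimod \<Rightarrow> 'u \<Rightarrow> 'u \<Rightarrow> 'u" where
  "upure R M N x y = to_univ (tensor (carrier R) M N) (pure_tensor (carrier R) M N x y)"

definition uunit :: "('k, 'a) module \<Rightarrow> ('a, 'a, 'u) bimod" where
  "uunit R = univ_copy (regular_bimod R)"

text \<open>The monoidal category of modules over the enveloping algebra of \<open>R\<close>, with the tensor product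
  over \<open>R\<close>. The arrows are extensional functions. The structure arrows are the unique bimodule
  homomorphisms with the usual values on pure tensors.\<close>

definition bimod_category ::
  "'k ring \<Rightarrow> ('k, 'a) module \<Rightarrow> (('a, 'a, 'u) bimod, 'u \<Rightarrow> 'u) monoidal_category" where
  "bimod_category K R =
    \<lparr>Obj = {M. ev_module K R M},
     Hom = bimod_hom R,
     Id = (\<lambda>M. \<lambda>x\<in>carrier M. x),
     Comp = (\<lambda>M N P g f. compose (carrier M) g f),
     TObj = utensor R,
     TArr = (\<lambda>M M' N N' f g.
       THE h. h \<in> bimod_hom R (utensor R M N) (utensor R M' N') \<and>
         (\<forall>x\<in>carrier M. \<forall>y\<in>carrier N. h (upure R M N x y) = upure R M' N' (f x) (g y))),
     Unit = uunit R,
     Assoc = (\<lambda>M N P.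
       THE h. h \<in> bimod_hom R (utensor R (utensor R M N) P) (utensor R M (utensor R N P)) \<and>
         (\<forall>x\<in>carrier M. \<forall>y\<in>carrier N. \<forall>z\<in>carrier P.
            h (upure R (utensor R M N) P (upure R M N x y) z) =
            upure R M (utensor R N P) x (upure R N P y z))),
     LUnit = (\<lambda>M.
       THE h. h \<in> bimod_hom R (utensor R (uunit R) M) M \<and>
         (\<forall>r\<in>carrier R. \<forall>x\<in>carrier M.
            h (upure R (uunit R) M (to_univ (regular_bimod R) r) x) = lact M r x)),
     RUnit = (\<lambda>M.
       THE h. h \<in> bimod_hom R (utensor R M (uunit R)) M \<and>
         (\<forall>r\<in>carrier R. \<forall>x\<in>carrier M.
            h (upure R M (uunit R) x (to_univ (regular_bimod R) r)) = ract M x r))\<rparr>"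


section \<open>Hochschild cohomology\<close>

text \<open>A cochain of degree \<open>n\<close>, that is, a \<open>K\<close>-linear map from the \<open>n\<close>-th tensor power of \<open>A\<close> to \<open>M\<close>,
  is given as a \<open>K\<close>-multilinear function on the lists of \<open>n\<close> elements of \<open>A\<close>, made extensional. The
  degree is an integer; in negative degree there are no lists and hence exactly one cochain, so
  that the cochain group and the cohomology are trivial there.\<close>

definition tuples :: "('k, 'a) module \<Rightarrow> int \<Rightarrow> 'a list set" where
  "tuples A n = {as. set as \<subseteq> carrier A \<and> int (length as) = n}"

definition cochains ::
  "'k ring \<Rightarrow> ('k, 'a) module \<Rightarrow> ('a, 'a, 'm) bimod \<Rightarrow> int \<Rightarrow> ('a list \<Rightarrow> 'm) set" where
  "cochains K A M n = {f \<in> tuples A n \<rightarrow>\<^sub>E carrier M.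
     (\<forall>as bs x y. as @ x # bs \<in> tuples A n \<and> as @ y # bs \<in> tuples A n \<longrightarrow>
        f (as @ (x \<oplus>\<^bsub>A\<^esub> y) # bs) = f (as @ x # bs) \<oplus>\<^bsub>M\<^esub> f (as @ y # bs)) \<and>
     (\<forall>as bs x. \<forall>k\<in>carrier K. as @ x # bs \<in> tuples A n \<longrightarrow>
        f (as @ (k \<odot>\<^bsub>A\<^esub> x) # bs) = lact M (k \<odot>\<^bsub>A\<^esub> \<one>\<^bsub>A\<^esub>) (f (as @ x # bs)))}"

text \<open>The list \<open>[]\<close> occurs only for the differential out of degree \<open>-1\<close>, which is zero. The indices
  are shifted by one, because lists are indexed from 0.\<close>

definition coboundary ::
  "('k, 'a) module \<Rightarrow> ('a, 'a, 'm) bimod \<Rightarrow> int \<Rightarrow> ('a list \<Rightarrow> 'm) \<Rightarrow> 'a list \<Rightarrow> 'm" where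
  "coboundary A M n f = (\<lambda>as\<in>tuples A (n + 1).
     if as = [] then \<zero>\<^bsub>M\<^esub>
     else lact M (hd as) (f (tl as))
       \<oplus>\<^bsub>M\<^esub> (\<Oplus>\<^bsub>M\<^esub>i\<in>{..<length as - 1}. add_pow M ((-1) ^ Suc i :: int)
              (f (take i as @ (as ! i \<otimes>\<^bsub>A\<^esub> as ! Suc i) # drop (i + 2) as)))
       \<oplus>\<^bsub>M\<^esub> add_pow M ((-1) ^ length as :: int) (ract M (f (butlast as)) (last as)))"

definition cocycle_group ::
  "'k ring \<Rightarrow> ('k, 'a) module \<Rightarrow> ('a, 'a, 'm) bimod \<Rightarrow> int \<Rightarrow> ('a list \<Rightarrow> 'm) monoid" where
  "cocycle_group K A M n =
    \<lparr>carrier = {f \<in> cochains K A M n. coboundary A M n f = (\<lambda>as\<in>tuples A (n + 1). \<zero>\<^bsub>M\<^esub>)},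
     monoid.mult = (\<lambda>f g. \<lambda>as\<in>tuples A n. f as \<oplus>\<^bsub>M\<^esub> g as),
     one = (\<lambda>as\<in>tuples A n. \<zero>\<^bsub>M\<^esub>)\<rparr>"

definition coboundaries ::
  "'k ring \<Rightarrow> ('k, 'a) module \<Rightarrow> ('a, 'a, 'm) bimod \<Rightarrow> int \<Rightarrow> ('a list \<Rightarrow> 'm) set" where
  "coboundaries K A M n = coboundary A M (n - 1) ` cochains K A M (n - 1)"

definition HH ::
  "'k ring \<Rightarrow> ('k, 'a) module \<Rightarrow> ('a, 'a, 'm) bimod \<Rightarrow> int \<Rightarrow> ('a list \<Rightarrow> 'm) set monoid" where
  "HH K A M n = cocycle_group K A M n Mod coboundaries K A M n"

definition bullet ::
  "('k, 'a) module \<Rightarrow> ('a, 'a, 'm) bimod \<Rightarrow> int \<Rightarrow> ('a list \<Rightarrow> 'm) \<Rightarrow> 'a \<Rightarrow> 'a list \<Rightarrow> 'm" where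
  "bullet A M n f z = (\<lambda>as\<in>tuples A (n - 1).
     \<Oplus>\<^bsub>M\<^esub>i\<in>{..length as}. add_pow M ((-1) ^ i :: int) (f (take i as @ z # drop i as)))"

text \<open>The map induced on cohomology; the cosets in the union coincide, since the class of
  \<open>bullet A M n f z\<close> depends only on the class of \<open>f\<close>.\<close>

definition bracket ::
  "'k ring \<Rightarrow> ('k, 'a) module \<Rightarrow> ('a, 'a, 'm) bimod \<Rightarrow> int
    \<Rightarrow> ('a list \<Rightarrow> 'm) set \<Rightarrow> 'a \<Rightarrow> ('a list \<Rightarrow> 'm) set" where
  "bracket K A M n \<phi> z =
    (\<Union>f\<in>\<phi>. coboundaries K A M (n - 1) #>\<^bsub>cocycle_group K A M (n - 1)\<^esub> bullet A M n f z)"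

end

theory Submission
  imports Defs "HOL-Algebra.Ideal"
begin

text \<open>Everything is reduced to the statement that \<open>Z(A)\<close> is the image \<open>K \<odot> \<one>\<close> of \<open>K\<close>. If \<open>z \<otimes> \<one> = \<one> \<otimes> z\<close>
  in \<open>A \<otimes> A\<close>, then \<open>\<phi> z \<odot> \<one> = \<phi> \<one> \<odot> z\<close> for all linear forms \<open>\<phi>\<close>; as \<open>A\<close> is projective, the values
  \<open>\<phi> \<one>\<close> generate a finitely generated idempotent ideal, and by Nakayama's lemma it contains a scalar that
  acts on \<open>A\<close> as \<open>\<one>\<close>, so that \<open>z\<close> is itself a scalar. When the center consists of scalars, it acts
  symmetrically on all its enveloping modules, and the flip is a braiding. Conversely, a braiding
  \<open>M \<otimes> I \<rightarrow> I \<otimes> M\<close> with the unit object is the canonical isomorphism, and its naturality under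
  multiplication by \<open>z\<close> on \<open>I\<close> says \<open>m z = z m\<close>.

  For the vanishing of the bracket, inserting a scalar \<open>z\<close> into a cocycle \<open>f\<close> is \<open>z\<close> times inserting
  \<open>\<one>\<close>. The latter is the coboundary of \<open>- (\<Sum>j. f (\<dots>, \<one>, \<one>, \<dots>))\<close>, with two adjacent units at
  position \<open>j\<close>: evaluate the cocycle condition at the lists with two adjacent units and sum.\<close>

section \<open>Tensor products of bimodules\<close>

text \<open>The ideal in the Nakayama step may be proper, because K need not act faithfully on A; so
  z is recovered from a scalar that fixes A and not from the unit of K. Such a scalar suffices
  because the c in K with c z in K 1 form an ideal containing all values phi 1.

  The other obstacle is size. The statements about all modules, and projectivity itself, quantify
  over carriers in the universe \<open>'u\<close>, while the tensor products, the unit object and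
  the free module covering A have types of their own. Each of them is bounded by the infinite type
  \<open>'u\<close> and replaced by an isomorphic copy; the codings stay inside a few interface
  lemmas, and all further arguments run on elements.

  The structure arrows of the category are definite descriptions, so unique existence has to be
  shown before anything can be said about them. Afterwards each coherence law is an equality of
  homomorphisms out of an iterated tensor product and can be read off on pure tensors.\<close>

definition add_hom :: "('a, 'm) ring_scheme \<Rightarrow> ('b, 'n) ring_scheme \<Rightarrow> ('a \<Rightarrow> 'b) set" where
  "add_hom G H = {f \<in> carrier G \<rightarrow> carrier H.
     \<forall>x\<in>carrier G. \<forall>y\<in>carrier G. f (x \<oplus>\<^bsub>G\<^esub> y) = f x \<oplus>\<^bsub>H\<^esub> f y}"

lemma add_hom_closed: "\<lbrakk>f \<in> add_hom G H; x \<in> carrier G\<rbrakk> \<Longrightarrow> f x \<in> carrier H"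
  by (auto simp: add_hom_def)

lemma add_hom_add:
  "\<lbrakk>f \<in> add_hom G H; x \<in> carrier G; y \<in> carrier G\<rbrakk> \<Longrightarrow> f (x \<oplus>\<^bsub>G\<^esub> y) = f x \<oplus>\<^bsub>H\<^esub> f y"
  by (auto simp: add_hom_def)

lemma add_hom_zero:
  assumes "abelian_group G" "abelian_group H" "f \<in> add_hom G H"
  shows "f \<zero>\<^bsub>G\<^esub> = \<zero>\<^bsub>H\<^esub>"
proof -
  interpret G: abelian_group G by fact
  interpret H: abelian_group H by fact
  have "f \<zero>\<^bsub>G\<^esub> \<oplus>\<^bsub>H\<^esub> f \<zero>\<^bsub>G\<^esub> = f \<zero>\<^bsub>G\<^esub>"
    using add_hom_add[OF assms(3), of "\<zero>\<^bsub>G\<^esub>" "\<zero>\<^bsub>G\<^esub>"] by simp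
  then show ?thesis
    using add_hom_closed[OF assms(3)] H.add.l_cancel_one' by fastforce
qed

lemma add_hom_minus:
  assumes "abelian_group G" "abelian_group H" "f \<in> add_hom G H" "x \<in> carrier G"
  shows "f (\<ominus>\<^bsub>G\<^esub> x) = \<ominus>\<^bsub>H\<^esub> f x"
proof -
  interpret G: abelian_group G by fact
  interpret H: abelian_group H by fact
  have "f (\<ominus>\<^bsub>G\<^esub> x) \<oplus>\<^bsub>H\<^esub> f x = \<zero>\<^bsub>H\<^esub>"
    using add_hom_add[OF assms(3), of "\<ominus>\<^bsub>G\<^esub> x" x] assms(4) add_hom_zero[OF assms(1-3)]
    by (simp add: G.l_neg)
  then show ?thesis
    using add_hom_closed[OF assms(3)] assms(4) H.minus_equality by fastforce
qed

text \<open>The target is an arbitrary additive group, because maps into bimodules and a map into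
  the algebra itself are both induced in this way.\<close>

definition balanced_map ::
  "'r set \<Rightarrow> ('l, 'r, 'm) bimod \<Rightarrow> ('r, 's, 'n) bimod \<Rightarrow> ('g, 'x) ring_scheme
    \<Rightarrow> ('m \<Rightarrow> 'n \<Rightarrow> 'g) \<Rightarrow> bool" where
  "balanced_map R M N G b \<longleftrightarrow>
     (\<forall>y\<in>carrier N. (\<lambda>x. b x y) \<in> add_hom M G) \<and>
     (\<forall>x\<in>carrier M. b x \<in> add_hom N G) \<and>
     (\<forall>x\<in>carrier M. \<forall>r\<in>R. \<forall>y\<in>carrier N. b (ract M x r) y = b x (lact N r y))"

lemma balanced_mapI:
  assumes "\<And>x y. \<lbrakk>x \<in> carrier M; y \<in> carrier N\<rbrakk> \<Longrightarrow> b x y \<in> carrier G"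
    and "\<And>x x' y. \<lbrakk>x \<in> carrier M; x' \<in> carrier M; y \<in> carrier N\<rbrakk>
      \<Longrightarrow> b (x \<oplus>\<^bsub>M\<^esub> x') y = b x y \<oplus>\<^bsub>G\<^esub> b x' y"
    and "\<And>x y y'. \<lbrakk>x \<in> carrier M; y \<in> carrier N; y' \<in> carrier N\<rbrakk>
      \<Longrightarrow> b x (y \<oplus>\<^bsub>N\<^esub> y') = b x y \<oplus>\<^bsub>G\<^esub> b x y'"
    and "\<And>x r y. \<lbrakk>x \<in> carrier M; r \<in> R; y \<in> carrier N\<rbrakk>
      \<Longrightarrow> b (ract M x r) y = b x (lact N r y)"
  shows "balanced_map R M N G b"
  using assms by (auto simp: balanced_map_def add_hom_def)

lemma balanced_mapD:
  assumes "balanced_map R M N G b"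
  shows balanced_map_closed: "\<lbrakk>x \<in> carrier M; y \<in> carrier N\<rbrakk> \<Longrightarrow> b x y \<in> carrier G"
    and balanced_map_add_left: "\<lbrakk>x \<in> carrier M; x' \<in> carrier M; y \<in> carrier N\<rbrakk>
      \<Longrightarrow> b (x \<oplus>\<^bsub>M\<^esub> x') y = b x y \<oplus>\<^bsub>G\<^esub> b x' y"
    and balanced_map_add_right: "\<lbrakk>x \<in> carrier M; y \<in> carrier N; y' \<in> carrier N\<rbrakk>
      \<Longrightarrow> b x (y \<oplus>\<^bsub>N\<^esub> y') = b x y \<oplus>\<^bsub>G\<^esub> b x y'"
    and balanced_map_balanced: "\<lbrakk>x \<in> carrier M; r \<in> R; y \<in> carrier N\<rbrakk>
      \<Longrightarrow> b (ract M x r) y = b x (lact N r y)"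
  using assms by (auto simp: balanced_map_def add_hom_def)

text \<open>The three rings are kept apart to cover two cases: all of them equal in the monoidal
  category, and A, K, A for the outer bimodule.\<close>

locale tensor_pair = M: bimodule L R M + N: bimodule R S N
  for L :: "('l, 'c) ring_scheme" and R :: "('r, 'd) ring_scheme" and S :: "('s, 'e) ring_scheme"
    and M :: "('l, 'r, 'm) bimod" and N :: "('r, 's, 'n) bimod"
begin

abbreviation "F \<equiv> tensor_free M N"
abbreviation "H \<equiv> tensor_rels (carrier R) M N"
abbreviation "T \<equiv> tensor (carrier R) M N"
abbreviation "pure \<equiv> pure_tensor (carrier R) M N"

text \<open>Chains and cosets are rephrased through the arithmetic of finitely supported integer
  functions, where addition is total and commutative, so that coset computations become ordinary
  algebra.\<close>

definition chains :: "('m \<times> 'n \<Rightarrow>\<^sub>0 int) set" where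
  "chains = {t. Poly_Mapping.keys t \<subseteq> carrier M \<times> carrier N}"

definition cls :: "('m \<times> 'n \<Rightarrow>\<^sub>0 int) \<Rightarrow> ('m \<times> 'n \<Rightarrow>\<^sub>0 int) set" where
  "cls t = (\<lambda>h. h + t) ` H"

lemma chains_closed:
  "0 \<in> chains" "s \<in> chains \<Longrightarrow> t \<in> chains \<Longrightarrow> s + t \<in> chains"
  "s \<in> chains \<Longrightarrow> t \<in> chains \<Longrightarrow> s - t \<in> chains" "s \<in> chains \<Longrightarrow> - s \<in> chains"
  "\<lbrakk>x \<in> carrier M; y \<in> carrier N\<rbrakk> \<Longrightarrow> frag_of (x, y) \<in> chains"
proof -
  show "s \<in> chains \<Longrightarrow> t \<in> chains \<Longrightarrow> s + t \<in> chains"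
    using keys_add[of s t] by (auto simp: chains_def)
  show "s \<in> chains \<Longrightarrow> t \<in> chains \<Longrightarrow> s - t \<in> chains"
    using keys_diff[of s t] by (auto simp: chains_def)
qed (auto simp: chains_def)

lemma carrier_F: "carrier F = chains"
  by (auto simp: tensor_free_def chains_def free_Abelian_group_def)

lemma F_ops [simp]:
  "x \<otimes>\<^bsub>F\<^esub> y = x + y" "\<one>\<^bsub>F\<^esub> = 0" "t \<in> chains \<Longrightarrow> inv\<^bsub>F\<^esub> t = - t"
  by (auto simp: tensor_free_def chains_def)

lemma group_F: "group F"
  by (simp add: tensor_free_def)

lemma chains_induct [consumes 1, case_names zero pure diff]:
  assumes "t \<in> chains" "P 0" "\<And>x y. \<lbrakk>x \<in> carrier M; y \<in> carrier N\<rbrakk> \<Longrightarrow> P (frag_of (x, y))"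
    "\<And>s t. \<lbrakk>s \<in> chains; t \<in> chains; P s; P t\<rbrakk> \<Longrightarrow> P (s - t)"
  shows "P t"
  using assms(1) unfolding chains_def mem_Collect_eq
  by (rule free_Abelian_group_induct) (use assms in \<open>auto simp: chains_def\<close>)

definition rel_gens :: "('m \<times> 'n \<Rightarrow>\<^sub>0 int) set" where
  "rel_gens = {frag_of (x \<oplus>\<^bsub>M\<^esub> x', y) - frag_of (x, y) - frag_of (x', y) | x x' y.
        x \<in> carrier M \<and> x' \<in> carrier M \<and> y \<in> carrier N} \<union>
     {frag_of (x, y \<oplus>\<^bsub>N\<^esub> y') - frag_of (x, y) - frag_of (x, y') | x y y'.
        x \<in> carrier M \<and> y \<in> carrier N \<and> y' \<in> carrier N} \<union>
     {frag_of (ract M x r, y) - frag_of (x, lact N r y) | x r y.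
        x \<in> carrier M \<and> r \<in> carrier R \<and> y \<in> carrier N}"

lemma H_generate: "H = generate F rel_gens"
  by (simp add: tensor_rels_def rel_gens_def)

lemma rel_gens_chains: "rel_gens \<subseteq> chains"
  unfolding rel_gens_def
  by (auto intro!: chains_closed M.add.m_closed N.add.m_closed M.ract_closed N.lact_closed)

lemma subgroup_H: "subgroup H F"
  unfolding H_generate
  by (rule group.generate_is_subgroup[OF group_F]) (use rel_gens_chains carrier_F in auto)

lemma H_closed:
  "H \<subseteq> chains" "0 \<in> H" "s \<in> H \<Longrightarrow> t \<in> H \<Longrightarrow> s + t \<in> H" "s \<in> H \<Longrightarrow> - s \<in> H"
  "s \<in> H \<Longrightarrow> t \<in> H \<Longrightarrow> s - t \<in> H"
proof -
  interpret subgroup H F by (rule subgroup_H)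
  show sub: "H \<subseteq> chains" using subset carrier_F by simp
  show "0 \<in> H" using one_closed by simp
  show *: "s \<in> H \<Longrightarrow> t \<in> H \<Longrightarrow> s + t \<in> H" for s t using m_closed[of s t] by simp
  show neg: "s \<in> H \<Longrightarrow> - s \<in> H" for s using m_inv_closed[of s] F_ops(3)[of s] sub by (metis subsetD)
  show "s \<in> H \<Longrightarrow> t \<in> H \<Longrightarrow> s - t \<in> H" using *[of s "- t"] neg[of t] by simp
qed

lemma H_induct [consumes 1, case_names gen zero add neg]:
  assumes "t \<in> H" "\<And>t. t \<in> rel_gens \<Longrightarrow> P t" "P 0"
    "\<And>s t. \<lbrakk>s \<in> H; t \<in> H; P s; P t\<rbrakk> \<Longrightarrow> P (s + t)" "\<And>t. \<lbrakk>t \<in> H; P t\<rbrakk> \<Longrightarrow> P (- t)"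
  shows "P t"
  using assms(1) unfolding H_generate
proof (induction rule: generate.induct)
  case one
  then show ?case using assms(3) by simp
next
  case (incl h)
  then show ?case using assms(2) by simp
next
  case (inv h)
  then have "h \<in> chains" "h \<in> H"
    using rel_gens_chains by (auto simp: H_generate intro: generate.incl)
  then show ?case using inv assms(2,5) by simp
next
  case (eng h1 h2)
  then show ?case using assms(4) by (simp add: H_generate)
qed

lemma r_coset_eq_cls: "H #>\<^bsub>F\<^esub> t = cls t"
  by (auto simp: r_coset_def cls_def)

lemma pure_eq_cls: "pure x y = cls (frag_of (x, y))"
  by (simp add: pure_tensor_def r_coset_eq_cls)

lemma cls_eqI:
  assumes "s - t \<in> H"
  shows "cls s = cls t"
proof -
  show ?thesis
  proof (intro equalityI subsetI)
    fix u assume "u \<in> cls s"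
    then obtain h where h: "h \<in> H" "u = h + s" unfolding cls_def by blast
    then have "u = (h + (s - t)) + t" by simp
    then show "u \<in> cls t" unfolding cls_def using H_closed(3)[OF h(1) assms] by (rule image_eqI)
  next
    fix u assume "u \<in> cls t"
    then obtain h where h: "h \<in> H" "u = h + t" unfolding cls_def by blast
    then have "u = (h - (s - t)) + s" by simp
    then show "u \<in> cls s" unfolding cls_def using H_closed(5)[OF h(1) assms] by (rule image_eqI)
  qed
qed

lemma mem_clsD: "s \<in> cls t \<Longrightarrow> s - t \<in> H"
  by (auto simp: cls_def)

lemma mem_cls_self: "t \<in> cls t"
  using H_closed(2) by (force simp: cls_def)

lemma mem_cls_chains: "t \<in> chains \<Longrightarrow> s \<in> cls t \<Longrightarrow> s \<in> chains"
  using H_closed(1) by (auto simp: cls_def intro: chains_closed)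

lemma carrier_T: "carrier T = cls ` chains"
  by (auto simp: tensor_def Let_def FactGroup_def RCOSETS_def r_coset_eq_cls carrier_F)

lemma zero_T: "\<zero>\<^bsub>T\<^esub> = cls 0"
  by (simp add: tensor_def Let_def FactGroup_def cls_def)

lemma add_T: "cls s \<oplus>\<^bsub>T\<^esub> cls t = cls (s + t)"
proof -
  have "(\<Union>h\<in>cls s. \<Union>k\<in>cls t. {h + k}) = cls (s + t)"
  proof (intro equalityI subsetI)
    fix x assume "x \<in> (\<Union>h\<in>cls s. \<Union>k\<in>cls t. {h + k})"
    then obtain h k where "h \<in> H" "k \<in> H" "x = (h + s) + (k + t)" by (auto simp: cls_def)
    then have "h + k \<in> H" "x = (h + k) + (s + t)" by (auto simp: H_closed algebra_simps)
    then show "x \<in> cls (s + t)" by (auto simp: cls_def)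
  next
    fix x assume "x \<in> cls (s + t)"
    then obtain h where "h \<in> H" "x = (h + s) + t" by (auto simp: cls_def algebra_simps)
    then show "x \<in> (\<Union>h\<in>cls s. \<Union>k\<in>cls t. {h + k})"
      using mem_cls_self[of t] unfolding cls_def by blast
  qed
  then show ?thesis
    by (simp add: tensor_def Let_def FactGroup_def set_mult_def)
qed

lemma abelian_group_T: "abelian_group T"
proof (rule abelian_groupI; unfold carrier_T zero_T)
  fix x y z assume "x \<in> cls ` chains" "y \<in> cls ` chains" "z \<in> cls ` chains"
  then show "x \<oplus>\<^bsub>T\<^esub> y \<in> cls ` chains" "x \<oplus>\<^bsub>T\<^esub> y \<oplus>\<^bsub>T\<^esub> z = x \<oplus>\<^bsub>T\<^esub> (y \<oplus>\<^bsub>T\<^esub> z)"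
    "x \<oplus>\<^bsub>T\<^esub> y = y \<oplus>\<^bsub>T\<^esub> x"
    by (auto simp: add_T chains_closed ac_simps)
next
  fix x assume "x \<in> cls ` chains"
  then obtain t where t: "t \<in> chains" "x = cls t" by auto
  then show "cls 0 \<oplus>\<^bsub>T\<^esub> x = x" by (simp add: add_T)
  show "\<exists>y\<in>cls ` chains. y \<oplus>\<^bsub>T\<^esub> x = cls 0"
    using t by (intro bexI[of _ "cls (- t)"]) (auto simp: add_T chains_closed)
qed (auto simp: chains_closed)

lemma pure_closed: "\<lbrakk>x \<in> carrier M; y \<in> carrier N\<rbrakk> \<Longrightarrow> pure x y \<in> carrier T"
  by (auto simp: pure_eq_cls carrier_T chains_closed)

lemma H_gen: "t \<in> rel_gens \<Longrightarrow> t \<in> H"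
  by (simp add: H_generate generate.incl)

lemma H_add_left:
  "\<lbrakk>x \<in> carrier M; x' \<in> carrier M; y \<in> carrier N\<rbrakk>
    \<Longrightarrow> frag_of (x \<oplus>\<^bsub>M\<^esub> x', y) - frag_of (x, y) - frag_of (x', y) \<in> H"
  by (rule H_gen) (unfold rel_gens_def, blast)

lemma H_add_right:
  "\<lbrakk>x \<in> carrier M; y \<in> carrier N; y' \<in> carrier N\<rbrakk>
    \<Longrightarrow> frag_of (x, y \<oplus>\<^bsub>N\<^esub> y') - frag_of (x, y) - frag_of (x, y') \<in> H"
  by (rule H_gen) (unfold rel_gens_def, blast)

lemma H_balanced:
  "\<lbrakk>x \<in> carrier M; r \<in> carrier R; y \<in> carrier N\<rbrakk>
    \<Longrightarrow> frag_of (ract M x r, y) - frag_of (x, lact N r y) \<in> H"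
  by (rule H_gen) (unfold rel_gens_def, blast)

lemma pure_add_left:
  "\<lbrakk>x \<in> carrier M; x' \<in> carrier M; y \<in> carrier N\<rbrakk>
    \<Longrightarrow> pure (x \<oplus>\<^bsub>M\<^esub> x') y = pure x y \<oplus>\<^bsub>T\<^esub> pure x' y"
  unfolding pure_eq_cls add_T using H_add_left[of x x' y] by (intro cls_eqI) (simp add: diff_diff_eq)

lemma pure_add_right:
  "\<lbrakk>x \<in> carrier M; y \<in> carrier N; y' \<in> carrier N\<rbrakk>
    \<Longrightarrow> pure x (y \<oplus>\<^bsub>N\<^esub> y') = pure x y \<oplus>\<^bsub>T\<^esub> pure x y'"
  unfolding pure_eq_cls add_T using H_add_right[of x y y'] by (intro cls_eqI) (simp add: diff_diff_eq)

lemma pure_balanced: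
  "\<lbrakk>x \<in> carrier M; r \<in> carrier R; y \<in> carrier N\<rbrakk>
    \<Longrightarrow> pure (ract M x r) y = pure x (lact N r y)"
  unfolding pure_eq_cls by (intro cls_eqI H_balanced)

lemma balanced_map_pure: "balanced_map (carrier R) M N T pure"
  by (intro balanced_mapI pure_closed pure_add_left pure_add_right pure_balanced)

text \<open>Differences are not needed, because \<open>- (x \<otimes> y) = (- x) \<otimes> y\<close>.\<close>

lemma tensor_induct [consumes 1, case_names pure add]:
  assumes "X \<in> carrier T"
    and pure: "\<And>x y. \<lbrakk>x \<in> carrier M; y \<in> carrier N\<rbrakk> \<Longrightarrow> P (pure x y)"
    and add: "\<And>X Y. \<lbrakk>X \<in> carrier T; Y \<in> carrier T; P X; P Y\<rbrakk> \<Longrightarrow> P (X \<oplus>\<^bsub>T\<^esub> Y)"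
  shows "P X"
proof -
  interpret T: abelian_group T by (rule abelian_group_T)
  have hom: "y \<in> carrier N \<Longrightarrow> (\<lambda>x. pure x y) \<in> add_hom M T" for y
    using balanced_map_pure by (simp add: balanced_map_def)
  have pure_zero: "pure \<zero>\<^bsub>M\<^esub> y = cls 0" if "y \<in> carrier N" for y
    using add_hom_zero[OF M.abelian_group_axioms abelian_group_T hom[OF that]] zero_T by simp
  have neg: "cls (- frag_of (x, y)) = pure (\<ominus>\<^bsub>M\<^esub> x) y" if "x \<in> carrier M" "y \<in> carrier N" for x y
  proof -
    have "cls (- frag_of (x, y)) \<oplus>\<^bsub>T\<^esub> pure x y = \<zero>\<^bsub>T\<^esub>"
      by (simp add: pure_eq_cls add_T zero_T)
    then have "cls (- frag_of (x, y)) = \<ominus>\<^bsub>T\<^esub> pure x y"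
      using that by (intro T.minus_equality[symmetric] pure_closed)
        (auto simp: carrier_T chains_closed)
    then show ?thesis
      using add_hom_minus[OF M.abelian_group_axioms abelian_group_T hom[OF that(2)] that(1)] by simp
  qed
  obtain t where t: "t \<in> chains" "X = cls t" using assms(1) carrier_T by auto
  \<comment> \<open>Induction on chains proceeds by differences, whereas \<open>P\<close> is only
    stable under sums; carrying \<open>t\<close> and \<open>- t\<close> together turns each
    difference into a sum.\<close>
  have "P (cls t) \<and> P (cls (- t))"
    using t(1)
  proof (induction rule: chains_induct)
    case zero
    show ?case using pure_zero[of "\<zero>\<^bsub>N\<^esub>"] pure[of "\<zero>\<^bsub>M\<^esub>" "\<zero>\<^bsub>N\<^esub>"] by simp
  next
    case (pure x y)
    then show ?case using assms(2)[of x y] assms(2)[of "\<ominus>\<^bsub>M\<^esub> x" y] neg[of x y]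
      by (simp add: pure_eq_cls)
  next
    case (diff s t)
    then have "P (cls s \<oplus>\<^bsub>T\<^esub> cls (- t))" "P (cls (- s) \<oplus>\<^bsub>T\<^esub> cls t)"
      by (auto intro!: add simp: carrier_T chains_closed)
    then show ?case by (simp add: add_T)
  qed
  then show ?thesis using t by simp
qed

text \<open>The map \<open>b\<close> extends to the free group, and the three clauses of
  balancedness say exactly that the three families of relations go to zero; the extension is
  therefore constant on cosets.\<close>

lemma tensor_lift:
  assumes G: "abelian_group G" and b: "balanced_map (carrier R) M N G b"
  obtains h where "h \<in> add_hom T G"
    "\<And>x y. \<lbrakk>x \<in> carrier M; y \<in> carrier N\<rbrakk> \<Longrightarrow> h (pure x y) = b x y"
proof -
  interpret G: abelian_group G by fact
  note b = balanced_mapD[OF b]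
  have "(\<lambda>(x, y). b x y) ` (carrier M \<times> carrier N) \<subseteq> carrier G"
    using b(1) by auto
  then obtain \<phi> where
      hom: "\<phi> \<in> hom (free_Abelian_group (carrier M \<times> carrier N)) (add_monoid G)"
    and val': "\<And>z. z \<in> carrier M \<times> carrier N \<Longrightarrow> \<phi> (frag_of z) = (case z of (x, y) \<Rightarrow> b x y)"
    by (rule G.add.free_Abelian_group_universal) blast
  have val: "\<phi> (frag_of (x, y)) = b x y" if "x \<in> carrier M" "y \<in> carrier N" for x y
    using val'[of "(x, y)"] that by simp
  have closed: "\<phi> t \<in> carrier G" if "t \<in> chains" for t
    using hom that by (auto simp: hom_def chains_def)
  have add: "\<phi> (s + t) = \<phi> s \<oplus>\<^bsub>G\<^esub> \<phi> t" if "s \<in> chains" "t \<in> chains" for s t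
    using hom that by (auto simp: hom_def chains_def)
  have zero: "\<phi> 0 = \<zero>\<^bsub>G\<^esub>"
    using add[of 0 0] closed[of 0] G.add.l_cancel_one'[of "\<phi> 0" "\<phi> 0"] by (simp add: chains_closed)
  have neg: "\<phi> (- t) = \<ominus>\<^bsub>G\<^esub> \<phi> t" if "t \<in> chains" for t
    using add[of "- t" t] closed that zero by (intro G.minus_equality[symmetric]) (auto simp: chains_closed)
  have diff: "\<phi> (s - t) = \<phi> s \<ominus>\<^bsub>G\<^esub> \<phi> t" if "s \<in> chains" "t \<in> chains" for s t
    using add[of s "- t"] neg that by (auto simp: chains_closed G.minus_eq)
  have kernel: "\<phi> t = \<zero>\<^bsub>G\<^esub>" if "t \<in> H" for t
    using that
  proof (induction rule: H_induct)
    case (gen t)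
    have cancel: "u \<oplus>\<^bsub>G\<^esub> v \<ominus>\<^bsub>G\<^esub> u \<ominus>\<^bsub>G\<^esub> v = \<zero>\<^bsub>G\<^esub>" if "u \<in> carrier G" "v \<in> carrier G" for u v
      using that by (simp add: G.a_comm[of u v] G.minus_eq G.a_assoc G.r_neg)
    show ?case using gen
      by (auto simp: rel_gens_def diff chains_closed val b M.ract_closed N.lact_closed cancel)
        (simp add: G.minus_eq G.r_neg b N.lact_closed)
  qed (simp_all add: zero add neg subsetD[OF H_closed(1)])
  \<comment> \<open>A coset is evaluated at an arbitrarily chosen member; by \<open>kernel\<close>
    any other representative gives the same value.\<close>
  define h where "h X = \<phi> (SOME t. t \<in> X)" for X
  have h: "h (cls t) = \<phi> t" if "t \<in> chains" for t
  proof -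
    define s where "s = (SOME s. s \<in> cls t)"
    have s: "s \<in> cls t" unfolding s_def using mem_cls_self by (rule someI)
    have "\<phi> s \<ominus>\<^bsub>G\<^esub> \<phi> t = \<zero>\<^bsub>G\<^esub>"
      using kernel[OF mem_clsD[OF s]] diff[OF mem_cls_chains[OF that s] that] by simp
    then show ?thesis
      using G.minus_equality[of "\<phi> s" "\<ominus>\<^bsub>G\<^esub> \<phi> t"] closed[OF mem_cls_chains[OF that s]] closed[OF that]
      by (simp add: G.minus_eq h_def flip: s_def)
  qed
  show thesis
  proof
    show "h \<in> add_hom T G"
      by (auto simp: add_hom_def carrier_T add_T h chains_closed closed add)
    show "h (pure x y) = b x y" if "x \<in> carrier M" "y \<in> carrier N" for x y
      using that by (simp add: pure_eq_cls h chains_closed val)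
  qed
qed

text \<open>Treats both outer actions at once: one of \<open>f\<close>, \<open>g\<close> is an
  action and the other the identity. Since the relations are mapped into the relations, all cosets
  in the union that defines the action coincide.\<close>

lemma outer_action:
  assumes f: "f \<in> add_hom M M" and g: "g \<in> add_hom N N"
    and fg: "\<And>x r y. \<lbrakk>x \<in> carrier M; r \<in> carrier R; y \<in> carrier N\<rbrakk>
      \<Longrightarrow> f (ract M x r) = ract M (f x) r \<and> g (lact N r y) = lact N r (g y)"
    and t: "t \<in> chains"
  shows "(\<Union>t\<in>cls t. H #>\<^bsub>F\<^esub> frag_extend (\<lambda>(x, y). frag_of (f x, g y)) t) =
      cls (frag_extend (\<lambda>(x, y). frag_of (f x, g y)) t)"
    and "frag_extend (\<lambda>(x, y). frag_of (f x, g y)) t \<in> chains"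
proof -
  let ?e = "frag_extend (\<lambda>(x, y). frag_of (f x, g y))"
  note closed = add_hom_closed[OF f] add_hom_closed[OF g]
  have chains: "?e t \<in> chains" if "t \<in> chains" for t
    using that by (induction rule: chains_induct) (auto simp: chains_closed frag_extend_diff closed)
  show "?e t \<in> chains" by (rule chains[OF t])
  have H: "?e s \<in> H" if "s \<in> H" for s
    using that
  proof (induction rule: H_induct)
    case (gen t)
    then show ?case
      unfolding rel_gens_def
      by (elim UnE CollectE exE conjE)
        (simp_all add: frag_extend_diff add_hom_add[OF f] add_hom_add[OF g] fg closed
          H_add_left H_add_right H_balanced)
  qed (simp_all add: H_closed frag_extend_add frag_extend_minus)
  have eq: "cls (?e s) = cls (?e t)" if "s \<in> cls t" for s
    using H[OF mem_clsD[OF that]] by (intro cls_eqI) (simp add: frag_extend_diff)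
  have "(\<Union>t\<in>cls t. H #>\<^bsub>F\<^esub> ?e t) = (\<Union>s\<in>cls t. cls (?e t))"
    unfolding r_coset_eq_cls by (intro SUP_cong refl eq)
  also have "\<dots> = cls (?e t)" by (rule SUP_const) (use mem_cls_self[of t] in blast)
  finally show "(\<Union>t\<in>cls t. H #>\<^bsub>F\<^esub> ?e t) = cls (?e t)" .
qed

lemma lact_T:
  assumes "a \<in> carrier L"
  shows "lact T a \<in> add_hom T T"
    "\<lbrakk>x \<in> carrier M; y \<in> carrier N\<rbrakk> \<Longrightarrow> lact T a (pure x y) = pure (lact M a x) y"
proof -
  have f: "lact M a \<in> add_hom M M"
    using assms by (auto simp: add_hom_def M.lact_closed M.lact_add_right)
  have g: "(\<lambda>y. y) \<in> add_hom N N" by (simp add: add_hom_def)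
  have fg: "\<lbrakk>x \<in> carrier M; r \<in> carrier R; y \<in> carrier N\<rbrakk>
      \<Longrightarrow> lact M a (ract M x r) = ract M (lact M a x) r \<and> lact N r y = lact N r y" for x r y
    using assms by (simp add: M.lact_ract)
  have act: "frag_extend (\<lambda>(x, y). frag_of (lact M a x, y)) t \<in> chains" if "t \<in> chains" for t
    by (rule outer_action(2)[where f = "lact M a" and g = "\<lambda>y. y"]) (use f g fg that in simp_all)
  have eq: "lact T a (cls t) = cls (frag_extend (\<lambda>(x, y). frag_of (lact M a x, y)) t)" if "t \<in> chains" for t
    unfolding tensor_def Let_def bimod.simps
    by (rule outer_action(1)[where f = "lact M a" and g = "\<lambda>y. y"]) (use f g fg that in simp_all)
  then show "lact T a \<in> add_hom T T"
    by (auto simp: add_hom_def carrier_T add_T chains_closed frag_extend_add act)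
  show "lact T a (pure x y) = pure (lact M a x) y" if "x \<in> carrier M" "y \<in> carrier N"
    using that by (simp add: pure_eq_cls eq chains_closed)
qed

lemma ract_T:
  assumes "a \<in> carrier S"
  shows "(\<lambda>X. ract T X a) \<in> add_hom T T"
    "\<lbrakk>x \<in> carrier M; y \<in> carrier N\<rbrakk> \<Longrightarrow> ract T (pure x y) a = pure x (ract N y a)"
proof -
  have f: "(\<lambda>x. x) \<in> add_hom M M" by (simp add: add_hom_def)
  have g: "(\<lambda>y. ract N y a) \<in> add_hom N N"
    using assms by (auto simp: add_hom_def N.ract_closed N.ract_add_left)
  have fg: "\<lbrakk>x \<in> carrier M; r \<in> carrier R; y \<in> carrier N\<rbrakk>
      \<Longrightarrow> ract M x r = ract M x r \<and> ract N (lact N r y) a = lact N r (ract N y a)" for x r y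
    using assms by (simp add: N.lact_ract)
  have act: "frag_extend (\<lambda>(x, y). frag_of (x, ract N y a)) t \<in> chains" if "t \<in> chains" for t
    by (rule outer_action(2)[where f = "\<lambda>x. x" and g = "\<lambda>y. ract N y a"]) (use f g fg that in simp_all)
  have eq: "ract T (cls t) a = cls (frag_extend (\<lambda>(x, y). frag_of (x, ract N y a)) t)" if "t \<in> chains" for t
    unfolding tensor_def Let_def bimod.simps
    by (rule outer_action(1)[where f = "\<lambda>x. x" and g = "\<lambda>y. ract N y a"]) (use f g fg that in simp_all)
  then show "(\<lambda>X. ract T X a) \<in> add_hom T T"
    by (auto simp: add_hom_def carrier_T add_T chains_closed frag_extend_add act)
  show "ract T (pure x y) a = pure x (ract N y a)" if "x \<in> carrier M" "y \<in> carrier N"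
    using that by (simp add: pure_eq_cls eq chains_closed)
qed

lemma bimodule_T: "bimodule L S T"
proof -
  interpret T: abelian_group T by (rule abelian_group_T)
  note l = add_hom_closed[OF lact_T(1)] add_hom_add[OF lact_T(1)]
  note r = add_hom_closed[OF ract_T(1)] add_hom_add[OF ract_T(1)]
  \<comment> \<open>Regroups the four summands that appear when distributivity over a sum of scalars
    is checked on a sum of tensors.\<close>
  have swap: "(u \<oplus>\<^bsub>T\<^esub> v) \<oplus>\<^bsub>T\<^esub> (u' \<oplus>\<^bsub>T\<^esub> v') = (u \<oplus>\<^bsub>T\<^esub> u') \<oplus>\<^bsub>T\<^esub> (v \<oplus>\<^bsub>T\<^esub> v')"
    if "u \<in> carrier T" "v \<in> carrier T" "u' \<in> carrier T" "v' \<in> carrier T" for u v u' v'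
    using that by (simp add: T.a_ac)
  show ?thesis
  proof (intro bimodule.intro bimodule_axioms.intro M.L.ring_axioms N.R.ring_axioms abelian_group_T)
    show "lact T (a \<oplus>\<^bsub>L\<^esub> a') X = lact T a X \<oplus>\<^bsub>T\<^esub> lact T a' X"
      if "a \<in> carrier L" "a' \<in> carrier L" "X \<in> carrier T" for a a' X
      using that(3) by (induction rule: tensor_induct)
        (simp_all add: that l lact_T M.lact_add_left M.lact_closed pure_add_left swap)
    show "ract T X (a \<oplus>\<^bsub>S\<^esub> a') = ract T X a \<oplus>\<^bsub>T\<^esub> ract T X a'"
      if "a \<in> carrier S" "a' \<in> carrier S" "X \<in> carrier T" for a a' X
      using that(3) by (induction rule: tensor_induct)
        (simp_all add: that r ract_T N.ract_add_right N.ract_closed pure_add_right swap)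
    show "lact T (a \<otimes>\<^bsub>L\<^esub> a') X = lact T a (lact T a' X)"
      if "a \<in> carrier L" "a' \<in> carrier L" "X \<in> carrier T" for a a' X
      using that(3) by (induction rule: tensor_induct)
        (simp_all add: that l lact_T M.lact_mult M.lact_closed)
    show "ract T X (a \<otimes>\<^bsub>S\<^esub> a') = ract T (ract T X a) a'"
      if "a \<in> carrier S" "a' \<in> carrier S" "X \<in> carrier T" for a a' X
      using that(3) by (induction rule: tensor_induct)
        (simp_all add: that r ract_T N.ract_mult N.ract_closed)
    show "lact T \<one>\<^bsub>L\<^esub> X = X" if "X \<in> carrier T" for X
      using that by (induction rule: tensor_induct) (simp_all add: l lact_T M.lact_one)
    show "ract T X \<one>\<^bsub>S\<^esub> = X" if "X \<in> carrier T" for X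
      using that by (induction rule: tensor_induct) (simp_all add: r ract_T N.ract_one)
    show "ract T (lact T a X) b = lact T a (ract T X b)"
      if "a \<in> carrier L" "b \<in> carrier S" "X \<in> carrier T" for a b X
      using that(3) by (induction rule: tensor_induct)
        (simp_all add: that l r lact_T ract_T M.lact_closed N.ract_closed)
  qed (simp_all add: l r)
qed

text \<open>The tensor product is an image of the chains, which embed into the free abelian group on
  \<open>'u\<close>; that group has the cardinality of \<open>'u\<close> because \<open>'u\<close>
  is infinite.\<close>

lemma tensor_lepoll:
  assumes "infinite (UNIV :: 'u set)" "carrier M \<lesssim> (UNIV :: 'u set)" "carrier N \<lesssim> (UNIV :: 'u set)"
  shows "carrier T \<lesssim> (UNIV :: 'u set)"
proof -
  have times: "(UNIV :: 'u set) \<times> (UNIV :: 'u set) \<lesssim> (UNIV :: 'u set)"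
    using card_of_Times_same_infinite[OF assms(1)]
    by (intro eqpoll_imp_lepoll) (simp only: eqpoll_iff_card_of_ordIso)
  obtain e :: "'m \<times> 'n \<Rightarrow> 'u" where e: "inj_on e (carrier M \<times> carrier N)"
    using lepoll_trans[OF times_lepoll_mono[OF assms(2,3)] times] unfolding lepoll_def by blast
  have 1: "carrier T \<lesssim> carrier (free_Abelian_group (carrier M \<times> carrier N))"
    unfolding carrier_T chains_def free_Abelian_group_def partial_object.simps by (rule image_lepoll)
  have 2: "carrier (free_Abelian_group (carrier M \<times> carrier N)) \<lesssim>
      carrier (free_Abelian_group (e ` (carrier M \<times> carrier N)))"
    by (rule eqpoll_imp_lepoll, rule iso_imp_eqpoll_carrier,
        rule isomorphic_free_Abelian_groups[THEN iffD2], rule eqpoll_sym,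
        rule inj_on_image_eqpoll_self, rule e)
  have 3: "carrier (free_Abelian_group (e ` (carrier M \<times> carrier N))) \<lesssim>
      carrier (free_Abelian_group (UNIV :: 'u set))"
    by (rule subset_imp_lepoll) (simp add: free_Abelian_group_def)
  have 4: "carrier (free_Abelian_group (UNIV :: 'u set)) \<lesssim> (UNIV :: 'u set)"
    by (rule eqpoll_imp_lepoll, rule eqpoll_free_Abelian_group_infinite, rule assms(1))
  show ?thesis
    by (rule lepoll_trans[OF 1 lepoll_trans[OF 2 lepoll_trans[OF 3 4]]])
qed

end

section \<open>The monoidal category of bimodules\<close>

lemma inj_on_to_univ:
  fixes M :: "('l, 'r, 'm) bimod"
  assumes "carrier M \<lesssim> (UNIV :: 'u set)"
  shows "inj_on (to_univ M :: 'm \<Rightarrow> 'u) (carrier M)"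
proof -
  obtain f :: "'m \<Rightarrow> 'u" where "inj_on f (carrier M)"
    using assms by (auto simp: lepoll_def)
  then show ?thesis unfolding to_univ_def by (rule someI[where P = "\<lambda>e. inj_on e (carrier M)"])
qed

lemma univ_copy_simps:
  fixes M :: "('l, 'r, 'm) bimod"
  defines "e \<equiv> to_univ M :: 'm \<Rightarrow> 'u"
  assumes "carrier M \<lesssim> (UNIV :: 'u set)"
  shows carrier_univ_copy: "carrier (univ_copy M) = e ` carrier M"
    and zero_univ_copy: "\<zero>\<^bsub>univ_copy M\<^esub> = e \<zero>\<^bsub>M\<^esub>"
    and add_univ_copy: "\<lbrakk>x \<in> carrier M; y \<in> carrier M\<rbrakk> \<Longrightarrow> e x \<oplus>\<^bsub>univ_copy M\<^esub> e y = e (x \<oplus>\<^bsub>M\<^esub> y)"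
    and lact_univ_copy: "x \<in> carrier M \<Longrightarrow> lact (univ_copy M) a (e x) = e (lact M a x)"
    and ract_univ_copy: "x \<in> carrier M \<Longrightarrow> ract (univ_copy M) (e x) b = e (ract M x b)"
  using inj_on_to_univ[OF assms(2)] by (simp_all add: univ_copy_def Let_def e_def)

lemma bimodule_univ_copy:
  fixes M :: "('l, 'r, 'm) bimod"
  assumes "bimodule L R M" and le: "carrier M \<lesssim> (UNIV :: 'u set)"
  shows "bimodule L R (univ_copy M :: ('l, 'r, 'u) bimod)"
proof -
  interpret M: bimodule L R M by fact
  note copy = univ_copy_simps[OF le]
  show ?thesis
  proof (intro bimodule.intro bimodule_axioms.intro M.L.ring_axioms M.R.ring_axioms)
    show "abelian_group (univ_copy M :: ('l, 'r, 'u) bimod)"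
    proof (rule abelian_groupI; unfold copy(1,2))
      show "\<exists>y\<in>to_univ M ` carrier M. y \<oplus>\<^bsub>univ_copy M\<^esub> x = to_univ M \<zero>\<^bsub>M\<^esub>"
        if x: "x \<in> to_univ M ` carrier M" for x :: 'u
      proof -
        obtain y where "y \<in> carrier M" "x = to_univ M y" using x by blast
        then show ?thesis
          using copy(3)[OF M.a_inv_closed, of y y]
          by (intro bexI[of _ "to_univ M (\<ominus>\<^bsub>M\<^esub> y)"]) (simp_all add: M.l_neg)
      qed
    qed (auto simp: copy M.a_ac)
  qed (auto simp: copy M.lact_closed M.ract_closed M.lact_add_left M.lact_add_right
      M.ract_add_left M.ract_add_right M.lact_mult M.ract_mult M.lact_one M.ract_one M.lact_ract)
qed

lemma bimod_homI:
  assumes "\<And>x. x \<in> carrier M \<Longrightarrow> f x \<in> carrier N"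
    and "\<And>x y. \<lbrakk>x \<in> carrier M; y \<in> carrier M\<rbrakk> \<Longrightarrow> f (x \<oplus>\<^bsub>M\<^esub> y) = f x \<oplus>\<^bsub>N\<^esub> f y"
    and "\<And>a x. \<lbrakk>a \<in> carrier A; x \<in> carrier M\<rbrakk> \<Longrightarrow> f (lact M a x) = lact N a (f x)"
    and "\<And>a x. \<lbrakk>a \<in> carrier A; x \<in> carrier M\<rbrakk> \<Longrightarrow> f (ract M x a) = ract N (f x) a"
    and "f \<in> extensional (carrier M)"
  shows "f \<in> bimod_hom A M N"
  using assms by (auto simp: bimod_hom_def PiE_def)

lemma bimod_homD:
  assumes "f \<in> bimod_hom A M N"
  shows bimod_hom_closed: "x \<in> carrier M \<Longrightarrow> f x \<in> carrier N"
    and bimod_hom_add: "\<lbrakk>x \<in> carrier M; y \<in> carrier M\<rbrakk> \<Longrightarrow> f (x \<oplus>\<^bsub>M\<^esub> y) = f x \<oplus>\<^bsub>N\<^esub> f y"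
    and bimod_hom_lact: "\<lbrakk>a \<in> carrier A; x \<in> carrier M\<rbrakk> \<Longrightarrow> f (lact M a x) = lact N a (f x)"
    and bimod_hom_ract: "\<lbrakk>a \<in> carrier A; x \<in> carrier M\<rbrakk> \<Longrightarrow> f (ract M x a) = ract N (f x) a"
    and bimod_hom_extensional: "f \<in> extensional (carrier M)"
  using assms by (auto simp: bimod_hom_def PiE_def)

lemma bimod_hom_compose:
  assumes f: "f \<in> bimod_hom A M N" and g: "g \<in> bimod_hom A N Q"
    and M: "bimodule A A M"
  shows "compose (carrier M) g f \<in> bimod_hom A M Q"
proof -
  interpret M: bimodule A A M by fact
  note rules = bimod_homD[OF f] bimod_homD[OF g]
  show ?thesis
    by (intro bimod_homI) (simp_all add: compose_eq rules M.lact_closed M.ract_closed compose_extensional)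
qed

lemma bimod_hom_id:
  assumes "bimodule A A M"
  shows "(\<lambda>x\<in>carrier M. x) \<in> bimod_hom A M M"
proof -
  interpret M: bimodule A A M by fact
  show ?thesis by (intro bimod_homI) (simp_all add: M.lact_closed M.ract_closed)
qed

text \<open>The parameter \<open>u\<close> carries no data and only pins the universe. Its being
  infinite makes room for tensor products, and the bound on \<open>R\<close> makes room for the unit
  object.\<close>

locale bimodule_category = assoc_algebra K R
  for K :: "'k ring" and R :: "('k, 'a) module" +
  fixes u :: "'u itself"
  assumes infinite_univ: "infinite (UNIV :: 'u set)"
    and small: "carrier R \<lesssim> (UNIV :: 'u set)"
begin

abbreviation ev :: "('a, 'a, 'u) bimod \<Rightarrow> bool" where "ev \<equiv> ev_module K R"
abbreviation T :: "('a, 'a, 'u) bimod \<Rightarrow> ('a, 'a, 'u) bimod \<Rightarrow> ('a, 'a, 'u) bimod"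
  where "T \<equiv> utensor R"
abbreviation p :: "('a, 'a, 'u) bimod \<Rightarrow> ('a, 'a, 'u) bimod \<Rightarrow> 'u \<Rightarrow> 'u \<Rightarrow> 'u"
  where "p \<equiv> upure R"

lemma ev_bimodule: "ev M \<Longrightarrow> bimodule R R M"
  by (simp add: ev_module_def)

lemma ev_abelian_group: "ev M \<Longrightarrow> abelian_group M"
  by (simp add: ev_module_def bimodule_def)

lemma ev_rules [simp]:
  assumes "ev M"
  shows "\<lbrakk>x \<in> carrier M; y \<in> carrier M\<rbrakk> \<Longrightarrow> x \<oplus>\<^bsub>M\<^esub> y \<in> carrier M"
    and "\<lbrakk>a \<in> carrier R; x \<in> carrier M\<rbrakk> \<Longrightarrow> lact M a x \<in> carrier M"
    and "\<lbrakk>a \<in> carrier R; x \<in> carrier M\<rbrakk> \<Longrightarrow> ract M x a \<in> carrier M"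
proof -
  interpret M: bimodule R R M using assms by (rule ev_bimodule)
  show "\<lbrakk>x \<in> carrier M; y \<in> carrier M\<rbrakk> \<Longrightarrow> x \<oplus>\<^bsub>M\<^esub> y \<in> carrier M"
    and "\<lbrakk>a \<in> carrier R; x \<in> carrier M\<rbrakk> \<Longrightarrow> lact M a x \<in> carrier M"
    and "\<lbrakk>a \<in> carrier R; x \<in> carrier M\<rbrakk> \<Longrightarrow> ract M x a \<in> carrier M"
    by (simp_all add: M.lact_closed M.ract_closed)
qed

lemma tensor_pairI: "ev M \<Longrightarrow> ev N \<Longrightarrow> tensor_pair R R R M N"
  by (intro tensor_pair.intro ev_bimodule)

lemma lepoll_univ: "X \<lesssim> (UNIV :: 'u set)" for X :: "'u set"
  by (rule subset_imp_lepoll) simp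

lemma tensor_small: "ev M \<Longrightarrow> ev N \<Longrightarrow> carrier (tensor (carrier R) M N) \<lesssim> (UNIV :: 'u set)"
  by (intro tensor_pair.tensor_lepoll[OF tensor_pairI] infinite_univ lepoll_univ)

lemma scalar_closed: "k \<in> carrier K \<Longrightarrow> k \<odot>\<^bsub>R\<^esub> \<one>\<^bsub>R\<^esub> \<in> carrier R"
  by simp

section \<open>The transported tensor product and its universal property\<close>

context
  fixes M N :: "('a, 'a, 'u) bimod"
  assumes MN: "ev M" "ev N"
begin

interpretation TP: tensor_pair R R R M N by (rule tensor_pairI[OF MN])

lemmas T_copy = univ_copy_simps[OF tensor_small[OF MN]]

lemma p_closed [simp]: "\<lbrakk>x \<in> carrier M; y \<in> carrier N\<rbrakk> \<Longrightarrow> p M N x y \<in> carrier (T M N)"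
  by (simp add: upure_def utensor_def T_copy TP.pure_closed)

lemma p_add_left: "\<lbrakk>x \<in> carrier M; x' \<in> carrier M; y \<in> carrier N\<rbrakk>
    \<Longrightarrow> p M N (x \<oplus>\<^bsub>M\<^esub> x') y = p M N x y \<oplus>\<^bsub>T M N\<^esub> p M N x' y"
  by (simp add: upure_def utensor_def T_copy TP.pure_closed TP.pure_add_left)

lemma p_add_right: "\<lbrakk>x \<in> carrier M; y \<in> carrier N; y' \<in> carrier N\<rbrakk>
    \<Longrightarrow> p M N x (y \<oplus>\<^bsub>N\<^esub> y') = p M N x y \<oplus>\<^bsub>T M N\<^esub> p M N x y'"
  by (simp add: upure_def utensor_def T_copy TP.pure_closed TP.pure_add_right)

lemma p_balanced: "\<lbrakk>x \<in> carrier M; r \<in> carrier R; y \<in> carrier N\<rbrakk>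
    \<Longrightarrow> p M N (ract M x r) y = p M N x (lact N r y)"
  by (simp add: upure_def TP.pure_balanced)

lemma p_lact: "\<lbrakk>a \<in> carrier R; x \<in> carrier M; y \<in> carrier N\<rbrakk>
    \<Longrightarrow> lact (T M N) a (p M N x y) = p M N (lact M a x) y"
  by (simp add: upure_def utensor_def T_copy TP.pure_closed TP.lact_T)

lemma p_ract: "\<lbrakk>a \<in> carrier R; x \<in> carrier M; y \<in> carrier N\<rbrakk>
    \<Longrightarrow> ract (T M N) (p M N x y) a = p M N x (ract N y a)"
  by (simp add: upure_def utensor_def T_copy TP.pure_closed TP.ract_T)

lemma T_induct [consumes 1, case_names pure add]:
  assumes "X \<in> carrier (T M N)"
    and "\<And>x y. \<lbrakk>x \<in> carrier M; y \<in> carrier N\<rbrakk> \<Longrightarrow> P (p M N x y)"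
    and "\<And>X Y. \<lbrakk>X \<in> carrier (T M N); Y \<in> carrier (T M N); P X; P Y\<rbrakk> \<Longrightarrow> P (X \<oplus>\<^bsub>T M N\<^esub> Y)"
  shows "P X"
proof -
  obtain Y where Y: "Y \<in> carrier (tensor (carrier R) M N)" "X = to_univ (tensor (carrier R) M N) Y"
    using assms(1) by (auto simp: utensor_def T_copy)
  show ?thesis
    unfolding Y(2) using Y(1)
  proof (induction rule: TP.tensor_induct)
    case (pure x y)
    then show ?case using assms(2) by (simp add: upure_def)
  next
    case (add X Y)
    then show ?case using assms(3)[unfolded utensor_def T_copy(1)] T_copy(3)[of X Y] by force
  qed
qed

lemma T_lift:
  assumes "abelian_group G" "balanced_map (carrier R) M N G b"
  obtains h where "h \<in> add_hom (T M N) G"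
    "\<And>x y. \<lbrakk>x \<in> carrier M; y \<in> carrier N\<rbrakk> \<Longrightarrow> h (p M N x y) = b x y"
proof -
  obtain h where h: "h \<in> add_hom (tensor (carrier R) M N) G"
    "\<And>x y. \<lbrakk>x \<in> carrier M; y \<in> carrier N\<rbrakk> \<Longrightarrow> h (TP.pure x y) = b x y"
    using TP.tensor_lift[OF assms] by blast
  let ?d = "inv_into (carrier (tensor (carrier R) M N)) (to_univ (tensor (carrier R) M N) :: _ \<Rightarrow> 'u)"
  have d: "?d (to_univ (tensor (carrier R) M N) X) = X" if "X \<in> carrier (tensor (carrier R) M N)" for X
    using that inj_on_to_univ[OF tensor_small[OF MN]] by simp
  interpret TT: abelian_group "tensor (carrier R) M N" by (rule TP.abelian_group_T)
  show thesis
  proof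
    show "h \<circ> ?d \<in> add_hom (T M N) G"
      by (auto simp: add_hom_def utensor_def T_copy d add_hom_closed[OF h(1)] add_hom_add[OF h(1)])
    show "(h \<circ> ?d) (p M N x y) = b x y" if "x \<in> carrier M" "y \<in> carrier N" for x y
      using that by (simp add: upure_def d TP.pure_closed h)
  qed
qed

text \<open>The two K-actions on a tensor agree because a scalar can be carried across: kx \<otimes>
  y = xk \<otimes> y = x \<otimes> ky = x \<otimes> yk.\<close>

lemma ev_T [simp]: "ev (T M N)"
  unfolding ev_module_def
proof (intro conjI ballI)
  show bi: "bimodule R R (T M N)"
    unfolding utensor_def by (rule bimodule_univ_copy[OF TP.bimodule_T tensor_small[OF MN]])
  interpret B: bimodule R R "T M N" by (rule bi)
  fix k X assume k: "k \<in> carrier K" and "X \<in> carrier (T M N)"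
  have s: "lact M (k \<odot>\<^bsub>R\<^esub> \<one>\<^bsub>R\<^esub>) x = ract M x (k \<odot>\<^bsub>R\<^esub> \<one>\<^bsub>R\<^esub>)" if "x \<in> carrier M" for x
    using MN k that by (simp add: ev_module_def)
  have s': "lact N (k \<odot>\<^bsub>R\<^esub> \<one>\<^bsub>R\<^esub>) x = ract N x (k \<odot>\<^bsub>R\<^esub> \<one>\<^bsub>R\<^esub>)" if "x \<in> carrier N" for x
    using MN k that by (simp add: ev_module_def)
  from \<open>X \<in> carrier (T M N)\<close> show "lact (T M N) (k \<odot>\<^bsub>R\<^esub> \<one>\<^bsub>R\<^esub>) X = ract (T M N) X (k \<odot>\<^bsub>R\<^esub> \<one>\<^bsub>R\<^esub>)"
    by (induction rule: T_induct)
      (simp_all add: p_lact p_ract scalar_closed k s p_balanced s' B.lact_add_right B.ract_add_left)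
qed

lemma hom_T_eqI:
  assumes "f \<in> bimod_hom R (T M N) Q" "g \<in> bimod_hom R (T M N) Q"
    and "\<And>x y. \<lbrakk>x \<in> carrier M; y \<in> carrier N\<rbrakk> \<Longrightarrow> f (p M N x y) = g (p M N x y)"
  shows "f = g"
proof (rule extensionalityI)
  show "f \<in> extensional (carrier (T M N))" "g \<in> extensional (carrier (T M N))"
    using assms(1,2) bimod_hom_extensional by blast+
  show "f X = g X" if "X \<in> carrier (T M N)" for X
    using that by (induction rule: T_induct)
      (simp_all add: assms(3) bimod_hom_add[OF assms(1)] bimod_hom_add[OF assms(2)])
qed

lemma hom_T_lift:
  assumes Q: "ev Q" and b: "balanced_map (carrier R) M N Q b"
    and l: "\<And>a x y. \<lbrakk>a \<in> carrier R; x \<in> carrier M; y \<in> carrier N\<rbrakk> \<Longrightarrow> b (lact M a x) y = lact Q a (b x y)"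
    and r: "\<And>a x y. \<lbrakk>a \<in> carrier R; x \<in> carrier M; y \<in> carrier N\<rbrakk> \<Longrightarrow> b x (ract N y a) = ract Q (b x y) a"
  obtains h where "h \<in> bimod_hom R (T M N) Q"
    "\<And>x y. \<lbrakk>x \<in> carrier M; y \<in> carrier N\<rbrakk> \<Longrightarrow> h (p M N x y) = b x y"
proof -
  interpret Q: bimodule R R Q using Q by (rule ev_bimodule)
  interpret B: bimodule R R "T M N" using ev_T by (rule ev_bimodule)
  obtain h where h: "h \<in> add_hom (T M N) Q"
    "\<And>x y. \<lbrakk>x \<in> carrier M; y \<in> carrier N\<rbrakk> \<Longrightarrow> h (p M N x y) = b x y"
    using T_lift[OF ev_abelian_group[OF Q] b] by blast
  note hh = add_hom_closed[OF h(1)] add_hom_add[OF h(1)]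
  note bc = balanced_map_closed[OF b]
  have hl: "h (lact (T M N) a X) = lact Q a (h X)" if "X \<in> carrier (T M N)" "a \<in> carrier R" for a X
    using that(1) by (induction rule: T_induct)
      (simp_all add: that(2) p_lact MN h(2) l bc hh B.lact_add_right Q.lact_add_right)
  have hr: "h (ract (T M N) X a) = ract Q (h X) a" if "X \<in> carrier (T M N)" "a \<in> carrier R" for a X
    using that(1) by (induction rule: T_induct)
      (simp_all add: that(2) p_ract MN h(2) r bc hh B.ract_add_left Q.ract_add_left)
  show thesis
  proof
    \<comment> \<open>Arrows are extensional functions, so the additive map becomes an arrow only
      after restriction.\<close>
    show "restrict h (carrier (T M N)) \<in> bimod_hom R (T M N) Q"
      by (intro bimod_homI) (simp_all add: hh hl hr)
    show "restrict h (carrier (T M N)) (p M N x y) = b x y" if "x \<in> carrier M" "y \<in> carrier N" for x y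
      using that by (simp add: h(2))
  qed
qed

text \<open>Discharges the definite descriptions by which \<open>bimod_category\<close> introduces
  its structure arrows.\<close>

lemma hom_T_the:
  assumes "ev Q" "balanced_map (carrier R) M N Q b"
    "\<And>a x y. \<lbrakk>a \<in> carrier R; x \<in> carrier M; y \<in> carrier N\<rbrakk> \<Longrightarrow> b (lact M a x) y = lact Q a (b x y)"
    "\<And>a x y. \<lbrakk>a \<in> carrier R; x \<in> carrier M; y \<in> carrier N\<rbrakk> \<Longrightarrow> b x (ract N y a) = ract Q (b x y) a"
  shows "\<exists>!h. h \<in> bimod_hom R (T M N) Q \<and> (\<forall>x\<in>carrier M. \<forall>y\<in>carrier N. h (p M N x y) = b x y)"
proof -
  obtain h where h: "h \<in> bimod_hom R (T M N) Q"
    "\<And>x y. \<lbrakk>x \<in> carrier M; y \<in> carrier N\<rbrakk> \<Longrightarrow> h (p M N x y) = b x y"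
    using hom_T_lift[OF assms] by blast
  show ?thesis
  proof (intro ex1I[of _ h] conjI ballI)
    fix g assume "g \<in> bimod_hom R (T M N) Q \<and> (\<forall>x\<in>carrier M. \<forall>y\<in>carrier N. g (p M N x y) = b x y)"
    then show "g = h" by (intro hom_T_eqI) (use h in auto)
  qed (use h in auto)
qed

end

end

lemma (in category) inverse_arrows_unique:
  assumes "X \<in> Obj C" "Y \<in> Obj C" "inverse_arrows C X Y f g" "inverse_arrows C X Y f g'"
  shows "g = g'"
proof -
  have "g = Comp C Y Y X g (Comp C Y X Y f g')"
    using assms by (simp add: inverse_arrows_def Comp_Id_right)
  also have "\<dots> = Comp C Y X X (Comp C X Y X g f) g'"
    using assms by (intro Comp_assoc) (simp_all add: inverse_arrows_def)
  also have "\<dots> = g'"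
    using assms by (simp add: inverse_arrows_def Comp_Id_left)
  finally show ?thesis .
qed

lemma (in category) inv_arrow_eq:
  assumes "X \<in> Obj C" "Y \<in> Obj C" "inverse_arrows C X Y f g"
  shows "inv_arrow C X Y f = g"
  unfolding inv_arrow_def using assms by (intro the_equality) (auto intro: inverse_arrows_unique)

lemma bimodule_regular:
  assumes "ring A"
  shows "bimodule A A (regular_bimod A)"
proof -
  interpret ring A by fact
  have "\<exists>y\<in>carrier A. y \<oplus>\<^bsub>A\<^esub> x = \<zero>\<^bsub>A\<^esub>" if "x \<in> carrier A" for x
    using that by (intro bexI[of _ "\<ominus>\<^bsub>A\<^esub> x"]) (simp_all add: l_neg)
  then show ?thesis
    by (intro bimodule.intro bimodule_axioms.intro assms abelian_groupI)
      (simp_all add: regular_bimod_def l_distr r_distr a_ac m_assoc)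
qed

section \<open>Structure arrows and their values on pure tensors\<close>

context bimodule_category
begin

abbreviation C :: "(('a, 'a, 'u) bimod, 'u \<Rightarrow> 'u) monoidal_category" where "C \<equiv> bimod_category K R"
abbreviation I :: "('a, 'a, 'u) bimod" where "I \<equiv> uunit R"
abbreviation \<iota> :: "'a \<Rightarrow> 'u" where "\<iota> \<equiv> to_univ (regular_bimod R)"

text \<open>The fields \<open>TArr\<close>, \<open>Assoc\<close>, \<open>LUnit\<close> and
  \<open>RUnit\<close> are left folded: they are used only through their types and their values on
  pure tensors.\<close>

lemma C_simps [simp]:
  "Obj C = {M. ev M}" "Hom C = bimod_hom R" "Id C M = (\<lambda>x\<in>carrier M. x)"
  "Comp C M N Q g f = compose (carrier M) g f" "TObj C = T" "Unit C = I"
  by (simp_all add: bimod_category_def)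

lemma id_hom: "ev M \<Longrightarrow> (\<lambda>x\<in>carrier M. x) \<in> bimod_hom R M M"
  by (intro bimod_hom_id ev_bimodule)

lemma comp_hom:
  "\<lbrakk>f \<in> bimod_hom R M N; g \<in> bimod_hom R N Q; ev M\<rbrakk> \<Longrightarrow> compose (carrier M) g f \<in> bimod_hom R M Q"
  by (intro bimod_hom_compose ev_bimodule)

lemma hom_eqI:
  assumes "f \<in> bimod_hom R M Q" "g \<in> bimod_hom R M Q" "\<And>x. x \<in> carrier M \<Longrightarrow> f x = g x"
  shows "f = g"
  using assms(3) by (rule extensionalityI[OF bimod_hom_extensional[OF assms(1)] bimod_hom_extensional[OF assms(2)]])

lemma regular_small: "carrier (regular_bimod R) \<lesssim> (UNIV :: 'u set)"
  using small by (simp add: regular_bimod_def)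

lemmas I_copy = univ_copy_simps[OF regular_small]

lemma ev_I [simp]: "ev I"
  unfolding ev_module_def
proof (intro conjI ballI)
  show "bimodule R R I"
    unfolding uunit_def by (rule bimodule_univ_copy[OF bimodule_regular[OF A.ring_axioms] regular_small])
  fix k x assume "k \<in> carrier K" "x \<in> carrier I"
  then show "lact I (k \<odot>\<^bsub>R\<^esub> \<one>\<^bsub>R\<^esub>) x = ract I x (k \<odot>\<^bsub>R\<^esub> \<one>\<^bsub>R\<^esub>)"
    by (auto simp: uunit_def I_copy) (auto simp: regular_bimod_def smult_mult_left smult_mult_right)
qed

lemma I_simps [simp]:
  "carrier I = \<iota> ` carrier R"
  "\<lbrakk>a \<in> carrier R; r \<in> carrier R\<rbrakk> \<Longrightarrow> lact I a (\<iota> r) = \<iota> (a \<otimes>\<^bsub>R\<^esub> r)"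
  "\<lbrakk>a \<in> carrier R; r \<in> carrier R\<rbrakk> \<Longrightarrow> ract I (\<iota> r) a = \<iota> (r \<otimes>\<^bsub>R\<^esub> a)"
  "\<lbrakk>a \<in> carrier R; r \<in> carrier R\<rbrakk> \<Longrightarrow> \<iota> a \<oplus>\<^bsub>I\<^esub> \<iota> r = \<iota> (a \<oplus>\<^bsub>R\<^esub> r)"
proof -
  have c: "x \<in> carrier (regular_bimod R)" if "x \<in> carrier R" for x
    using that by (simp add: regular_bimod_def)
  show "carrier I = \<iota> ` carrier R"
    unfolding uunit_def I_copy by (simp add: regular_bimod_def)
  show "lact I a (\<iota> r) = \<iota> (a \<otimes>\<^bsub>R\<^esub> r)" "ract I (\<iota> r) a = \<iota> (r \<otimes>\<^bsub>R\<^esub> a)"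
    "\<iota> a \<oplus>\<^bsub>I\<^esub> \<iota> r = \<iota> (a \<oplus>\<^bsub>R\<^esub> r)" if "a \<in> carrier R" "r \<in> carrier R"
    unfolding uunit_def I_copy(3)[OF c[OF that(1)] c[OF that(2)]] I_copy(4,5)[OF c[OF that(2)]]
    by (simp_all add: regular_bimod_def)
qed

lemma inj_\<iota>: "inj_on \<iota> (carrier R)"
  using inj_on_to_univ[OF regular_small] by (simp add: regular_bimod_def)

lemma TArr_props:
  assumes "ev M" "ev M'" "ev N" "ev N'" and f: "f \<in> bimod_hom R M M'" and g: "g \<in> bimod_hom R N N'"
  shows TArr_hom: "TArr C M M' N N' f g \<in> bimod_hom R (T M N) (T M' N')" (is ?hom)
    and TArr_eval: "\<lbrakk>x \<in> carrier M; y \<in> carrier N\<rbrakk>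
      \<Longrightarrow> TArr C M M' N N' f g (p M N x y) = p M' N' (f x) (g y)" (is "PROP ?eval")
proof -
  note hom = bimod_homD[OF f] bimod_homD[OF g]
  have "\<exists>!h. h \<in> bimod_hom R (T M N) (T M' N') \<and>
      (\<forall>x\<in>carrier M. \<forall>y\<in>carrier N. h (p M N x y) = p M' N' (f x) (g y))"
    by (rule hom_T_the) (auto intro!: balanced_mapI simp: assms hom p_add_left p_add_right p_balanced p_lact p_ract)
  from theI'[OF this] show ?hom "PROP ?eval"
    by (simp_all add: bimod_category_def)
qed

lemma LUnit_props:
  assumes "ev M"
  shows LUnit_hom: "LUnit C M \<in> bimod_hom R (T I M) M" (is ?hom)
    and LUnit_eval: "\<lbrakk>r \<in> carrier R; x \<in> carrier M\<rbrakk> \<Longrightarrow> LUnit C M (p I M (\<iota> r) x) = lact M r x" (is "PROP ?eval")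
proof -
  interpret M: bimodule R R M using assms by (rule ev_bimodule)
  \<comment> \<open>The left unit is specified on elements of \<open>R\<close>, while the universal
    property speaks of the coded elements of \<open>I\<close>; \<open>d\<close> decodes
    them.\<close>
  define d where "d = inv_into (carrier R) \<iota>"
  have d: "r \<in> carrier R \<Longrightarrow> d (\<iota> r) = r" for r
    using inj_\<iota> by (simp add: d_def)
  have "\<exists>!h. h \<in> bimod_hom R (T I M) M \<and>
      (\<forall>x\<in>carrier I. \<forall>y\<in>carrier M. h (p I M x y) = lact M (d x) y)"
    by (rule hom_T_the)
      (auto intro!: balanced_mapI simp: assms d M.lact_add_left M.lact_add_right M.lact_mult M.lact_ract)
  then have "\<exists>!h. h \<in> bimod_hom R (T I M) M \<and>
      (\<forall>r\<in>carrier R. \<forall>y\<in>carrier M. h (p I M (\<iota> r) y) = lact M r y)"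
    by (simp add: d)
  from theI'[OF this] show ?hom "PROP ?eval"
    by (simp_all add: bimod_category_def)
qed

lemma RUnit_props:
  assumes "ev M"
  shows RUnit_hom: "RUnit C M \<in> bimod_hom R (T M I) M" (is ?hom)
    and RUnit_eval: "\<lbrakk>r \<in> carrier R; x \<in> carrier M\<rbrakk> \<Longrightarrow> RUnit C M (p M I x (\<iota> r)) = ract M x r" (is "PROP ?eval")
proof -
  interpret M: bimodule R R M using assms by (rule ev_bimodule)
  define d where "d = inv_into (carrier R) \<iota>"
  have d: "r \<in> carrier R \<Longrightarrow> d (\<iota> r) = r" for r
    using inj_\<iota> by (simp add: d_def)
  have 1: "\<exists>!h. h \<in> bimod_hom R (T M I) M \<and>
      (\<forall>x\<in>carrier M. \<forall>y\<in>carrier I. h (p M I x y) = ract M x (d y))"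
    by (rule hom_T_the)
      (auto intro!: balanced_mapI simp: assms d M.ract_add_left M.ract_add_right M.ract_mult M.lact_ract)
  have 2: "(\<forall>x\<in>carrier M. \<forall>y\<in>carrier I. h (p M I x y) = ract M x (d y)) \<longleftrightarrow>
      (\<forall>r\<in>carrier R. \<forall>y\<in>carrier M. h (p M I y (\<iota> r)) = ract M y r)" for h
    by (auto simp: d)
  from theI'[OF 1[unfolded 2]] show ?hom "PROP ?eval"
    by (simp_all add: bimod_category_def)
qed

text \<open>Two nested generation arguments: the outer one reduces to tensors of some X with z, and
  additivity in the left slot then reduces X to pure tensors.\<close>

lemma hom_TT_left_eqI:
  assumes "ev M" "ev N" "ev P"
    and f: "f \<in> bimod_hom R (T (T M N) P) Q" and g: "g \<in> bimod_hom R (T (T M N) P) Q"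
    and eq: "\<And>x y z. \<lbrakk>x \<in> carrier M; y \<in> carrier N; z \<in> carrier P\<rbrakk>
      \<Longrightarrow> f (p (T M N) P (p M N x y) z) = g (p (T M N) P (p M N x y) z)"
  shows "f = g"
proof (rule hom_T_eqI[OF _ _ f g])
  fix X z assume "X \<in> carrier (T M N)" and z: "z \<in> carrier P"
  then show "f (p (T M N) P X z) = g (p (T M N) P X z)"
    by (induction rule: T_induct[OF assms(1,2), consumes 1])
      (simp_all add: assms eq p_add_left bimod_hom_add[OF f] bimod_hom_add[OF g])
qed (simp_all add: assms)

lemma hom_TT_right_eqI:
  assumes "ev M" "ev N" "ev P"
    and f: "f \<in> bimod_hom R (T M (T N P)) Q" and g: "g \<in> bimod_hom R (T M (T N P)) Q"
    and eq: "\<And>x y z. \<lbrakk>x \<in> carrier M; y \<in> carrier N; z \<in> carrier P\<rbrakk>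
      \<Longrightarrow> f (p M (T N P) x (p N P y z)) = g (p M (T N P) x (p N P y z))"
  shows "f = g"
proof (rule hom_T_eqI[OF _ _ f g])
  fix x Y assume x: "x \<in> carrier M" and "Y \<in> carrier (T N P)"
  from this(2) show "f (p M (T N P) x Y) = g (p M (T N P) x Y)"
    by (induction rule: T_induct[OF assms(2,3), consumes 1])
      (simp_all add: assms x eq p_add_right bimod_hom_add[OF f] bimod_hom_add[OF g])
qed (simp_all add: assms)

text \<open>Serves the pentagon, whose source is a fourfold product bracketed to the left.\<close>

lemma hom_TTT_left_eqI:
  assumes "ev L" "ev M" "ev N" "ev P"
    and f: "f \<in> bimod_hom R (T (T (T L M) N) P) Q" and g: "g \<in> bimod_hom R (T (T (T L M) N) P) Q"
    and eq: "\<And>w x y z. \<lbrakk>w \<in> carrier L; x \<in> carrier M; y \<in> carrier N; z \<in> carrier P\<rbrakk>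
      \<Longrightarrow> f (p (T (T L M) N) P (p (T L M) N (p L M w x) y) z) =
          g (p (T (T L M) N) P (p (T L M) N (p L M w x) y) z)"
  shows "f = g"
proof (rule hom_TT_left_eqI[OF _ _ _ f g])
  fix X y z assume "X \<in> carrier (T L M)" and yz: "y \<in> carrier N" "z \<in> carrier P"
  from this(1) show "f (p (T (T L M) N) P (p (T L M) N X y) z) = g (p (T (T L M) N) P (p (T L M) N X y) z)"
    by (induction rule: T_induct[OF assms(1,2), consumes 1])
      (simp_all add: assms yz eq p_add_left bimod_hom_add[OF f] bimod_hom_add[OF g])
qed (simp_all add: assms)

section \<open>Maps out of triple tensor products\<close>

context
  fixes M N P Q :: "('a, 'a, 'u) bimod" and b :: "'u \<Rightarrow> 'u \<Rightarrow> 'u \<Rightarrow> 'u"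
  assumes ev3: "ev M" "ev N" "ev P" "ev Q"
    and b12: "\<And>z. z \<in> carrier P \<Longrightarrow> balanced_map (carrier R) M N Q (\<lambda>x y. b x y z)"
    and b23: "\<And>x. x \<in> carrier M \<Longrightarrow> balanced_map (carrier R) N P Q (b x)"
    and bl: "\<And>a x y z. \<lbrakk>a \<in> carrier R; x \<in> carrier M; y \<in> carrier N; z \<in> carrier P\<rbrakk>
      \<Longrightarrow> b (lact M a x) y z = lact Q a (b x y z)"
    and br: "\<And>a x y z. \<lbrakk>a \<in> carrier R; x \<in> carrier M; y \<in> carrier N; z \<in> carrier P\<rbrakk>
      \<Longrightarrow> b x y (ract P z a) = ract Q (b x y z) a"
begin

interpretation Q: bimodule R R Q using ev3(4) by (rule ev_bimodule)

lemma b_closed: "\<lbrakk>x \<in> carrier M; y \<in> carrier N; z \<in> carrier P\<rbrakk> \<Longrightarrow> b x y z \<in> carrier Q"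
  using balanced_map_closed[OF b23] by simp

lemma Q_swap:
  "\<lbrakk>v \<in> carrier Q; w \<in> carrier Q; v' \<in> carrier Q; w' \<in> carrier Q\<rbrakk>
    \<Longrightarrow> (v \<oplus>\<^bsub>Q\<^esub> w) \<oplus>\<^bsub>Q\<^esub> (v' \<oplus>\<^bsub>Q\<^esub> w') = (v \<oplus>\<^bsub>Q\<^esub> v') \<oplus>\<^bsub>Q\<^esub> (w \<oplus>\<^bsub>Q\<^esub> w')"
  by (simp add: Q.a_ac)

text \<open>Currying: for fixed z the map in x and y lifts to \<open>H z\<close> on the inner
  product. The values on pure tensors determine \<open>H z\<close>, so additivity, balance and
  linearity in z follow by induction on the inner tensor, and a second lift applies to the pair (X,
  z).\<close>

lemma hom_TT_left_lift:
  "\<exists>h \<in> bimod_hom R (T (T M N) P) Q. \<forall>x\<in>carrier M. \<forall>y\<in>carrier N. \<forall>z\<in>carrier P.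
     h (p (T M N) P (p M N x y) z) = b x y z"
proof -
  interpret MN: bimodule R R "T M N" by (rule ev_bimodule) (simp add: ev3)
  have "\<forall>z\<in>carrier P. \<exists>h. h \<in> add_hom (T M N) Q \<and>
      (\<forall>x\<in>carrier M. \<forall>y\<in>carrier N. h (p M N x y) = b x y z)"
  proof
    fix z assume "z \<in> carrier P"
    then show "\<exists>h. h \<in> add_hom (T M N) Q \<and> (\<forall>x\<in>carrier M. \<forall>y\<in>carrier N. h (p M N x y) = b x y z)"
      using T_lift[OF ev3(1,2) ev_abelian_group[OF ev3(4)] b12] by metis
  qed
  then obtain H where H: "\<And>z. z \<in> carrier P \<Longrightarrow> H z \<in> add_hom (T M N) Q"
    and Hp: "\<And>x y z. \<lbrakk>x \<in> carrier M; y \<in> carrier N; z \<in> carrier P\<rbrakk> \<Longrightarrow> H z (p M N x y) = b x y z"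
    by metis
  note HH = add_hom_closed[OF H] add_hom_add[OF H]
  note b' = balanced_mapD[OF b23]
  have add: "H (z \<oplus>\<^bsub>P\<^esub> z') X = H z X \<oplus>\<^bsub>Q\<^esub> H z' X"
    if "X \<in> carrier (T M N)" "z \<in> carrier P" "z' \<in> carrier P" for X z z'
    using that(1) by (induction rule: T_induct[OF ev3(1,2), consumes 1])
      (simp_all add: that(2,3) ev3 HH Hp b' Q_swap)
  have bal: "H z (ract (T M N) X r) = H (lact P r z) X"
    if "X \<in> carrier (T M N)" "z \<in> carrier P" "r \<in> carrier R" for X z r
    using that(1) by (induction rule: T_induct[OF ev3(1,2), consumes 1])
      (simp_all add: that(2,3) ev3 HH Hp b' p_ract MN.ract_add_left)
  have l: "H z (lact (T M N) a X) = lact Q a (H z X)"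
    if "X \<in> carrier (T M N)" "z \<in> carrier P" "a \<in> carrier R" for X z a
    using that(1) by (induction rule: T_induct[OF ev3(1,2), consumes 1])
      (simp_all add: that(2,3) ev3 HH Hp bl p_lact b_closed MN.lact_add_right Q.lact_add_right)
  have r: "H (ract P z a) X = ract Q (H z X) a"
    if "X \<in> carrier (T M N)" "z \<in> carrier P" "a \<in> carrier R" for X z a
    using that(1) by (induction rule: T_induct[OF ev3(1,2), consumes 1])
      (simp_all add: that(2,3) ev3 HH Hp br b_closed Q.ract_add_left)
  have B: "balanced_map (carrier R) (T M N) P Q (\<lambda>X z. H z X)"
    by (intro balanced_mapI) (simp_all add: HH add bal)
  obtain h where h: "h \<in> bimod_hom R (T (T M N) P) Q"
      "\<And>X z. \<lbrakk>X \<in> carrier (T M N); z \<in> carrier P\<rbrakk> \<Longrightarrow> h (p (T M N) P X z) = H z X"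
    by (rule hom_T_lift[OF ev_T[OF ev3(1,2)] ev3(3,4) B]) (simp_all add: l r)
  then show ?thesis
    by (intro bexI[OF _ h(1)]) (simp add: ev3 Hp)
qed

lemma hom_TT_right_lift:
  "\<exists>h \<in> bimod_hom R (T M (T N P)) Q. \<forall>x\<in>carrier M. \<forall>y\<in>carrier N. \<forall>z\<in>carrier P.
     h (p M (T N P) x (p N P y z)) = b x y z"
proof -
  interpret NP: bimodule R R "T N P" by (rule ev_bimodule) (simp add: ev3)
  have "\<forall>x\<in>carrier M. \<exists>h. h \<in> add_hom (T N P) Q \<and>
      (\<forall>y\<in>carrier N. \<forall>z\<in>carrier P. h (p N P y z) = b x y z)"
  proof
    fix x assume "x \<in> carrier M"
    then show "\<exists>h. h \<in> add_hom (T N P) Q \<and> (\<forall>y\<in>carrier N. \<forall>z\<in>carrier P. h (p N P y z) = b x y z)"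
      using T_lift[OF ev3(2,3) ev_abelian_group[OF ev3(4)] b23] by metis
  qed
  then obtain H where H: "\<And>x. x \<in> carrier M \<Longrightarrow> H x \<in> add_hom (T N P) Q"
    and Hp: "\<And>x y z. \<lbrakk>x \<in> carrier M; y \<in> carrier N; z \<in> carrier P\<rbrakk> \<Longrightarrow> H x (p N P y z) = b x y z"
    by metis
  note HH = add_hom_closed[OF H] add_hom_add[OF H]
  note b' = balanced_mapD[OF b12]
  have add: "H (x \<oplus>\<^bsub>M\<^esub> x') X = H x X \<oplus>\<^bsub>Q\<^esub> H x' X"
    if "X \<in> carrier (T N P)" "x \<in> carrier M" "x' \<in> carrier M" for X x x'
    using that(1) by (induction rule: T_induct[OF ev3(2,3), consumes 1])
      (simp_all add: that(2,3) ev3 HH Hp b' Q_swap)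
  have bal: "H (ract M x r) X = H x (lact (T N P) r X)"
    if "X \<in> carrier (T N P)" "x \<in> carrier M" "r \<in> carrier R" for X x r
    using that(1) by (induction rule: T_induct[OF ev3(2,3), consumes 1])
      (simp_all add: that(2,3) ev3 HH Hp b' p_lact NP.lact_add_right)
  have l: "H (lact M a x) X = lact Q a (H x X)"
    if "X \<in> carrier (T N P)" "x \<in> carrier M" "a \<in> carrier R" for X x a
    using that(1) by (induction rule: T_induct[OF ev3(2,3), consumes 1])
      (simp_all add: that(2,3) ev3 HH Hp bl b_closed Q.lact_add_right)
  have r: "H x (ract (T N P) X a) = ract Q (H x X) a"
    if "X \<in> carrier (T N P)" "x \<in> carrier M" "a \<in> carrier R" for X x a
    using that(1) by (induction rule: T_induct[OF ev3(2,3), consumes 1])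
      (simp_all add: that(2,3) ev3 HH Hp br p_ract b_closed NP.ract_add_left Q.ract_add_left)
  have B: "balanced_map (carrier R) M (T N P) Q H"
    by (intro balanced_mapI) (simp_all add: HH add bal)
  obtain h where h: "h \<in> bimod_hom R (T M (T N P)) Q"
      "\<And>x X. \<lbrakk>x \<in> carrier M; X \<in> carrier (T N P)\<rbrakk> \<Longrightarrow> h (p M (T N P) x X) = H x X"
    by (rule hom_T_lift[OF ev3(1) ev_T[OF ev3(2,3)] ev3(4) B]) (simp_all add: l r)
  then show ?thesis
    by (intro bexI[OF _ h(1)]) (simp add: ev3 Hp)
qed

end

lemma Assoc_props:
  assumes ev: "ev M" "ev N" "ev P"
  shows Assoc_hom: "Assoc C M N P \<in> bimod_hom R (T (T M N) P) (T M (T N P))" (is ?hom)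
    and Assoc_eval: "\<lbrakk>x \<in> carrier M; y \<in> carrier N; z \<in> carrier P\<rbrakk>
      \<Longrightarrow> Assoc C M N P (p (T M N) P (p M N x y) z) = p M (T N P) x (p N P y z)" (is "PROP ?eval")
proof -
  have "\<exists>h \<in> bimod_hom R (T (T M N) P) (T M (T N P)).
      \<forall>x\<in>carrier M. \<forall>y\<in>carrier N. \<forall>z\<in>carrier P.
        h (p (T M N) P (p M N x y) z) = p M (T N P) x (p N P y z)"
    by (rule hom_TT_left_lift)
      (auto intro!: balanced_mapI simp: ev p_add_left p_add_right p_balanced p_lact p_ract)
  then obtain h where h: "h \<in> bimod_hom R (T (T M N) P) (T M (T N P))"
    "\<And>x y z. \<lbrakk>x \<in> carrier M; y \<in> carrier N; z \<in> carrier P\<rbrakk>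
        \<Longrightarrow> h (p (T M N) P (p M N x y) z) = p M (T N P) x (p N P y z)"
    by blast
  have "\<exists>!h. h \<in> bimod_hom R (T (T M N) P) (T M (T N P)) \<and>
      (\<forall>x\<in>carrier M. \<forall>y\<in>carrier N. \<forall>z\<in>carrier P.
        h (p (T M N) P (p M N x y) z) = p M (T N P) x (p N P y z))"
  proof (rule ex1I[of _ h])
    fix g assume g: "g \<in> bimod_hom R (T (T M N) P) (T M (T N P)) \<and>
      (\<forall>x\<in>carrier M. \<forall>y\<in>carrier N. \<forall>z\<in>carrier P.
        g (p (T M N) P (p M N x y) z) = p M (T N P) x (p N P y z))"
    show "g = h"
      by (rule hom_TT_left_eqI[OF ev conjunct1[OF g] h(1)]) (simp add: g h(2))
  qed (simp add: h)
  from theI'[OF this] show ?hom "PROP ?eval"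
    by (simp_all add: bimod_category_def)
qed

text \<open>The values of the inverse are exported as well, because the second hexagon mentions
  inverse associators and is evaluated on pure tensors.\<close>

lemma Assoc_inverse:
  assumes ev: "ev M" "ev N" "ev P"
  obtains g where "inverse_arrows C (T (T M N) P) (T M (T N P)) (Assoc C M N P) g"
    "g \<in> bimod_hom R (T M (T N P)) (T (T M N) P)"
    "\<And>x y z. \<lbrakk>x \<in> carrier M; y \<in> carrier N; z \<in> carrier P\<rbrakk>
      \<Longrightarrow> g (p M (T N P) x (p N P y z)) = p (T M N) P (p M N x y) z"
proof -
  have "\<exists>h \<in> bimod_hom R (T M (T N P)) (T (T M N) P).
      \<forall>x\<in>carrier M. \<forall>y\<in>carrier N. \<forall>z\<in>carrier P.
        h (p M (T N P) x (p N P y z)) = p (T M N) P (p M N x y) z"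
    by (rule hom_TT_right_lift)
      (auto intro!: balanced_mapI simp: ev p_add_left p_add_right p_balanced p_lact p_ract
        simp flip: p_balanced)
  then obtain g where g: "g \<in> bimod_hom R (T M (T N P)) (T (T M N) P)"
    "\<And>x y z. \<lbrakk>x \<in> carrier M; y \<in> carrier N; z \<in> carrier P\<rbrakk>
        \<Longrightarrow> g (p M (T N P) x (p N P y z)) = p (T M N) P (p M N x y) z"
    by blast
  note a = Assoc_hom[OF ev] Assoc_eval[OF ev]
  have 1: "compose (carrier (T (T M N) P)) g (Assoc C M N P) = (\<lambda>x\<in>carrier (T (T M N) P). x)"
    by (rule hom_TT_left_eqI[OF ev], (rule comp_hom id_hom a g)+) (simp_all add: ev id_hom compose_eq a g)
  have 2: "compose (carrier (T M (T N P))) (Assoc C M N P) g = (\<lambda>x\<in>carrier (T M (T N P)). x)"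
    by (rule hom_TT_right_eqI[OF ev], (rule comp_hom id_hom a g)+) (simp_all add: ev id_hom compose_eq a g)
  show thesis
    by (rule that[OF _ g]) (simp_all add: inverse_arrows_def a g 1 2)
qed

lemmas homs = comp_hom id_hom TArr_hom Assoc_hom LUnit_hom RUnit_hom
text \<open>The unfolded instance is included because simplification rewrites
  \<open>carrier I\<close> into the image under \<open>\<iota>\<close>, also inside the identity
  arrow of \<open>I\<close>.\<close>

lemmas evals = compose_eq TArr_eval Assoc_eval LUnit_eval RUnit_eval homs id_hom[OF ev_I, unfolded I_simps(1)]

lemma category_C: "category C"
proof
  fix X Y Z f g assume "X \<in> Obj C" "Y \<in> Obj C" "Z \<in> Obj C" "f \<in> Hom C X Y" "g \<in> Hom C Y Z"
  then show "Comp C X Y Z g f \<in> Hom C X Z" by (simp add: comp_hom)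
next
  fix X Y f assume "X \<in> Obj C" "Y \<in> Obj C" "f \<in> Hom C X Y"
  then show "Comp C X Y Y (Id C Y) f = f" "Comp C X X Y f (Id C X) = f"
    by (auto intro!: hom_eqI comp_hom id_hom simp: compose_eq bimod_hom_closed)
next
  fix W X Y Z f g h
  assume "W \<in> Obj C" "X \<in> Obj C" "Y \<in> Obj C" "Z \<in> Obj C"
    "f \<in> Hom C W X" "g \<in> Hom C X Y" "h \<in> Hom C Y Z"
  then show "Comp C W Y Z h (Comp C W X Y g f) = Comp C W X Z (Comp C X Y Z h g) f"
    by (auto intro!: extensionalityI[of _ "carrier W"] simp: compose_eq bimod_hom_closed)
qed (simp_all add: id_hom)

interpretation cat: category C by (rule category_C)

lemma inv_Assoc_props:
  assumes ev: "ev M" "ev N" "ev P"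
  shows inv_Assoc_hom: "inv_arrow C (T (T M N) P) (T M (T N P)) (Assoc C M N P)
      \<in> bimod_hom R (T M (T N P)) (T (T M N) P)" (is ?hom)
    and inv_Assoc_eval: "\<lbrakk>x \<in> carrier M; y \<in> carrier N; z \<in> carrier P\<rbrakk>
      \<Longrightarrow> inv_arrow C (T (T M N) P) (T M (T N P)) (Assoc C M N P) (p M (T N P) x (p N P y z)) =
          p (T M N) P (p M N x y) z" (is "PROP ?eval")
proof -
  obtain g where g: "inverse_arrows C (T (T M N) P) (T M (T N P)) (Assoc C M N P) g"
    "g \<in> bimod_hom R (T M (T N P)) (T (T M N) P)"
    "\<And>x y z. \<lbrakk>x \<in> carrier M; y \<in> carrier N; z \<in> carrier P\<rbrakk>
      \<Longrightarrow> g (p M (T N P) x (p N P y z)) = p (T M N) P (p M N x y) z"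
    using Assoc_inverse[OF ev] by blast
  have "inv_arrow C (T (T M N) P) (T M (T N P)) (Assoc C M N P) = g"
    using g(1) by (rule cat.inv_arrow_eq[rotated 2]) (simp_all add: ev)
  then show ?hom "PROP ?eval"
    using g by simp_all
qed

text \<open>Left linearity is balance: a (1 \<otimes> x) = a \<otimes> x = 1 \<otimes> ax. Besides
  inverting the left unit, the case M = I supplies the map from I to I \<otimes> I to which the
  braiding is compared later.\<close>

lemma LUnit_inverse_hom:
  assumes M: "ev M"
  shows "(\<lambda>x\<in>carrier M. p I M (\<iota> \<one>\<^bsub>R\<^esub>) x) \<in> bimod_hom R M (T I M)"
proof (rule bimod_homI)
  fix a x assume a: "a \<in> carrier R" and x: "x \<in> carrier M"
  then show "(\<lambda>x\<in>carrier M. p I M (\<iota> \<one>\<^bsub>R\<^esub>) x) (lact M a x) =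
      lact (T I M) a ((\<lambda>x\<in>carrier M. p I M (\<iota> \<one>\<^bsub>R\<^esub>) x) x)"
    using p_balanced[OF ev_I M, of "\<iota> \<one>\<^bsub>R\<^esub>" a x] by (simp add: M p_lact)
qed (simp_all add: M p_add_right p_ract)

lemma LUnit_iso: "ev M \<Longrightarrow> iso_arrow C (T I M) M (LUnit C M)"
proof -
  assume M: "ev M"
  interpret M: bimodule R R M using M by (rule ev_bimodule)
  define g where "g = (\<lambda>x\<in>carrier M. p I M (\<iota> \<one>\<^bsub>R\<^esub>) x)"
  have move: "p I M (\<iota> r) x = p I M (\<iota> \<one>\<^bsub>R\<^esub>) (lact M r x)" if "r \<in> carrier R" "x \<in> carrier M" for r x
    using p_balanced[OF ev_I M, of "\<iota> \<one>\<^bsub>R\<^esub>" r x] that by simp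
  have g: "g \<in> bimod_hom R M (T I M)"
    unfolding g_def by (rule LUnit_inverse_hom[OF M])
  have "inverse_arrows C (T I M) M (LUnit C M) g"
    unfolding inverse_arrows_def
  proof (intro conjI)
    show "Comp C (T I M) M (T I M) g (LUnit C M) = Id C (T I M)"
      unfolding C_simps
      by (rule hom_T_eqI[OF ev_I M], (rule homs g M ev_T ev_I)+)
        (auto simp: evals M g_def simp flip: move)
    show "Comp C M (T I M) M (LUnit C M) g = Id C M"
      unfolding C_simps
      by (rule hom_eqI, (rule homs g M)+) (simp_all add: evals M g_def M.lact_one)
  qed (simp_all add: g LUnit_hom M)
  then show ?thesis by (auto simp: iso_arrow_def)
qed

lemma RUnit_iso: "ev M \<Longrightarrow> iso_arrow C (T M I) M (RUnit C M)"
proof -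
  assume M: "ev M"
  interpret M: bimodule R R M using M by (rule ev_bimodule)
  define g where "g = (\<lambda>x\<in>carrier M. p M I x (\<iota> \<one>\<^bsub>R\<^esub>))"
  have move: "p M I x (\<iota> r) = p M I (ract M x r) (\<iota> \<one>\<^bsub>R\<^esub>)" if "r \<in> carrier R" "x \<in> carrier M" for r x
    using p_balanced[OF M ev_I, of x r "\<iota> \<one>\<^bsub>R\<^esub>"] that by simp
  have g: "g \<in> bimod_hom R M (T M I)"
    unfolding g_def
    by (rule bimod_homI) (simp_all add: M p_add_left p_lact p_ract flip: move)
  have "inverse_arrows C (T M I) M (RUnit C M) g"
    unfolding inverse_arrows_def
  proof (intro conjI)
    show "Comp C (T M I) M (T M I) g (RUnit C M) = Id C (T M I)"
      unfolding C_simps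
      by (rule hom_T_eqI[OF M ev_I], (rule homs g M ev_T ev_I)+)
        (auto simp: evals M g_def simp flip: move)
    show "Comp C M (T M I) M (RUnit C M) g = Id C M"
      unfolding C_simps
      by (rule hom_eqI, (rule homs g M)+) (simp_all add: evals M g_def M.ract_one)
  qed (simp_all add: g RUnit_hom M)
  then show ?thesis by (auto simp: iso_arrow_def)
qed

text \<open>Both sides of each equation are arrows out of an iterated tensor product; the uniqueness
  rule matching its bracketing leaves a computation on pure tensors.\<close>

theorem monoidal_category_C: "monoidal_category C"
proof (intro monoidal_category.intro category_C monoidal_category_axioms.intro, goal_cases)
  case (1 X Y)
  then show ?case by simp
next
  case (2 X X' Y Y' f g)
  then show ?case by (simp add: TArr_hom)
next
  case (3 X Y)
  then have ev: "ev X" "ev Y" by simp_all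
  show ?case
    unfolding C_simps by (rule hom_T_eqI[OF ev], (rule homs ev ev_T)+) (simp_all add: evals ev)
next
  case (4 X X' X'' Y Y' Y'' f f' g g')
  then have ev: "ev X" "ev X'" "ev X''" "ev Y" "ev Y'" "ev Y''"
    and h: "f \<in> bimod_hom R X X'" "f' \<in> bimod_hom R X' X''" "g \<in> bimod_hom R Y Y'" "g' \<in> bimod_hom R Y' Y''"
    by simp_all
  note c = bimod_hom_closed[OF h(1)] bimod_hom_closed[OF h(2)] bimod_hom_closed[OF h(3)] bimod_hom_closed[OF h(4)]
  have h': "compose (carrier X) f' f \<in> bimod_hom R X X''" "compose (carrier Y) g' g \<in> bimod_hom R Y Y''"
    by (rule comp_hom h ev)+
  show ?case
    unfolding C_simps
    by (rule hom_T_eqI[OF ev(1,4)], (rule h h' homs ev ev_T)+) (simp_all add: evals ev h h' c)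
next
  case 5
  show ?case by simp
next
  case (6 X Y Z)
  then have "ev X" "ev Y" "ev Z" by simp_all
  then obtain g where "inverse_arrows C (T (T X Y) Z) (T X (T Y Z)) (Assoc C X Y Z) g"
    by (rule Assoc_inverse)
  then show ?case by (auto simp: iso_arrow_def)
next
  case (7 X X' Y Y' Z Z' f g h)
  then have ev: "ev X" "ev X'" "ev Y" "ev Y'" "ev Z" "ev Z'"
    and h: "f \<in> bimod_hom R X X'" "g \<in> bimod_hom R Y Y'" "h \<in> bimod_hom R Z Z'"
    by simp_all
  note c = bimod_hom_closed[OF h(1)] bimod_hom_closed[OF h(2)] bimod_hom_closed[OF h(3)]
  show ?case
    unfolding C_simps
    by (rule hom_TT_left_eqI[OF ev(1,3,5)], (rule h homs ev ev_T)+) (simp_all add: evals ev h c)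
next
  case (8 X)
  then show ?case by (simp add: LUnit_iso)
next
  case (9 X Y f)
  then have ev: "ev X" "ev Y" and f: "f \<in> bimod_hom R X Y" by simp_all
  show ?case
    unfolding C_simps
    by (rule hom_T_eqI[OF ev_I ev(1)], (rule f homs ev ev_T ev_I)+) (auto simp: evals ev f bimod_homD[OF f])
next
  case (10 X)
  then show ?case by (simp add: RUnit_iso)
next
  case (11 X Y f)
  then have ev: "ev X" "ev Y" and f: "f \<in> bimod_hom R X Y" by simp_all
  show ?case
    unfolding C_simps
    by (rule hom_T_eqI[OF ev(1) ev_I], (rule f homs ev ev_T ev_I)+) (auto simp: evals ev f bimod_homD[OF f])
next
  case (12 W X Y Z)
  then have ev: "ev W" "ev X" "ev Y" "ev Z" by simp_all
  show ?case
    unfolding C_simps by (rule hom_TTT_left_eqI[OF ev], (rule homs ev ev_T)+) (simp_all add: evals ev)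
next
  case (13 X Y)
  then have ev: "ev X" "ev Y" by simp_all
  show ?case
    unfolding C_simps
    by (rule hom_TT_left_eqI[OF ev(1) ev_I ev(2)], (rule homs ev ev_T ev_I)+) (auto simp: evals ev p_balanced)
qed

text \<open>The flip of factors is well defined and bilinear because, for symmetric actions, a ring
  element can be moved freely: ax \<otimes> y = xa \<otimes> y = x \<otimes> ay. It is its own
  inverse, and both hexagons become trivial on pure tensors.\<close>

lemma braided_if_symmetric:
  assumes sym: "\<And>(M :: ('a, 'a, 'u) bimod) a x. \<lbrakk>ev M; a \<in> carrier R; x \<in> carrier M\<rbrakk>
    \<Longrightarrow> lact M a x = ract M x a"
  shows "\<exists>c. braided_monoidal_category C c"
proof -
  have slide: "p M N (lact M a x) y = p M N x (lact N a y)"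
    if "ev M" "ev N" "a \<in> carrier R" "x \<in> carrier M" "y \<in> carrier N" for M N a x y
    using p_balanced[of M N x a y] sym[of M a x] that by simp
  have sym': "ract M x a = lact M a x" if "ev M" "a \<in> carrier R" "x \<in> carrier M" for M a x
    using sym[OF that] by simp
  have "\<exists>h. h \<in> bimod_hom R (T M N) (T N M) \<and>
      (\<forall>x\<in>carrier M. \<forall>y\<in>carrier N. h (p M N x y) = p N M y x)" if "ev M" "ev N" for M N
    by (rule ex1_implies_ex, rule hom_T_the)
      (auto intro!: balanced_mapI simp: that p_add_left p_add_right p_lact p_ract sym' slide)
  then obtain c where c: "\<And>M N. \<lbrakk>ev M; ev N\<rbrakk> \<Longrightarrow> c M N \<in> bimod_hom R (T M N) (T N M)"
    and cp: "\<And>M N x y. \<lbrakk>ev M; ev N; x \<in> carrier M; y \<in> carrier N\<rbrakk> \<Longrightarrow> c M N (p M N x y) = p N M y x"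
    by metis
  have inverse: "compose (carrier (T X Y)) (c Y X) (c X Y) = (\<lambda>x\<in>carrier (T X Y). x)"
    if "ev X" "ev Y" for X Y
    by (rule hom_T_eqI[OF that], (rule c homs that ev_T)+) (simp_all add: evals c cp that)
  have "braided_monoidal_category C c"
  proof (intro braided_monoidal_category.intro monoidal_category_C braided_monoidal_category_axioms.intro,
      goal_cases)
    case (1 X Y)
    then show ?case
      unfolding iso_arrow_def inverse_arrows_def by (intro exI[of _ "c Y X"]) (simp add: c inverse)
  next
    case (2 X X' Y Y' f g)
    then have ev: "ev X" "ev X'" "ev Y" "ev Y'" and h: "f \<in> bimod_hom R X X'" "g \<in> bimod_hom R Y Y'"
      by simp_all
    show ?case
      unfolding C_simps
      by (rule hom_T_eqI[OF ev(1,3)], (rule c h homs ev ev_T)+)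
        (simp_all add: evals c cp ev h bimod_hom_closed[OF h(1)] bimod_hom_closed[OF h(2)])
  next
    case (3 X Y Z)
    then have ev: "ev X" "ev Y" "ev Z" by simp_all
    show ?case
      unfolding C_simps
      by (rule hom_TT_left_eqI[OF ev], (rule c homs ev ev_T)+) (simp_all add: evals c cp ev)
  next
    case (4 X Y Z)
    then have ev: "ev X" "ev Y" "ev Z" by simp_all
    show ?case
      unfolding C_simps
      by (rule hom_TT_right_eqI[OF ev], (rule c homs inv_Assoc_hom ev ev_T)+)
        (simp_all add: evals inv_Assoc_hom inv_Assoc_eval c cp ev)
  qed
  then show ?thesis by blast
qed

text \<open>Every element of I \<otimes> M is thus of the form 1 \<otimes> m, which allows a map
  into I \<otimes> M to be read as a map into M.\<close>

lemma LUnit_inverse: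
  assumes M: "ev M" and X: "X \<in> carrier (T I M)"
  shows "p I M (\<iota> \<one>\<^bsub>R\<^esub>) (LUnit C M X) = X"
  using X
proof (induction rule: T_induct[OF ev_I M, consumes 1, case_names pure add])
  case (pure x y)
  then obtain r where r: "r \<in> carrier R" "x = \<iota> r" by auto
  then show ?case
    using pure p_balanced[OF ev_I M, of "\<iota> \<one>\<^bsub>R\<^esub>" r y] bimodule.lact_one[OF ev_bimodule[OF M]]
    by (simp add: LUnit_eval M)
next
  case (add X Y)
  then show ?case
    using bimod_homD[OF LUnit_hom[OF M]] by (simp add: M p_add_right)
qed

text \<open>Two instances of the braiding suffice. The first hexagon for \<open>M, I, I\<close>, with naturality along
  \<open>I \<rightarrow> I \<otimes> I\<close>, shows that \<open>c M I\<close> becomes idempotent, hence the identity, after identifying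
  \<open>M \<otimes> I\<close> and \<open>I \<otimes> M\<close> with \<open>M\<close>. Naturality along multiplication by \<open>z\<close> on \<open>I\<close> then turns
  the right action of \<open>z\<close> into the left one.\<close>

lemma symmetric_if_braided:
  assumes "braided_monoidal_category C c" and M: "ev M" and m: "m \<in> carrier M"
    and z: "z \<in> carrier R" and central: "\<And>a. a \<in> carrier R \<Longrightarrow> z \<otimes>\<^bsub>R\<^esub> a = a \<otimes>\<^bsub>R\<^esub> z"
  shows "lact M z m = ract M m z"
proof -
  interpret B: braided_monoidal_category C c by fact
  interpret M: bimodule R R M using M by (rule ev_bimodule)
  interpret I: bimodule R R I using ev_I by (rule ev_bimodule)
  let ?e = "\<iota> \<one>\<^bsub>R\<^esub>"
  have one: "?e \<in> carrier I" by simp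
  obtain g where g: "inverse_arrows C (T M I) (T I M) (c M I) g"
    using B.braid_iso[of M I] M by (auto simp: iso_arrow_def)
  then have c: "c M I \<in> bimod_hom R (T M I) (T I M)"
    and gc: "compose (carrier (T M I)) g (c M I) = (\<lambda>x\<in>carrier (T M I). x)"
    by (simp_all add: inverse_arrows_def)
  \<comment> \<open>The self-map of M obtained from the braiding by identifying x \<otimes> 1 and 1
    \<otimes> x with x.\<close>
  define w where "w x = LUnit C M (c M I (p M I x ?e))" for x
  have w: "w x \<in> carrier M" if "x \<in> carrier M" for x
    unfolding w_def using that M by (intro bimod_hom_closed[OF LUnit_hom] bimod_hom_closed[OF c] p_closed) simp_all
  have cw: "c M I (p M I x ?e) = p I M ?e (w x)" if "x \<in> carrier M" for x
    unfolding w_def using that M by (intro LUnit_inverse[symmetric] bimod_hom_closed[OF c] p_closed) simp_all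
  have p_inj: "x = y" if "p I M ?e x = p I M ?e y" "x \<in> carrier M" "y \<in> carrier M" for x y
    using arg_cong[OF that(1), of "LUnit C M"] that(2,3) by (simp add: LUnit_eval M M.lact_one)
  \<comment> \<open>Injectivity comes from the inverse arrow \<open>g\<close>; it is what turns the
    idempotence of \<open>w\<close> into \<open>w x = x\<close>.\<close>
  have w_inj: "x = y" if "w x = w y" "x \<in> carrier M" "y \<in> carrier M" for x y
  proof -
    have "p M I x' ?e = g (p I M ?e (w x'))" if "x' \<in> carrier M" for x'
      using fun_cong[OF gc, of "p M I x' ?e"] that M by (simp add: compose_eq cw)
    then have "RUnit C M (p M I x ?e) = RUnit C M (p M I y ?e)" using that by simp
    then show ?thesis using that(2,3) by (simp add: RUnit_eval M M.ract_one)
  qed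
  \<comment> \<open>Naturality in the second variable expresses the braiding with any J on x
    \<otimes> h(1) through \<open>w\<close> alone. It is applied to the map from I to I \<otimes> I
    and to multiplication by z.\<close>
  have nat: "c M J (p M J x (h ?e)) = p J M (h ?e) (w x)"
    if h: "h \<in> bimod_hom R I J" and J: "ev J" and x: "x \<in> carrier M" for h J x
  proof -
    have "compose (carrier (T M I)) (c M J) (TArr C M M I J (\<lambda>x\<in>carrier M. x) h) =
        compose (carrier (T M I)) (TArr C I J M M h (\<lambda>x\<in>carrier M. x)) (c M I)"
      using B.braid_natural[of M M I J "\<lambda>x\<in>carrier M. x" h] M h J id_hom[OF M] by simp
    from fun_cong[OF this, of "p M I x ?e"] show ?thesis
      using M h J x w by (simp add: evals id_hom cw)
  qed
  have ww: "w (w x) = w x" if x: "x \<in> carrier M" for x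
  proof -
    define k where "k = (\<lambda>y\<in>carrier I. p I I ?e y)"
    have k: "k \<in> bimod_hom R I (T I I)"
      unfolding k_def by (rule LUnit_inverse_hom[OF ev_I])
    have ke: "k ?e = p I I ?e ?e" by (simp add: k_def)
    \<comment> \<open>The two sides of the hexagon at (x \<otimes> 1) \<otimes> 1: the side through
      I \<otimes> I uses one braiding and gives \<open>w x\<close>, the other uses the braiding with
      I twice and gives \<open>w (w x)\<close>. The left unit then strips the outer factor
      1.\<close>
    have "p I (T I M) ?e (p I M ?e (w x)) = Assoc C I I M (c M (T I I) (p M (T I I) x (k ?e)))"
      using M x w nat[OF k ev_T[OF ev_I ev_I] x, unfolded ke]
      by (simp add: ke Assoc_eval)
    also have "\<dots> = Assoc C I I M (c M (T I I) (Assoc C M I I (p (T M I) I (p M I x ?e) ?e)))"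
      using M x by (simp add: ke Assoc_eval)
    also have "\<dots> = TArr C I I (T M I) (T I M) (\<lambda>x\<in>carrier I. x) (c M I)
        (Assoc C I M I (TArr C (T M I) (T I M) I I (c M I) (\<lambda>x\<in>carrier I. x) (p (T M I) I (p M I x ?e) ?e)))"
      using fun_cong[OF B.hexagon1[of M I I, unfolded C_simps], of "p (T M I) I (p M I x ?e) ?e"] M x
      by (simp add: compose_eq)
    also have "\<dots> = p I (T I M) ?e (p I M ?e (w (w x)))"
      using M x w c by (simp add: evals id_hom cw)
    finally have "LUnit C (T I M) (p I (T I M) ?e (p I M ?e (w x))) =
        LUnit C (T I M) (p I (T I M) ?e (p I M ?e (w (w x))))" by simp
    then have "p I M ?e (w x) = p I M ?e (w (w x))"
      using M x w by (simp add: LUnit_eval p_lact)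
    then show ?thesis by (rule p_inj[symmetric]) (intro w x)+
  qed
  have w_id: "w x = x" if "x \<in> carrier M" for x
    using w_inj[OF ww] w that by simp
  \<comment> \<open>Multiplication by z respects both actions because z is central.\<close>
  define h where "h = (\<lambda>y\<in>carrier I. ract I y z)"
  have h: "h \<in> bimod_hom R I I"
    unfolding h_def using z
    by (intro bimod_homI)
      (simp_all add: I.ract_add_left I.lact_ract I.ract_closed I.lact_closed
        central flip: I.ract_mult del: I_simps)
  have "p I M ?e (ract M m z) = c M I (p M I (ract M m z) ?e)"
    using cw w_id M m z by simp
  also have "\<dots> = c M I (p M I m (h ?e))"
    using M m z by (simp add: p_balanced h_def)
  also have "\<dots> = p I M (h ?e) m"
    using nat[OF h ev_I m] w_id m by simp
  also have "\<dots> = p I M ?e (lact M z m)"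
    using p_balanced[OF ev_I M, of ?e z m] M m z by (simp add: h_def)
  finally have "ract M m z = lact M z m"
    by (rule p_inj) (simp_all add: M m z)
  then show ?thesis by simp
qed

end

section \<open>The enveloping bimodule\<close>

lemma ev_module_univ_copy:
  fixes M :: "('a, 'a, 'm) bimod"
  assumes "assoc_algebra K A" and M: "ev_module K A M" and le: "carrier M \<lesssim> (UNIV :: 'u set)"
  shows "ev_module K A (univ_copy M :: ('a, 'a, 'u) bimod)"
proof -
  interpret assoc_algebra K A by fact
  show ?thesis
    using M bimodule_univ_copy[OF _ le] by (auto simp: ev_module_def univ_copy_simps[OF le])
qed

text \<open>The two records inside \<open>outer_bimod\<close>, named so that the general theory of
  tensor pairs applies to A \<otimes> A.\<close>

abbreviation outer_left :: "('k, 'a) module \<Rightarrow> ('a, 'k, 'a) bimod" where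
  "outer_left A \<equiv> \<lparr>carrier = carrier A, monoid.mult = monoid.mult A, one = \<one>\<^bsub>A\<^esub>, ring.zero = \<zero>\<^bsub>A\<^esub>, add = add A,
      lact = monoid.mult A, ract = (\<lambda>x k. k \<odot>\<^bsub>A\<^esub> x)\<rparr>"

abbreviation outer_right :: "('k, 'a) module \<Rightarrow> ('k, 'a, 'a) bimod" where
  "outer_right A \<equiv> \<lparr>carrier = carrier A, monoid.mult = monoid.mult A, one = \<one>\<^bsub>A\<^esub>, ring.zero = \<zero>\<^bsub>A\<^esub>, add = add A,
      lact = smult A, ract = monoid.mult A\<rparr>"

lemma abelian_group_cong:
  assumes "abelian_group G" "carrier H = carrier G" "add H = add G" "\<zero>\<^bsub>H\<^esub> = \<zero>\<^bsub>G\<^esub>"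
  shows "abelian_group H"
proof -
  interpret G: abelian_group G by fact
  have "\<exists>y\<in>carrier G. y \<oplus>\<^bsub>G\<^esub> x = \<zero>\<^bsub>G\<^esub>" if "x \<in> carrier G" for x
    using that by (intro bexI[of _ "\<ominus>\<^bsub>G\<^esub> x"]) (simp_all add: G.l_neg)
  then show ?thesis
    by (intro abelian_groupI) (simp_all add: assms G.a_ac)
qed

context
  fixes K :: "'k ring" and A :: "('k, 'a) module" (structure)
  assumes alg: "assoc_algebra K A"
begin

interpretation assoc_algebra K A by (rule alg)

lemma tensor_pair_outer: "tensor_pair A K A (outer_left A) (outer_right A)"
proof (intro tensor_pair.intro)
  have "abelian_group (outer_left A)" "abelian_group (outer_right A)"
    by (rule abelian_group_cong[OF A.is_abelian_group]; simp)+
  then show "bimodule A K (outer_left A)" "bimodule K A (outer_right A)"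
    by (auto intro!: bimodule.intro bimodule_axioms.intro A.ring_axioms R.ring_axioms
      simp: A.l_distr A.r_distr A.m_assoc smult_l_distr smult_r_distr smult_mult_left smult_mult_right
        smult_assoc1 R.m_comm simp flip: smult_assoc1)
qed

interpretation O: tensor_pair A K A "outer_left A" "outer_right A" by (rule tensor_pair_outer)

lemma outer_bimod_eq: "outer_bimod K A = O.T"
  by (simp add: outer_bimod_def)

lemma scalar_left: "\<lbrakk>k \<in> carrier K; x \<in> carrier A\<rbrakk> \<Longrightarrow> (k \<odot> \<one>) \<otimes> x = k \<odot> x"
  by (simp add: smult_mult_left)

lemma scalar_right: "\<lbrakk>k \<in> carrier K; x \<in> carrier A\<rbrakk> \<Longrightarrow> x \<otimes> (k \<odot> \<one>) = k \<odot> x"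
  by (simp add: smult_mult_right)

lemma ev_module_outer: "ev_module K A (outer_bimod K A)"
  unfolding ev_module_def outer_bimod_eq
proof (intro conjI ballI)
  show "bimodule A A O.T" by (rule O.bimodule_T)
  interpret OT: bimodule A A O.T by (rule O.bimodule_T)
  fix k X assume k: "k \<in> carrier K" and "X \<in> carrier O.T"
  from this(2) show "lact O.T (k \<odot> \<one>) X = ract O.T X (k \<odot> \<one>)"
  proof (induction rule: O.tensor_induct)
    case (pure x y)
    then show ?case
      using O.pure_balanced[of x k y] k by (simp add: O.lact_T O.ract_T scalar_left scalar_right)
  next
    case (add X Y)
    then show ?case using k by (simp add: OT.lact_add_right OT.ract_add_left)
  qed
qed

lemma outer_small:
  assumes "infinite (UNIV :: 'u set)" "carrier A \<lesssim> (UNIV :: 'u set)"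
  shows "carrier (outer_bimod K A) \<lesssim> (UNIV :: 'u set)"
  unfolding outer_bimod_eq using assms by (intro O.tensor_lepoll) simp_all

text \<open>The commutation with z is evaluated at 1 \<otimes> 1.\<close>

lemma outer_pure_commute:
  assumes "z \<in> relative_center A (outer_bimod K A)"
  shows "O.pure z \<one> = O.pure \<one> z"
proof -
  have z: "z \<in> carrier A" and eq: "\<And>X. X \<in> carrier O.T \<Longrightarrow> lact O.T z X = ract O.T X z"
    using assms by (auto simp: relative_center_def center_def outer_bimod_eq)
  have "O.pure \<one> \<one> \<in> carrier O.T" by (rule O.pure_closed) simp_all
  from eq[OF this] show ?thesis using z by (simp add: O.lact_T O.ract_T)
qed

text \<open>A linear form induces the map from A \<otimes> A to A sending x \<otimes> y to phi(x) y;
  it is applied to z \<otimes> 1 = 1 \<otimes> z.\<close>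

lemma outer_commute_scalars:
  assumes z: "z \<in> relative_center A (outer_bimod K A)" and \<phi>: "\<phi> \<in> carrier A \<rightarrow> carrier K"
    and add: "\<And>x y. \<lbrakk>x \<in> carrier A; y \<in> carrier A\<rbrakk> \<Longrightarrow> \<phi> (x \<oplus> y) = \<phi> x \<oplus>\<^bsub>K\<^esub> \<phi> y"
    and smult: "\<And>k x. \<lbrakk>k \<in> carrier K; x \<in> carrier A\<rbrakk> \<Longrightarrow> \<phi> (k \<odot> x) = k \<otimes>\<^bsub>K\<^esub> \<phi> x"
  shows "\<phi> z \<odot> \<one> = \<phi> \<one> \<odot> z"
proof -
  have zA: "z \<in> carrier A" using z by (auto simp: relative_center_def center_def)
  have c: "x \<in> carrier A \<Longrightarrow> \<phi> x \<in> carrier K" for x using \<phi> by auto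
  have "balanced_map (carrier K) (outer_left A) (outer_right A) A (\<lambda>x y. \<phi> x \<odot> y)"
    by (intro balanced_mapI)
      (simp_all add: c add smult smult_l_distr smult_r_distr R.m_comm flip: smult_assoc1)
  then obtain h where "\<And>x y. \<lbrakk>x \<in> carrier (outer_left A); y \<in> carrier (outer_right A)\<rbrakk>
      \<Longrightarrow> h (O.pure x y) = \<phi> x \<odot> y"
    using O.tensor_lift[OF A.is_abelian_group] by blast
  then show ?thesis
    using outer_pure_commute[OF z] zA by (metis A.one_closed partial_object.select_convs(1))
qed

end

section \<open>Projective algebras with scalar enveloping center\<close>

text \<open>Coefficients and generators are separate arguments, since Nakayama's lemma compares
  combinations with coefficients in J to those with coefficients in the whole ring. A list of
  generators lets them be eliminated by structural induction.\<close>

fun span_list :: "('k, 'x) ring_scheme \<Rightarrow> 'k set \<Rightarrow> 'k list \<Rightarrow> 'k set" where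
  "span_list K B [] = {\<zero>\<^bsub>K\<^esub>}"
| "span_list K B (v # vs) = {b \<otimes>\<^bsub>K\<^esub> v \<oplus>\<^bsub>K\<^esub> y | b y. b \<in> B \<and> y \<in> span_list K B vs}"

section \<open>Finitely generated ideals and Nakayama's lemma\<close>

context cring
begin

lemma span_list_ConsI:
  "\<lbrakk>x = b \<otimes> v \<oplus> y; b \<in> B; y \<in> span_list R B vs\<rbrakk> \<Longrightarrow> x \<in> span_list R B (v # vs)"
  by auto

lemma span_list_closed:
  assumes "B \<subseteq> carrier R" "set vs \<subseteq> carrier R"
  shows "span_list R B vs \<subseteq> carrier R"
  using assms(2) by (induction vs) (use assms(1) in auto)

lemma span_list_mono: "B \<subseteq> B' \<Longrightarrow> span_list R B vs \<subseteq> span_list R B' vs"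
  by (induction vs) auto

lemma span_list_zero:
  assumes "\<zero> \<in> B" "set vs \<subseteq> carrier R"
  shows "\<zero> \<in> span_list R B vs"
  using assms(2)
proof (induction vs)
  case (Cons v vs)
  then have "\<zero> = \<zero> \<otimes> v \<oplus> \<zero>" "\<zero> \<in> span_list R B vs" by simp_all
  then show ?case using assms(1) by (intro span_list_ConsI)
qed simp

lemma span_list_add:
  assumes "ideal B R" "set vs \<subseteq> carrier R" "x \<in> span_list R B vs" "y \<in> span_list R B vs"
  shows "x \<oplus> y \<in> span_list R B vs"
  using assms(2-4)
proof (induction vs arbitrary: x y)
  case (Cons v vs)
  interpret B: ideal B R by fact
  have sub: "B \<subseteq> carrier R" by (rule B.a_subset)
  obtain b x' c y' where 1: "x = b \<otimes> v \<oplus> x'" "b \<in> B" "x' \<in> span_list R B vs"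
    and 2: "y = c \<otimes> v \<oplus> y'" "c \<in> B" "y' \<in> span_list R B vs"
    using Cons.prems(2,3) by auto
  have "x' \<in> carrier R" "y' \<in> carrier R" "b \<in> carrier R" "c \<in> carrier R"
    using span_list_closed[OF sub, of vs] sub Cons.prems(1) 1 2 by auto
  then have "x \<oplus> y = (b \<oplus> c) \<otimes> v \<oplus> (x' \<oplus> y')"
    using Cons.prems(1) 1(1) 2(1) by (simp add: l_distr a_ac)
  moreover have "x' \<oplus> y' \<in> span_list R B vs" using Cons 1 2 by simp
  moreover have "b \<oplus> c \<in> B" using 1 2 by simp
  ultimately show ?case by (intro span_list_ConsI)
qed simp

text \<open>Multiplication may change the coefficient set: with k in an ideal, arbitrary
  coefficients become coefficients in that ideal.\<close>

lemma span_list_mult: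
  assumes B: "B \<subseteq> carrier R" and closed: "\<And>b. b \<in> B \<Longrightarrow> k \<otimes> b \<in> C" and k: "k \<in> carrier R"
    and "set vs \<subseteq> carrier R" "x \<in> span_list R B vs"
  shows "k \<otimes> x \<in> span_list R C vs"
  using assms(4,5)
proof (induction vs arbitrary: x)
  case (Cons v vs)
  obtain b y where x: "x = b \<otimes> v \<oplus> y" "b \<in> B" "y \<in> span_list R B vs"
    using Cons.prems(2) by auto
  have "y \<in> carrier R" "b \<in> carrier R"
    using span_list_closed[OF B, of vs] B Cons.prems(1) x by auto
  then have "k \<otimes> x = (k \<otimes> b) \<otimes> v \<oplus> k \<otimes> y"
    using Cons.prems(1) k x(1) by (simp add: r_distr m_assoc)
  moreover have "k \<otimes> y \<in> span_list R C vs" using Cons x by simp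
  ultimately show ?case using closed[OF x(2)] by (intro span_list_ConsI)
qed (use k in simp)

lemma span_list_member:
  assumes "set vs \<subseteq> carrier R" "v \<in> set vs"
  shows "v \<in> span_list R (carrier R) vs"
  using assms
proof (induction vs)
  case (Cons w vs)
  show ?case
  proof (cases "v = w")
    case True
    then have "v = \<one> \<otimes> w \<oplus> \<zero>" using Cons.prems by simp
    then show ?thesis using span_list_zero[of "carrier R" vs] Cons.prems
      by (intro span_list_ConsI[of v \<one> w \<zero>]) simp_all
  next
    case False
    then have v: "v \<in> span_list R (carrier R) vs" using Cons by simp
    have "v = \<zero> \<otimes> w \<oplus> v" using Cons.prems by auto
    then show ?thesis by (rule span_list_ConsI) (use v in simp_all)
  qed
qed simp

lemma span_list_finsum:
  assumes "ideal J R" "distinct ss" "v ` set ss \<subseteq> carrier R" "\<And>s. s \<in> set ss \<Longrightarrow> q s \<in> J"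
  shows "(\<Oplus>s\<in>set ss. q s \<otimes> v s) \<in> span_list R J (map v ss)"
  using assms(2-4)
proof (induction ss)
  case (Cons s ss)
  interpret J: ideal J R by fact
  have q: "q t \<in> carrier R" if "t \<in> set (s # ss)" for t
    using Cons.prems(3)[OF that] J.a_subset by auto
  have "(\<Oplus>t\<in>set (s # ss). q t \<otimes> v t) = q s \<otimes> v s \<oplus> (\<Oplus>t\<in>set ss. q t \<otimes> v t)"
    using Cons.prems(1,2) q by (simp add: finsum_insert Pi_def image_subset_iff)
  moreover have "(\<Oplus>t\<in>set ss. q t \<otimes> v t) \<in> span_list R J (map v ss)"
    using Cons by simp
  moreover have "q s \<in> J" using Cons.prems(3) by simp
  ultimately show ?case unfolding list.map by (intro span_list_ConsI)
qed simp

text \<open>Keeps coefficients in J while the generators change: once d carries the old generators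
  into the span of the new ones, an old relation with coefficients in J becomes a new one.\<close>

lemma span_list_transfer:
  assumes J: "ideal J R" and d: "d \<in> carrier R" and "set vs \<subseteq> carrier R" "set ws \<subseteq> carrier R"
    and "x \<in> span_list R J vs" "\<And>v. v \<in> set vs \<Longrightarrow> d \<otimes> v \<in> span_list R (carrier R) ws"
  shows "d \<otimes> x \<in> span_list R J ws"
  using assms(3,5,6)
proof (induction vs arbitrary: x)
  case Nil
  interpret J: ideal J R by fact
  show ?case using Nil d span_list_zero[OF _ assms(4), of J] by simp
next
  case (Cons v vs)
  interpret J: ideal J R by fact
  have sub: "J \<subseteq> carrier R" by (rule J.a_subset)
  obtain b y where x: "x = b \<otimes> v \<oplus> y" "b \<in> J" "y \<in> span_list R J vs"
    using Cons.prems(2) by auto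
  have c: "y \<in> carrier R" "b \<in> carrier R" "v \<in> carrier R"
    using span_list_closed[OF sub, of vs] sub Cons.prems(1) x by auto
  then have "d \<otimes> x = b \<otimes> (d \<otimes> v) \<oplus> d \<otimes> y"
    using d x(1) by (simp add: r_distr m_ac)
  moreover have "b \<otimes> (d \<otimes> v) \<in> span_list R J ws"
    by (rule span_list_mult[of "carrier R"]) (use c x Cons.prems assms(4) in \<open>auto intro: J.I_r_closed\<close>)
  moreover have "d \<otimes> y \<in> span_list R J ws" using Cons x by simp
  ultimately show ?case using span_list_add[OF J assms(4)] by simp
qed

text \<open>Nakayama's lemma by elimination: the generators are removed one by one, at the price of
  multiplying by an element congruent to \<open>\<one>\<close> modulo \<open>J\<close>.\<close>

lemma nakayama_list:
  assumes J: "ideal J R" and vs: "set vs \<subseteq> carrier R"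
    and gen: "\<And>v. v \<in> set vs \<Longrightarrow> v \<in> span_list R J vs"
  obtains d where "d \<in> carrier R" "\<one> \<ominus> d \<in> J" "\<And>v. v \<in> set vs \<Longrightarrow> d \<otimes> v = \<zero>"
proof -
  interpret J: ideal J R by fact
  have sub: "J \<subseteq> carrier R" by (rule J.a_subset)
  \<comment> \<open>Invariant of the elimination: \<open>ws\<close> holds the generators that
    remain, and \<open>d\<close>, congruent to 1 modulo J, carries every original generator into
    their span. With \<open>ws\<close> empty, \<open>d\<close> annihilates all of them.\<close>
  have elim: "\<exists>d\<in>carrier R. \<one> \<ominus> d \<in> J \<and> (\<forall>v\<in>set vs. d \<otimes> v = \<zero>)"
    if "set ws \<subseteq> set vs" "d \<in> carrier R" "\<one> \<ominus> d \<in> J"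
      "\<And>v. v \<in> set vs \<Longrightarrow> d \<otimes> v \<in> span_list R (carrier R) ws" for d ws
    using that
  proof (induction ws arbitrary: d)
    case Nil
    then show ?case by auto
  next
    case (Cons w ws)
    have w: "w \<in> carrier R" "w \<in> set vs" and ws: "set ws \<subseteq> carrier R" "set (w # ws) \<subseteq> carrier R"
      using Cons.prems(1) vs by auto
    have "d \<otimes> w \<in> span_list R J (w # ws)"
      by (rule span_list_transfer[OF J Cons.prems(2) vs ws(2) gen[OF w(2)] Cons.prems(4)])
    then obtain b y where b: "b \<in> J" "y \<in> span_list R J ws" "d \<otimes> w = b \<otimes> w \<oplus> y" by auto
    have bc: "b \<in> carrier R" "y \<in> carrier R" using b(1,2) sub span_list_closed[OF sub ws(1)] by auto
    \<comment> \<open>The relation d w = b w + y has b in J, so d - b is still congruent to 1 and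
      sends w into the span of the later generators.\<close>
    have dw: "(d \<ominus> b) \<otimes> w = y"
      using b(3) bc w(1) Cons.prems(2) by (simp add: minus_eq l_distr l_minus a_ac) (simp add: r_neg1 r_neg2 r_neg a_ac)
    have yK: "y \<in> span_list R (carrier R) ws" using span_list_mono[OF sub] b(2) by blast
    \<comment> \<open>The factor d brings each generator into the span of w and \<open>ws\<close>,
      and the factor d - b then removes w.\<close>
    let ?d = "(d \<ominus> b) \<otimes> d"
    show ?case
    proof (rule Cons.IH)
      show "set ws \<subseteq> set vs" using Cons.prems(1) by auto
      show "?d \<in> carrier R" using bc Cons.prems(2) by simp
      have "\<one> \<ominus> ?d = (\<one> \<ominus> d) \<oplus> (\<one> \<ominus> d) \<otimes> d \<oplus> b \<otimes> d"
        using bc Cons.prems(2) by algebra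
      then show "\<one> \<ominus> ?d \<in> J" using b(1) Cons.prems(2,3) by (simp add: J.I_r_closed)
      fix v assume v: "v \<in> set vs"
      obtain a x where x: "a \<in> carrier R" "x \<in> span_list R (carrier R) ws" "d \<otimes> v = a \<otimes> w \<oplus> x"
        using Cons.prems(4)[OF v] by auto
      have xc: "x \<in> carrier R" using x(2) span_list_closed[OF _ ws(1)] by blast
      have "?d \<otimes> v = (d \<ominus> b) \<otimes> (d \<otimes> v)" using v vs bc Cons.prems(2) by (auto simp: m_assoc)
      also have "\<dots> = a \<otimes> ((d \<ominus> b) \<otimes> w) \<oplus> (d \<ominus> b) \<otimes> x"
        unfolding x(3) using x(1) xc w(1) bc Cons.prems(2) by (simp add: r_distr m_ac)
      also have "\<dots> = a \<otimes> y \<oplus> (d \<ominus> b) \<otimes> x" by (simp add: dw)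
      also have "\<dots> \<in> span_list R (carrier R) ws"
        using x yK bc Cons.prems(2) ws(1)
        by (intro span_list_add oneideal span_list_mult[of "carrier R"]) auto
      finally show "?d \<otimes> v \<in> span_list R (carrier R) ws" .
    qed
  qed
  have "\<exists>d\<in>carrier R. \<one> \<ominus> d \<in> J \<and> (\<forall>v\<in>set vs. d \<otimes> v = \<zero>)"
  proof (rule elim[of vs \<one>])
    show "\<one> \<ominus> \<one> \<in> J" by (simp add: minus_eq r_neg)
    show "\<one> \<otimes> v \<in> span_list R (carrier R) vs" if "v \<in> set vs" for v
      using span_list_member[OF vs that] that vs by (simp add: subset_iff)
  qed simp_all
  then show thesis using that by blast
qed

end

text \<open>In contrast to \<open>univ_copy\<close> the injection is an argument, because it is
  composed with other maps when a lifting problem is set up in the universe.\<close>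

definition module_copy :: "('m \<Rightarrow> 'u) \<Rightarrow> ('k, 'm) module \<Rightarrow> ('k, 'u) module" where
  "module_copy e M = (let d = inv_into (carrier M) e in
     \<lparr>carrier = e ` carrier M, monoid.mult = undefined, one = undefined, ring.zero = e \<zero>\<^bsub>M\<^esub>,
      add = (\<lambda>x y. e (d x \<oplus>\<^bsub>M\<^esub> d y)), smult = (\<lambda>k x. e (k \<odot>\<^bsub>M\<^esub> d x))\<rparr>)"

lemma module_copy_simps:
  assumes "inj_on e (carrier M)"
  shows "carrier (module_copy e M) = e ` carrier M" "\<zero>\<^bsub>module_copy e M\<^esub> = e \<zero>\<^bsub>M\<^esub>"
    "\<lbrakk>x \<in> carrier M; y \<in> carrier M\<rbrakk> \<Longrightarrow> e x \<oplus>\<^bsub>module_copy e M\<^esub> e y = e (x \<oplus>\<^bsub>M\<^esub> y)"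
    "x \<in> carrier M \<Longrightarrow> k \<odot>\<^bsub>module_copy e M\<^esub> e x = e (k \<odot>\<^bsub>M\<^esub> x)"
  using assms by (simp_all add: module_copy_def Let_def)

lemma module_module_copy:
  fixes M :: "('k, 'm) module"
  assumes "module K M" "inj_on e (carrier M)"
  shows "module K (module_copy e M)"
proof -
  interpret module K M by fact
  note copy = module_copy_simps[OF assms(2)]
  show ?thesis
  proof (rule moduleI)
    show "abelian_group (module_copy e M)"
    proof (rule abelian_groupI; unfold copy(1,2))
      fix x assume x: "x \<in> e ` carrier M"
      then obtain y where y: "y \<in> carrier M" "x = e y" by blast
      show "\<exists>y\<in>e ` carrier M. y \<oplus>\<^bsub>module_copy e M\<^esub> x = e \<zero>\<^bsub>M\<^esub>"
        using copy(3)[of "\<ominus>\<^bsub>M\<^esub> y" y] y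
        by (intro bexI[of _ "e (\<ominus>\<^bsub>M\<^esub> y)"]) (simp_all add: M.l_neg)
    qed (auto simp: copy M.a_ac)
  qed (auto simp: copy smult_l_distr smult_r_distr smult_assoc1 R.cring_axioms)
qed

section \<open>Free modules and dual bases of projective modules\<close>

definition free_module :: "('k, 'c) ring_scheme \<Rightarrow> 'b set \<Rightarrow> ('k, 'b \<Rightarrow> 'k) module" where
  "free_module K X = \<lparr>carrier = {f. (\<forall>x. f x \<in> carrier K) \<and> {x. f x \<noteq> \<zero>\<^bsub>K\<^esub>} \<subseteq> X \<and> finite {x. f x \<noteq> \<zero>\<^bsub>K\<^esub>}},
     monoid.mult = undefined, one = undefined, ring.zero = (\<lambda>_. \<zero>\<^bsub>K\<^esub>),
     add = (\<lambda>f g x. f x \<oplus>\<^bsub>K\<^esub> g x), smult = (\<lambda>k f x. k \<otimes>\<^bsub>K\<^esub> f x)\<rparr>"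

lemma module_free_module:
  fixes K :: "('k, 'c) ring_scheme" (structure) and X :: "'b set"
  assumes "cring K"
  shows "module K (free_module K X)"
proof -
  interpret cring K by fact
  have add: "{x. f x \<oplus> g x \<noteq> \<zero>} \<subseteq> {x. f x \<noteq> \<zero>} \<union> {x. g x \<noteq> \<zero>}" for f g :: "'b \<Rightarrow> 'k"
    by auto
  have mult: "{x. k \<otimes> f x \<noteq> \<zero>} \<subseteq> {x. f x \<noteq> \<zero>}" if "k \<in> carrier K" for k and f :: "'b \<Rightarrow> 'k"
    using that by auto
  have addc: "(\<lambda>x. f x \<oplus> g x) \<in> carrier (free_module K X)"
    if "f \<in> carrier (free_module K X)" "g \<in> carrier (free_module K X)" for f g
    using that add[of f g] finite_subset[OF add[of f g]] by (auto simp: free_module_def)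
  have multc: "(\<lambda>x. k \<otimes> f x) \<in> carrier (free_module K X)"
    if "f \<in> carrier (free_module K X)" "k \<in> carrier K" for f k
    using that mult[of k f] finite_subset[OF mult[of k f]] by (auto simp: free_module_def)
  have val: "f x \<in> carrier K" if "f \<in> carrier (free_module K X)" for f x
    using that by (auto simp: free_module_def)
  have ops: "f \<oplus>\<^bsub>free_module K X\<^esub> g = (\<lambda>x. f x \<oplus> g x)"
    "k \<odot>\<^bsub>free_module K X\<^esub> f = (\<lambda>x. k \<otimes> f x)" "\<zero>\<^bsub>free_module K X\<^esub> = (\<lambda>_. \<zero>)" for f g k
    by (simp_all add: free_module_def)
  show ?thesis
  proof (rule moduleI[OF assms])
    show "abelian_group (free_module K X)"
    proof (rule abelian_groupI; unfold ops)
      show "(\<lambda>_. \<zero>) \<in> carrier (free_module K X)" by (auto simp: free_module_def)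
      fix f assume f: "f \<in> carrier (free_module K X)"
      \<comment> \<open>Writing the negative as a multiple by -1 gets finite support from the
        closure under scalars.\<close>
      have "(\<lambda>x. \<ominus> \<one> \<otimes> f x) \<in> carrier (free_module K X)" using f by (intro multc) simp_all
      moreover have "(\<lambda>x. (\<ominus> \<one> \<otimes> f x) \<oplus> f x) = (\<lambda>_. \<zero>)"
        using val[OF f] by (simp add: l_minus l_neg)
      ultimately show "\<exists>g\<in>carrier (free_module K X). (\<lambda>x. g x \<oplus> f x) = (\<lambda>_. \<zero>)"
        by (intro bexI[of _ "\<lambda>x. \<ominus> \<one> \<otimes> f x"])
    qed (simp_all add: addc val a_ac)
  qed (simp_all add: ops addc multc val l_distr r_distr m_assoc)
qed

text \<open>A finitely supported function is encoded by its graph over the support, a finite subset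
  of X times K, and an infinite type has as many finite subsets as elements.\<close>

lemma free_module_small:
  fixes K :: "('k, 'c) ring_scheme" (structure) and X :: "'b set"
  assumes "infinite (UNIV :: 'u set)" "carrier K \<lesssim> (UNIV :: 'u set)" "X \<lesssim> (UNIV :: 'u set)"
  shows "carrier (free_module K X) \<lesssim> (UNIV :: 'u set)"
proof -
  have times: "(UNIV :: 'u set) \<times> (UNIV :: 'u set) \<lesssim> (UNIV :: 'u set)"
    using card_of_Times_same_infinite[OF assms(1)]
    by (intro eqpoll_imp_lepoll) (simp only: eqpoll_iff_card_of_ordIso)
  obtain e :: "'b \<times> 'k \<Rightarrow> 'u" where e: "inj_on e (X \<times> carrier K)"
    using lepoll_trans[OF times_lepoll_mono[OF assms(3,2)] times] unfolding lepoll_def by blast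
  have 1: "carrier (free_module K X) \<lesssim> {f. f ` X \<subseteq> carrier K \<and> {x. f x \<noteq> \<zero>} \<subseteq> X \<and> finite {x. f x \<noteq> \<zero>}}"
    by (rule subset_imp_lepoll) (auto simp: free_module_def)
  have 2: "\<dots> \<lesssim> Fpow (X \<times> carrier K)"
    by (rule lepoll_restricted_funspace)
  have 3: "Fpow (X \<times> carrier K) \<lesssim> Fpow (UNIV :: 'u set)"
    unfolding lepoll_def
    by (rule exI[of _ "image e"]) (use inj_on_image_Fpow[OF e] in \<open>auto simp: Fpow_def\<close>)
  have 4: "Fpow (UNIV :: 'u set) \<lesssim> (UNIV :: 'u set)"
    by (rule eqpoll_imp_lepoll[OF eqpoll_Fpow[OF assms(1)]])
  show ?thesis by (rule lepoll_trans[OF 1 lepoll_trans[OF 2 lepoll_trans[OF 3 4]]])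
qed

text \<open>The coordinates \<open>\<phi> a\<close> are indexed by the elements of the module itself: the identity of \<open>P\<close>
  is lifted along the canonical map from the free module on the set \<open>carrier P\<close>.\<close>

lemma projective_dual_basis:
  fixes K :: "'k ring" (structure) and P :: "('k, 'a) module"
  assumes proj: "projective_module TYPE('u) K P"
    and inf: "infinite (UNIV :: 'u set)" and KU: "carrier K \<lesssim> (UNIV :: 'u set)"
    and PU: "carrier P \<lesssim> (UNIV :: 'u set)"
  obtains \<phi> :: "'a \<Rightarrow> 'a \<Rightarrow> 'k" where
    "\<And>a x. x \<in> carrier P \<Longrightarrow> \<phi> a x \<in> carrier K"
    "\<And>a x y. \<lbrakk>x \<in> carrier P; y \<in> carrier P\<rbrakk> \<Longrightarrow> \<phi> a (x \<oplus>\<^bsub>P\<^esub> y) = \<phi> a x \<oplus> \<phi> a y"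
    "\<And>a k x. \<lbrakk>k \<in> carrier K; x \<in> carrier P\<rbrakk> \<Longrightarrow> \<phi> a (k \<odot>\<^bsub>P\<^esub> x) = k \<otimes> \<phi> a x"
    "\<And>x. x \<in> carrier P \<Longrightarrow> finite {a. \<phi> a x \<noteq> \<zero>}"
    "\<And>x. x \<in> carrier P \<Longrightarrow> {a. \<phi> a x \<noteq> \<zero>} \<subseteq> carrier P"
    "\<And>x. x \<in> carrier P \<Longrightarrow> x = (\<Oplus>\<^bsub>P\<^esub>a\<in>{a. \<phi> a x \<noteq> \<zero>}. \<phi> a x \<odot>\<^bsub>P\<^esub> a)"
proof -
  interpret module K P using proj by (simp add: projective_module_def)
  let ?F = "free_module K (carrier P)"
  have F: "module K ?F" by (rule module_free_module[OF R.cring_axioms])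
  obtain i :: "'a \<Rightarrow> 'u" where i: "inj_on i (carrier P)" using PU by (auto simp: lepoll_def)
  obtain e :: "('a \<Rightarrow> 'k) \<Rightarrow> 'u" where e: "inj_on e (carrier ?F)"
    using free_module_small[OF inf KU PU] by (auto simp: lepoll_def)
  define d where "d = inv_into (carrier ?F) e"
  have d: "d (e f) = f" if "f \<in> carrier ?F" for f using that e by (simp add: d_def)
  have supp: "finite {x. f x \<noteq> \<zero>}" "{x. f x \<noteq> \<zero>} \<subseteq> carrier P" "f x \<in> carrier K"
    if "f \<in> carrier ?F" for f x using that by (auto simp: free_module_def)
  have ops: "f \<oplus>\<^bsub>?F\<^esub> g = (\<lambda>x. f x \<oplus> g x)" "k \<odot>\<^bsub>?F\<^esub> f = (\<lambda>x. k \<otimes> f x)" for f g k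
    by (simp_all add: free_module_def)
  define \<pi> where "\<pi> f = (\<Oplus>\<^bsub>P\<^esub>a\<in>{a. f a \<noteq> \<zero>}. f a \<odot>\<^bsub>P\<^esub> a)" for f
  have \<pi>: "\<pi> f = (\<Oplus>\<^bsub>P\<^esub>a\<in>S. f a \<odot>\<^bsub>P\<^esub> a)"
    if "f \<in> carrier ?F" "finite S" "{a. f a \<noteq> \<zero>} \<subseteq> S" "S \<subseteq> carrier P" for f S
    unfolding \<pi>_def using that supp[OF that(1)]
    by (intro M.add.finprod_mono_neutral_cong_left) auto
  have \<pi>_closed: "\<pi> f \<in> carrier P" if "f \<in> carrier ?F" for f
    unfolding \<pi>_def using supp[OF that] by (intro M.finsum_closed) auto
  interpret F: module K ?F by (rule F)
  have \<pi>_add: "\<pi> (f \<oplus>\<^bsub>?F\<^esub> g) = \<pi> f \<oplus>\<^bsub>P\<^esub> \<pi> g" if fg: "f \<in> carrier ?F" "g \<in> carrier ?F" for f g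
  proof -
    let ?S = "{a. f a \<noteq> \<zero>} \<union> {a. g a \<noteq> \<zero>}"
    have S: "finite ?S" "?S \<subseteq> carrier P" using supp[OF fg(1)] supp[OF fg(2)] by auto
    have "\<pi> (f \<oplus>\<^bsub>?F\<^esub> g) = (\<Oplus>\<^bsub>P\<^esub>a\<in>?S. (f a \<oplus> g a) \<odot>\<^bsub>P\<^esub> a)"
    proof -
      have "{a. (f \<oplus>\<^bsub>?F\<^esub> g) a \<noteq> \<zero>} \<subseteq> ?S" by (auto simp: ops)
      from \<pi>[OF F.M.a_closed[OF fg] S(1) this S(2)] show ?thesis by (simp only: ops)
    qed
    also have "\<dots> = (\<Oplus>\<^bsub>P\<^esub>a\<in>?S. f a \<odot>\<^bsub>P\<^esub> a \<oplus>\<^bsub>P\<^esub> g a \<odot>\<^bsub>P\<^esub> a)"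
      using S supp[OF fg(1)] supp[OF fg(2)] by (intro M.finsum_cong') (auto simp: smult_l_distr)
    also have "\<dots> = (\<Oplus>\<^bsub>P\<^esub>a\<in>?S. f a \<odot>\<^bsub>P\<^esub> a) \<oplus>\<^bsub>P\<^esub> (\<Oplus>\<^bsub>P\<^esub>a\<in>?S. g a \<odot>\<^bsub>P\<^esub> a)"
      using S supp[OF fg(1)] supp[OF fg(2)] by (intro M.finsum_addf) auto
    also have "\<dots> = \<pi> f \<oplus>\<^bsub>P\<^esub> \<pi> g" using fg S by (simp add: \<pi>[of _ ?S])
    finally show ?thesis .
  qed
  have \<pi>_smult: "\<pi> (k \<odot>\<^bsub>?F\<^esub> f) = k \<odot>\<^bsub>P\<^esub> \<pi> f" if f: "f \<in> carrier ?F" and k: "k \<in> carrier K" for f k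
  proof -
    let ?S = "{a. f a \<noteq> \<zero>}"
    have "\<pi> (k \<odot>\<^bsub>?F\<^esub> f) = (\<Oplus>\<^bsub>P\<^esub>a\<in>?S. (k \<otimes> f a) \<odot>\<^bsub>P\<^esub> a)"
    proof -
      have "{a. (k \<odot>\<^bsub>?F\<^esub> f) a \<noteq> \<zero>} \<subseteq> ?S" using k by (auto simp: ops)
      from \<pi>[OF F.smult_closed[OF k f] supp(1)[OF f] this supp(2)[OF f]] show ?thesis by (simp only: ops)
    qed
    also have "\<dots> = (\<Oplus>\<^bsub>P\<^esub>a\<in>?S. k \<odot>\<^bsub>P\<^esub> (f a \<odot>\<^bsub>P\<^esub> a))"
      using k supp[OF f] by (intro M.finsum_cong') (auto simp: smult_assoc1)
    also have "\<dots> = k \<odot>\<^bsub>P\<^esub> \<pi> f"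
      unfolding \<pi>_def using k supp[OF f] by (intro finsum_smult_ldistr[symmetric]) auto
    finally show ?thesis .
  qed
  have \<pi>_surj: "\<exists>f\<in>carrier ?F. \<pi> f = x" if x: "x \<in> carrier P" for x
  proof (cases "\<one> = \<zero>")
    \<comment> \<open>Over the zero ring the indicator function of x has empty support, so this case
      is settled by P being zero.\<close>
    case True
    then have "x = \<zero>\<^bsub>P\<^esub>" using x smult_one[OF x] by simp
    then show ?thesis by (intro bexI[of _ "\<lambda>_. \<zero>"]) (auto simp: \<pi>_def free_module_def)
  next
    case False
    let ?f = "\<lambda>a. if a = x then \<one> else \<zero>"
    have "{a. ?f a \<noteq> \<zero>} = {x}" using False by auto
    then show ?thesis using x
      by (intro bexI[of _ ?f]) (auto simp: \<pi>_def free_module_def)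
  qed
  note copyF = module_copy_simps[OF e] and copyP = module_copy_simps[OF i]
  \<comment> \<open>The lifting property is only available between modules inside \<open>'u\<close>,
    so the canonical surjection is conjugated by the codings \<open>e\<close> and
    \<open>i\<close>.\<close>
  have g: "(\<lambda>u. i (\<pi> (d u))) \<in> module_maps K (module_copy e ?F) (module_copy i P)"
    by (auto simp: module_maps_def copyF copyP d \<pi>_closed \<pi>_add \<pi>_smult)
  have gs: "(\<lambda>u. i (\<pi> (d u))) ` carrier (module_copy e ?F) = carrier (module_copy i P)"
  proof (intro equalityI subsetI)
    show "y \<in> carrier (module_copy i P)" if "y \<in> (\<lambda>u. i (\<pi> (d u))) ` carrier (module_copy e ?F)" for y
      using that by (auto simp: copyF copyP d \<pi>_closed)
    fix y assume "y \<in> carrier (module_copy i P)"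
    then obtain x where "x \<in> carrier P" "y = i x" by (auto simp: copyP)
    then obtain f where "f \<in> carrier ?F" "y = i (\<pi> f)" using \<pi>_surj by auto
    then show "y \<in> (\<lambda>u. i (\<pi> (d u))) ` carrier (module_copy e ?F)"
      by (intro image_eqI[of _ _ "e f"]) (auto simp: copyF d)
  qed
  \<comment> \<open>The map to be lifted is the identity of P, seen as the coding into its copy; a
    lift is a section of the surjection.\<close>
  have "i \<in> module_maps K P (module_copy i P)"
    by (auto simp: module_maps_def copyP)
  then obtain h where h: "h \<in> module_maps K P (module_copy e ?F)"
    and lift: "\<And>x. x \<in> carrier P \<Longrightarrow> i (\<pi> (d (h x))) = i x"
    using proj[unfolded projective_module_def] module_module_copy[OF F e]
      module_module_copy[OF module_axioms i] g gs by meson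
  have hF: "\<exists>f\<in>carrier ?F. h x = e f" if "x \<in> carrier P" for x
    using h that by (auto simp: module_maps_def copyF)
  have dF: "d (h x) \<in> carrier ?F" if "x \<in> carrier P" for x
    using hF[OF that] by (auto simp: d)
  have ed: "e (d (h x)) = h x" if "x \<in> carrier P" for x
    using hF[OF that] by (auto simp: d)
  have sum: "\<pi> (d (h x)) = x" if "x \<in> carrier P" for x
    using inj_onD[OF i lift[OF that]] \<pi>_closed[OF dF[OF that]] that by simp
  have dadd: "d (h (x \<oplus>\<^bsub>P\<^esub> y)) = d (h x) \<oplus>\<^bsub>?F\<^esub> d (h y)" if "x \<in> carrier P" "y \<in> carrier P" for x y
  proof -
    have "h (x \<oplus>\<^bsub>P\<^esub> y) = e (d (h x)) \<oplus>\<^bsub>module_copy e ?F\<^esub> e (d (h y))"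
      using h that by (simp add: module_maps_def ed)
    then show ?thesis using dF that by (simp add: copyF d)
  qed
  have dsmult: "d (h (k \<odot>\<^bsub>P\<^esub> x)) = k \<odot>\<^bsub>?F\<^esub> d (h x)" if "k \<in> carrier K" "x \<in> carrier P" for k x
  proof -
    have "h (k \<odot>\<^bsub>P\<^esub> x) = k \<odot>\<^bsub>module_copy e ?F\<^esub> e (d (h x))"
      using h that by (simp add: module_maps_def ed)
    then show ?thesis using dF that by (simp add: copyF d)
  qed
  show thesis
  \<comment> \<open>The coordinate with index a is the a-th entry of the section at x.\<close>
  proof (rule that[of "\<lambda>a x. d (h x) a"])
    fix x assume x: "x \<in> carrier P"
    show "x = (\<Oplus>\<^bsub>P\<^esub>a\<in>{a. d (h x) a \<noteq> \<zero>}. d (h x) a \<odot>\<^bsub>P\<^esub> a)"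
      using sum[OF x] by (simp add: \<pi>_def)
  qed (use supp[OF dF] in \<open>simp_all add: dadd dsmult ops\<close>)
qed

text \<open>The ideal generated by the values \<open>\<phi> \<one>\<close> is idempotent, because \<open>\<one>\<close> is a combination of
  elements of \<open>A\<close> with these coefficients and \<open>x = x \<otimes> \<one>\<close> for all \<open>x\<close>.\<close>

lemma relative_center_outer_scalar:
  fixes K :: "'k ring" (structure) and A :: "('k, 'a) module"
  assumes alg: "assoc_algebra K A"
    and proj: "projective_module TYPE('u) K A"
    and inf: "infinite (UNIV :: 'u set)" and KU: "carrier K \<lesssim> (UNIV :: 'u set)"
    and AU: "carrier A \<lesssim> (UNIV :: 'u set)"
    and z: "z \<in> relative_center A (outer_bimod K A)"
  obtains k where "k \<in> carrier K" "z = k \<odot>\<^bsub>A\<^esub> \<one>\<^bsub>A\<^esub>"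
proof -
  interpret assoc_algebra K A by (rule alg)
  have zA: "z \<in> carrier A" using z by (auto simp: relative_center_def center_def)
  obtain \<phi> :: "'a \<Rightarrow> 'a \<Rightarrow> 'k" where
    c: "\<And>a x. x \<in> carrier A \<Longrightarrow> \<phi> a x \<in> carrier K" and
    add: "\<And>a x y. \<lbrakk>x \<in> carrier A; y \<in> carrier A\<rbrakk> \<Longrightarrow> \<phi> a (x \<oplus>\<^bsub>A\<^esub> y) = \<phi> a x \<oplus> \<phi> a y" and
    smult: "\<And>a k x. \<lbrakk>k \<in> carrier K; x \<in> carrier A\<rbrakk> \<Longrightarrow> \<phi> a (k \<odot>\<^bsub>A\<^esub> x) = k \<otimes> \<phi> a x" and
    fin: "\<And>x. x \<in> carrier A \<Longrightarrow> finite {a. \<phi> a x \<noteq> \<zero>}" and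
    sub: "\<And>x. x \<in> carrier A \<Longrightarrow> {a. \<phi> a x \<noteq> \<zero>} \<subseteq> carrier A" and
    sum: "\<And>x. x \<in> carrier A \<Longrightarrow> x = (\<Oplus>\<^bsub>A\<^esub>a\<in>{a. \<phi> a x \<noteq> \<zero>}. \<phi> a x \<odot>\<^bsub>A\<^esub> a)"
    by (rule projective_dual_basis[OF proj inf KU AU]) blast
  define S where "S = {a. \<phi> a \<one>\<^bsub>A\<^esub> \<noteq> \<zero>}"
  define v where "v a = \<phi> a \<one>\<^bsub>A\<^esub>" for a
  have S: "finite S" "S \<subseteq> carrier A" using fin sub by (auto simp: S_def)
  have v: "v a \<in> carrier K" for a by (simp add: v_def c)
  have one: "\<one>\<^bsub>A\<^esub> = (\<Oplus>\<^bsub>A\<^esub>a\<in>S. v a \<odot>\<^bsub>A\<^esub> a)"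
    using sum[of "\<one>\<^bsub>A\<^esub>"] by (simp add: S_def v_def)
  have vz: "\<phi> a z \<odot>\<^bsub>A\<^esub> \<one>\<^bsub>A\<^esub> = v a \<odot>\<^bsub>A\<^esub> z" for a
    unfolding v_def by (rule outer_commute_scalars[OF alg z]) (simp_all add: c add smult)
  have \<phi>0: "\<phi> a \<zero>\<^bsub>A\<^esub> = \<zero>" for a
    using smult[of "\<zero>" "\<zero>\<^bsub>A\<^esub>" a] c by simp
  have \<phi>sum: "\<phi> a (\<Oplus>\<^bsub>A\<^esub>s\<in>U. f s) = (\<Oplus>s\<in>U. \<phi> a (f s))"
    if "finite U" "f ` U \<subseteq> carrier A" for a U and f :: "'a \<Rightarrow> 'a"
    using that by (induction U rule: finite_induct)
      (simp_all add: \<phi>0 add c M.finsum_insert R.finsum_insert Pi_def image_subset_iff)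
  \<comment> \<open>Expand the right factor 1 of x \<otimes> 1 as the sum of the v s multiplied by
    s, and apply the form with index a.\<close>
  have linear: "\<phi> a (x \<otimes>\<^bsub>A\<^esub> \<one>\<^bsub>A\<^esub>) = (\<Oplus>s\<in>S. \<phi> a (x \<otimes>\<^bsub>A\<^esub> s) \<otimes> v s)" if x: "x \<in> carrier A" for a x
  proof -
    have "x \<otimes>\<^bsub>A\<^esub> \<one>\<^bsub>A\<^esub> = (\<Oplus>\<^bsub>A\<^esub>s\<in>S. x \<otimes>\<^bsub>A\<^esub> (v s \<odot>\<^bsub>A\<^esub> s))"
      unfolding one using S v x by (intro A.finsum_rdistr) auto
    also have "\<phi> a \<dots> = (\<Oplus>s\<in>S. \<phi> a (x \<otimes>\<^bsub>A\<^esub> (v s \<odot>\<^bsub>A\<^esub> s)))"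
      using S v x by (intro \<phi>sum) auto
    also have "\<dots> = (\<Oplus>s\<in>S. \<phi> a (x \<otimes>\<^bsub>A\<^esub> s) \<otimes> v s)"
      using S v x by (intro R.finsum_cong') (auto simp: smult_mult_right smult c R.m_comm)
    finally show ?thesis .
  qed
  \<comment> \<open>This ideal contains the one generated by the values v a, by \<open>vz\<close>.
    It is taken larger so that membership in it already has the desired form: the element returned
    by Nakayama's lemma turns z into a multiple of the unit.\<close>
  define J where "J = {c \<in> carrier K. \<exists>k\<in>carrier K. c \<odot>\<^bsub>A\<^esub> z = k \<odot>\<^bsub>A\<^esub> \<one>\<^bsub>A\<^esub>}"
  have J: "ideal J K"
  proof (rule idealI)
    show "subgroup J (add_monoid K)"
    proof (rule R.add.subgroupI)
      show "J \<subseteq> carrier K" by (auto simp: J_def)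
      have "\<zero> \<in> J" unfolding J_def using zA by (auto intro!: bexI[of _ "\<zero>"])
      then show "J \<noteq> {}" by blast
      show "\<ominus> a \<in> J" if "a \<in> J" for a
      proof -
        obtain k where "a \<in> carrier K" "k \<in> carrier K" "a \<odot>\<^bsub>A\<^esub> z = k \<odot>\<^bsub>A\<^esub> \<one>\<^bsub>A\<^esub>"
          using \<open>a \<in> J\<close> by (auto simp: J_def)
        then show ?thesis using zA by (auto simp: J_def smult_l_minus intro!: bexI[of _ "\<ominus> k"])
      qed
      show "a \<oplus> b \<in> J" if "a \<in> J" "b \<in> J" for a b
      proof -
        obtain k l where "a \<in> carrier K" "k \<in> carrier K" "a \<odot>\<^bsub>A\<^esub> z = k \<odot>\<^bsub>A\<^esub> \<one>\<^bsub>A\<^esub>"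
          "b \<in> carrier K" "l \<in> carrier K" "b \<odot>\<^bsub>A\<^esub> z = l \<odot>\<^bsub>A\<^esub> \<one>\<^bsub>A\<^esub>"
          using \<open>a \<in> J\<close> \<open>b \<in> J\<close> by (auto simp: J_def)
        then show ?thesis using zA by (auto simp: J_def smult_l_distr intro!: bexI[of _ "k \<oplus> l"])
      qed
    qed
    show "x \<otimes> a \<in> J" if "a \<in> J" "x \<in> carrier K" for a x
    proof -
      obtain k where "a \<in> carrier K" "k \<in> carrier K" "a \<odot>\<^bsub>A\<^esub> z = k \<odot>\<^bsub>A\<^esub> \<one>\<^bsub>A\<^esub>"
        using \<open>a \<in> J\<close> by (auto simp: J_def)
      then show ?thesis using zA \<open>x \<in> carrier K\<close>
        by (auto simp: J_def smult_assoc1 intro!: bexI[of _ "x \<otimes> k"])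
    qed
    then show "a \<otimes> x \<in> J" if "a \<in> J" "x \<in> carrier K" for a x
      using that R.m_comm[of a x] by (auto simp: J_def)
  qed (rule R.ring_axioms)
  have vJ: "v a \<in> J" for a
    using vz[of a] c[OF zA] v by (auto simp: J_def intro!: bexI[of _ "\<phi> a z"])
  interpret J: ideal J K by (rule J)
  \<comment> \<open>By \<open>linear\<close> every coordinate of every x is a combination of the
    values v s, all of which lie in J.\<close>
  have \<phi>J: "\<phi> a x \<in> J" if "x \<in> carrier A" for a x
  proof -
    have "(\<Oplus>s\<in>U. \<phi> a (x \<otimes>\<^bsub>A\<^esub> s) \<otimes> v s) \<in> J" if "finite U" "U \<subseteq> carrier A" for U
      using that
    proof (induction U rule: finite_induct)
      case (insert s U)
      then show ?case using \<open>x \<in> carrier A\<close>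
        by (simp add: R.finsum_insert Pi_def c v subset_iff J.I_l_closed vJ)
    qed simp
    from this[OF S] linear[OF that] that show ?thesis by simp
  qed
  obtain ss where ss: "set ss = S" "distinct ss" using finite_distinct_list[OF S(1)] by blast
  \<comment> \<open>The hypothesis of Nakayama's lemma: \<open>linear\<close> at x = 1 writes v a
    with the coefficients phi_a(s), which lie in J by the preceding step.\<close>
  have gen: "u \<in> span_list K J (map v ss)" if u: "u \<in> set (map v ss)" for u
  proof -
    obtain a where a: "u = v a" using u by auto
    have "v a = (\<Oplus>s\<in>set ss. \<phi> a s \<otimes> v s)"
    proof -
      have "v a = (\<Oplus>s\<in>S. \<phi> a (\<one>\<^bsub>A\<^esub> \<otimes>\<^bsub>A\<^esub> s) \<otimes> v s)"
        using linear[of "\<one>\<^bsub>A\<^esub>" a] by (simp add: v_def)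
      also have "\<dots> = (\<Oplus>s\<in>S. \<phi> a s \<otimes> v s)"
        using S v by (intro R.finsum_cong') (auto simp: c subset_iff)
      finally show ?thesis by (simp add: ss)
    qed
    then show ?thesis
      unfolding a using R.span_list_finsum[OF J ss(2), of v "\<phi> a"] v \<phi>J S ss(1) by auto
  qed
  have vs: "set (map v ss) \<subseteq> carrier K" using v by auto
  obtain d where d: "d \<in> carrier K" "\<one> \<ominus> d \<in> J"
      "\<And>u. u \<in> set (map v ss) \<Longrightarrow> d \<otimes> u = \<zero>"
    by (rule R.nakayama_list[OF J vs]) (blast intro: gen)+
  \<comment> \<open>Since d kills all coordinates of the unit of A, it kills the unit and hence A;
    therefore 1 - d acts on A as the identity.\<close>
  have "d \<odot>\<^bsub>A\<^esub> \<one>\<^bsub>A\<^esub> = (\<Oplus>\<^bsub>A\<^esub>s\<in>S. d \<odot>\<^bsub>A\<^esub> (v s \<odot>\<^bsub>A\<^esub> s))"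
    unfolding one using S v d(1) by (intro finsum_smult_ldistr) auto
  also have "\<dots> = (\<Oplus>\<^bsub>A\<^esub>s\<in>S. \<zero>\<^bsub>A\<^esub>)"
    using S v d ss(1) by (intro M.finsum_cong') (auto simp: subset_iff simp flip: smult_assoc1)
  finally have d1: "d \<odot>\<^bsub>A\<^esub> \<one>\<^bsub>A\<^esub> = \<zero>\<^bsub>A\<^esub>" by simp
  have "d \<odot>\<^bsub>A\<^esub> z = (d \<odot>\<^bsub>A\<^esub> \<one>\<^bsub>A\<^esub>) \<otimes>\<^bsub>A\<^esub> z" using zA d(1) by (simp add: smult_mult_left)
  then have "d \<odot>\<^bsub>A\<^esub> z = \<zero>\<^bsub>A\<^esub>" using zA d1 by simp
  then have dz: "(\<one> \<ominus> d) \<odot>\<^bsub>A\<^esub> z = z"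
    using zA d(1) by (simp add: R.minus_eq smult_l_distr smult_l_minus)
  obtain k where "k \<in> carrier K" "(\<one> \<ominus> d) \<odot>\<^bsub>A\<^esub> z = k \<odot>\<^bsub>A\<^esub> \<one>\<^bsub>A\<^esub>"
    using d(2) unfolding J_def by blast
  then show thesis using that dz by simp
qed

section \<open>Insertion operators on Hochschild cochains\<close>

lemma add_hom_finsum:
  assumes G: "abelian_group G" and H: "abelian_group H" and f: "f \<in> add_hom G H"
    and "finite S" "g ` S \<subseteq> carrier G"
  shows "f (\<Oplus>\<^bsub>G\<^esub>s\<in>S. g s) = (\<Oplus>\<^bsub>H\<^esub>s\<in>S. f (g s))"
proof -
  interpret G: abelian_group G by fact
  interpret H: abelian_group H by fact
  show ?thesis
    using assms(4,5)
    by (induction S rule: finite_induct)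
      (simp_all add: add_hom_zero[OF G H f] add_hom_closed[OF f] add_hom_add[OF f]
        G.finsum_insert H.finsum_insert Pi_def image_subset_iff)
qed

definition insert_at :: "nat \<Rightarrow> 'a list \<Rightarrow> 'a list \<Rightarrow> 'a list" where
  "insert_at j us v = take j v @ us @ drop j v"

lemma length_insert_at [simp]: "length (insert_at j us v) = length v + length us"
  by (simp add: insert_at_def)

lemma set_insert_at [simp]: "set (insert_at j us v) = set us \<union> set v"
proof -
  have "set v = set (take j v) \<union> set (drop j v)" by (metis append_take_drop_id set_append)
  then show ?thesis by (auto simp: insert_at_def)
qed

text \<open>The sign (-1)^i as a parity test, so that signs compose by adding exponents.\<close>

definition sg :: "('a, 'm) ring_scheme \<Rightarrow> nat \<Rightarrow> 'a \<Rightarrow> 'a" where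
  "sg G i x = (if even i then x else \<ominus>\<^bsub>G\<^esub> x)"

section \<open>Signs and rearrangement of finite sums\<close>

context abelian_group
begin

lemmas endo_zero = add_hom_zero[OF abelian_group_axioms abelian_group_axioms]
lemmas endo_minus = add_hom_minus[OF abelian_group_axioms abelian_group_axioms]
lemmas endo_finsum = add_hom_finsum[OF abelian_group_axioms abelian_group_axioms]

lemma sg_closed [simp]: "x \<in> carrier G \<Longrightarrow> sg G i x \<in> carrier G"
  by (simp add: sg_def)

lemma add_pow_minus_one: "x \<in> carrier G \<Longrightarrow> add_pow G ((-1) ^ i :: int) x = sg G i x"
  using add.int_pow_neg[of x 1] by (cases "even i") (simp_all add: sg_def add.int_pow_1)

lemma sg_zero [simp]: "sg G i \<zero> = \<zero>"
  by (simp add: sg_def)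

lemma sg_add: "\<lbrakk>x \<in> carrier G; y \<in> carrier G\<rbrakk> \<Longrightarrow> sg G i (x \<oplus> y) = sg G i x \<oplus> sg G i y"
  by (simp add: sg_def minus_add)

lemma sg_sg: "x \<in> carrier G \<Longrightarrow> sg G i (sg G j x) = sg G (i + j) x"
  by (simp add: sg_def)

lemma sg_even: "even i \<Longrightarrow> sg G i x = x"
  by (simp add: sg_def)

lemma sg_hom: "sg G i \<in> add_hom G G"
  by (simp add: add_hom_def sg_add)

lemma sg_finsum:
  "\<lbrakk>finite S; g ` S \<subseteq> carrier G\<rbrakk> \<Longrightarrow> sg G i (\<Oplus>s\<in>S. g s) = (\<Oplus>s\<in>S. sg G i (g s))"
  by (rule endo_finsum[OF sg_hom])

lemma sg_hom_commute:
  "\<lbrakk>f \<in> add_hom G G; x \<in> carrier G\<rbrakk> \<Longrightarrow> f (sg G i x) = sg G i (f x)"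
  by (simp add: sg_def endo_minus)

lemma finsum_swap:
  assumes "finite S" "finite U" "\<And>s u. \<lbrakk>s \<in> S; u \<in> U\<rbrakk> \<Longrightarrow> g s u \<in> carrier G"
  shows "(\<Oplus>s\<in>S. \<Oplus>u\<in>U. g s u) = (\<Oplus>u\<in>U. \<Oplus>s\<in>S. g s u)"
  using assms(1,3)
proof (induction S rule: finite_induct)
  case empty
  then show ?case by simp
next
  case (insert s S)
  have "(\<Oplus>u\<in>U. \<Oplus>s\<in>insert s S. g s u) = (\<Oplus>u\<in>U. g s u \<oplus> (\<Oplus>s\<in>S. g s u))"
    using insert by (intro finsum_cong') (auto intro!: finsum_insert finsum_closed)
  also have "\<dots> = (\<Oplus>u\<in>U. g s u) \<oplus> (\<Oplus>u\<in>U. \<Oplus>s\<in>S. g s u)"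
    using insert by (intro finsum_addf) (auto intro!: finsum_closed)
  also have "\<dots> = (\<Oplus>s\<in>insert s S. \<Oplus>u\<in>U. g s u)"
    using insert by (subst finsum_insert) (auto intro!: finsum_closed)
  finally show ?case by simp
qed

lemma finsum_split_low_high:
  fixes m :: nat
  assumes "\<And>i. i \<le> m \<Longrightarrow> g i \<in> carrier G" "j \<le> m"
  shows "(\<Oplus>i\<in>{..m}. g i) = (\<Oplus>i\<in>{..<Suc j}. g i) \<oplus> (\<Oplus>i\<in>{j<..m}. g i)"
proof -
  have eq: "{..m} = {..<Suc j} \<union> {j<..m}" using assms(2) by auto
  show ?thesis unfolding eq using assms by (intro finsum_Un_disjoint) auto
qed

text \<open>Fits a list with a block of length c inserted at position j: the faces before, at and
  after the block, the last ones reindexed by the faces of the original list.\<close>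

lemma finsum_split_middle:
  fixes m c :: nat
  assumes "\<And>i. i \<le> m + c \<Longrightarrow> g i \<in> carrier G" "j \<le> m"
  shows "(\<Oplus>i\<in>{..m + c}. g i) =
    (\<Oplus>i\<in>{..<j}. g i) \<oplus> (\<Oplus>i\<in>{j..j + c}. g i) \<oplus> (\<Oplus>i\<in>{j<..m}. g (i + c))"
proof -
  have "(\<Oplus>i\<in>(\<lambda>i. i + c) ` {j<..m}. g i) = (\<Oplus>i\<in>{j<..m}. g (i + c))"
    by (intro finsum_reindex) (auto simp: assms(1))
  moreover have "(\<lambda>i. i + c) ` {j<..m} = {j + c<..m + c}"
  proof (intro equalityI subsetI)
    fix x assume "x \<in> {j + c<..m + c}"
    then show "x \<in> (\<lambda>i. i + c) ` {j<..m}" by (intro image_eqI[of _ _ "x - c"]) auto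
  qed auto
  moreover have "(\<Oplus>i\<in>{..m + c}. g i) = (\<Oplus>i\<in>{..<j} \<union> {j..j + c}. g i) \<oplus> (\<Oplus>i\<in>{j + c<..m + c}. g i)"
  proof -
    have eq: "{..m + c} = ({..<j} \<union> {j..j + c}) \<union> {j + c<..m + c}" using assms(2) by auto
    show ?thesis unfolding eq using assms by (intro finsum_Un_disjoint) auto
  qed
  moreover have "(\<Oplus>i\<in>{..<j} \<union> {j..j + c}. g i) = (\<Oplus>i\<in>{..<j}. g i) \<oplus> (\<Oplus>i\<in>{j..j + c}. g i)"
    using assms by (intro finsum_Un_disjoint) auto
  ultimately show ?thesis by simp
qed

text \<open>After the shift of j by one, the pairs with i < j become those with i at most j.
  Together with the pairs with i > j they fill the rectangle of m + 1 by m.\<close>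

lemma finsum_low_high:
  fixes m :: nat
  assumes "\<And>i j. \<lbrakk>i \<le> m; j < m\<rbrakk> \<Longrightarrow> g i j \<in> carrier G"
  shows "(\<Oplus>j\<in>{..m}. \<Oplus>i\<in>{..<j}. g i (j - 1)) \<oplus> (\<Oplus>j\<in>{..m}. \<Oplus>i\<in>{j<..m}. g i j) =
    (\<Oplus>j\<in>{..<m}. \<Oplus>i\<in>{..m}. g i j)"
proof (cases m)
  case 0
  then show ?thesis by simp
next
  case (Suc k)
  have "(\<Oplus>j\<in>{..m}. \<Oplus>i\<in>{..<j}. g i (j - 1)) = (\<Oplus>j\<in>{..k}. \<Oplus>i\<in>{..<Suc j}. g i j)"
    unfolding Suc using assms Suc by (subst finsum_Suc2) (auto intro!: finsum_closed)
  moreover have "(\<Oplus>j\<in>{..m}. \<Oplus>i\<in>{j<..m}. g i j) = (\<Oplus>j\<in>{..k}. \<Oplus>i\<in>{j<..m}. g i j)"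
    unfolding Suc using assms Suc by (subst finsum_Suc) (auto intro!: finsum_closed)
  moreover have "(\<Oplus>j\<in>{..k}. \<Oplus>i\<in>{..<Suc j}. g i j) \<oplus> (\<Oplus>j\<in>{..k}. \<Oplus>i\<in>{j<..m}. g i j) =
      (\<Oplus>j\<in>{..k}. (\<Oplus>i\<in>{..<Suc j}. g i j) \<oplus> (\<Oplus>i\<in>{j<..m}. g i j))"
    using assms Suc by (intro finsum_addf[symmetric]) (auto intro!: finsum_closed)
  moreover have "\<dots> = (\<Oplus>j\<in>{..k}. \<Oplus>i\<in>{..m}. g i j)"
  proof (intro finsum_cong')
    fix j assume j: "j \<in> {..k}"
    show "(\<Oplus>i\<in>{..<Suc j}. g i j) \<oplus> (\<Oplus>i\<in>{j<..m}. g i j) = (\<Oplus>i\<in>{..m}. g i j)"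
      by (rule finsum_split_low_high[symmetric]) (use assms Suc j in auto)
  qed (use assms Suc in \<open>auto intro!: finsum_closed\<close>)
  ultimately show ?thesis by (simp add: Suc lessThan_Suc_atMost)
qed

lemma finsum_telescope:
  assumes "\<And>i. i \<le> Suc m \<Longrightarrow> g i \<in> carrier G"
  shows "(\<Oplus>j\<in>{..m}. g j \<ominus> g (Suc j)) = g 0 \<ominus> g (Suc m)"
  using assms
proof (induction m)
  case 0
  then show ?case by simp
next
  case (Suc m)
  have c: "g i \<in> carrier G" if "i \<le> Suc (Suc m)" for i using Suc.prems that by simp
  have "(\<Oplus>j\<in>{..Suc m}. g j \<ominus> g (Suc j)) = (g (Suc m) \<ominus> g (Suc (Suc m))) \<oplus> (\<Oplus>j\<in>{..m}. g j \<ominus> g (Suc j))"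
    using c by (intro finsum_Suc) auto
  also have "\<dots> = (g (Suc m) \<ominus> g (Suc (Suc m))) \<oplus> (g 0 \<ominus> g (Suc m))"
    using Suc by simp
  also have "\<dots> = g 0 \<ominus> g (Suc (Suc m))"
    using c by (simp add: minus_eq a_ac r_neg1 r_neg2 r_neg)
  finally show ?case .
qed

end

section \<open>Faces of cochains and insertion of blocks\<close>

locale hochschild = Mod: bimodule A A M + assoc_algebra K A
  for M :: "('a, 'a, 'm) bimod" (structure) and K :: "'k ring" and A :: "('k, 'a) module" +
  assumes scalar_symmetric: "\<lbrakk>k \<in> carrier K; x \<in> carrier M\<rbrakk>
    \<Longrightarrow> lact M (k \<odot>\<^bsub>A\<^esub> \<one>\<^bsub>A\<^esub>) x = ract M x (k \<odot>\<^bsub>A\<^esub> \<one>\<^bsub>A\<^esub>)"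
begin

lemma lact_hom: "a \<in> carrier A \<Longrightarrow> lact M a \<in> add_hom M M"
  by (simp add: add_hom_def Mod.lact_closed Mod.lact_add_right)

lemma ract_hom: "a \<in> carrier A \<Longrightarrow> (\<lambda>x. ract M x a) \<in> add_hom M M"
  by (simp add: add_hom_def Mod.ract_closed Mod.ract_add_left)

lemmas sg_lact = Mod.sg_hom_commute[OF lact_hom]
lemmas sg_ract = Mod.sg_hom_commute[OF ract_hom]

text \<open>The coface operators of the Hochschild complex, indexed from 0 to
  \<open>length w\<close> so that the differential becomes one alternating sum.\<close>

definition face :: "('a list \<Rightarrow> 'm) \<Rightarrow> nat \<Rightarrow> 'a list \<Rightarrow> 'm" where
  "face f i w =
    (if i = 0 then lact M (hd w) (f (tl w))
     else if i < length w then f (take (i - 1) w @ (w ! (i - 1) \<otimes>\<^bsub>A\<^esub> w ! i) # drop (Suc i) w)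
     else ract M (f (butlast w)) (last w))"

text \<open>This is the differential on nonempty lists only. On the empty list, where
  \<open>coboundary\<close> is zero, its value is meaningless, hence the recurring case split on
  \<open>v = []\<close>.\<close>

definition alternating :: "('a list \<Rightarrow> 'm) \<Rightarrow> 'a list \<Rightarrow> 'm" where
  "alternating f w = (\<Oplus>i\<in>{..length w}. sg M i (face f i w))"

definition cochain_on :: "nat \<Rightarrow> ('a list \<Rightarrow> 'm) \<Rightarrow> bool" where
  "cochain_on n f \<longleftrightarrow> (\<forall>v. set v \<subseteq> carrier A \<longrightarrow> length v = n \<longrightarrow> f v \<in> carrier M)"

text \<open>Replaces index arithmetic by a decomposition of the list around the entries that the
  face touches. The formulas hold for all f, since faces of a cochain and of its modifications are
  compared on the same list.\<close>

lemma face_cases: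
  assumes "i \<le> length w" "w \<noteq> []"
  obtains (first) x xs where "i = 0" "w = x # xs" "\<And>f. face f i w = lact M x (f xs)"
  | (middle) xs a b ys where "i = Suc (length xs)" "w = xs @ a # b # ys"
      "\<And>f. face f i w = f (xs @ (a \<otimes>\<^bsub>A\<^esub> b) # ys)"
  | (last) xs x where "i = length w" "i \<noteq> 0" "w = xs @ [x]" "\<And>f. face f i w = ract M (f xs) x"
proof -
  consider "i = 0" | "0 < i" "i < length w" | "i = length w" using assms by linarith
  then show thesis
  proof cases
    case 1
    then show thesis using first[of "hd w" "tl w"] assms by (simp add: face_def)
  next
    case 2
    have "w = take (i - 1) w @ w ! (i - 1) # w ! i # drop (Suc i) w"
      using 2 by (metis Cons_nth_drop_Suc Suc_diff_1 append_take_drop_id less_imp_diff_less)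
    then show thesis using 2 by (intro middle[of "take (i - 1) w" "w ! (i - 1)" "w ! i" "drop (Suc i) w"])
        (simp_all add: face_def)
  next
    case 3
    then show thesis using last[of "butlast w" "last w"] assms by (simp add: face_def)
  qed
qed

lemma face_middle: "face f (Suc (length xs)) (xs @ a # b # ys) = f (xs @ (a \<otimes>\<^bsub>A\<^esub> b) # ys)"
  by (simp add: face_def nth_append)

lemma face_first: "face f 0 (x # xs) = lact M x (f xs)"
  by (simp add: face_def)

lemma face_last: "face f (Suc (length xs)) (xs @ [x]) = ract M (f xs) x"
  by (simp add: face_def)

lemma face_closed:
  assumes "cochain_on n f" "set w \<subseteq> carrier A" "length w = Suc n" "i \<le> length w"
  shows "face f i w \<in> carrier M"
proof -
  have "w \<noteq> []" using assms(3) by auto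
  with assms(4) show ?thesis
    by (cases rule: face_cases)
      (use assms in \<open>auto simp: cochain_on_def Mod.lact_closed Mod.ract_closed\<close>)
qed

lemma face_cong:
  assumes "\<And>v. \<lbrakk>set v \<subseteq> carrier A; length v = n\<rbrakk> \<Longrightarrow> f v = g v"
    and "set w \<subseteq> carrier A" "length w = Suc n" "i \<le> length w"
  shows "face f i w = face g i w"
proof -
  have "w \<noteq> []" using assms(3) by auto
  with assms(4) show ?thesis
    by (cases rule: face_cases) (use assms(2,3) in \<open>simp_all add: assms(1)\<close>)
qed

lemma face_finsum:
  assumes "finite J" "\<And>j. j \<in> J \<Longrightarrow> cochain_on n (q j)"
    and "set w \<subseteq> carrier A" "length w = Suc n" "i \<le> length w"
  shows "face (\<lambda>v. \<Oplus>j\<in>J. q j v) i w = (\<Oplus>j\<in>J. face (q j) i w)"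
proof -
  have "w \<noteq> []" using assms(4) by auto
  with assms(5) show ?thesis
  proof (cases rule: face_cases)
    case (first x xs)
    then have "(\<lambda>j. q j xs) ` J \<subseteq> carrier M" "x \<in> carrier A" using assms by (auto simp: cochain_on_def)
    then show ?thesis unfolding first(3)
      by (intro Mod.endo_finsum lact_hom assms(1))
  next
    case (middle xs a b ys)
    then show ?thesis by simp
  next
    case (last xs x)
    then have "(\<lambda>j. q j xs) ` J \<subseteq> carrier M" "x \<in> carrier A" using assms by (auto simp: cochain_on_def)
    then show ?thesis unfolding last(4)
      by (intro Mod.endo_finsum[where f = "\<lambda>y. ract M y x"] ract_hom assms(1))
  qed
qed

text \<open>The endomorphisms in question are signs, negation and the action of a scalar; all of
  them commute with both actions of A.\<close>

lemma face_hom: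
  assumes F: "F \<in> add_hom M M" "\<And>a x. \<lbrakk>a \<in> carrier A; x \<in> carrier M\<rbrakk> \<Longrightarrow> F (lact M a x) = lact M a (F x)"
      "\<And>a x. \<lbrakk>a \<in> carrier A; x \<in> carrier M\<rbrakk> \<Longrightarrow> F (ract M x a) = ract M (F x) a"
    and "cochain_on n f" "set w \<subseteq> carrier A" "length w = Suc n" "i \<le> length w"
  shows "face (\<lambda>v. F (f v)) i w = F (face f i w)"
proof -
  have "w \<noteq> []" using assms(6) by auto
  with assms(7) show ?thesis
    by (cases rule: face_cases) (use assms(4-6) in \<open>simp_all add: F cochain_on_def\<close>)
qed

lemma face_sg:
  assumes "cochain_on n f" "set w \<subseteq> carrier A" "length w = Suc n" "i \<le> length w"
  shows "face (\<lambda>v. sg M k (f v)) i w = sg M k (face f i w)"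
  by (rule face_hom[OF Mod.sg_hom _ _ assms]) (simp_all add: sg_lact sg_ract)

text \<open>Such a face changes only entries in front of the block. It shortens that part by one
  entry, so the block moves from j to j - 1.\<close>

lemma face_insert_low:
  assumes "i < j" "j \<le> length v"
  shows "face f i (insert_at j us v) = face (\<lambda>v. f (insert_at (j - 1) us v)) i v"
proof -
  have "i \<le> length v" "v \<noteq> []" using assms by auto
  then show ?thesis
  proof (cases rule: face_cases)
    case (first x xs)
    obtain k where "j = Suc k" using assms(1) by (cases j) auto
    then show ?thesis using first by (simp add: insert_at_def face_first)
  next
    case (middle xs a b ys)
    obtain k where k: "j = Suc (Suc (length xs + k))"
      using assms(1) middle(1) by (metis Suc_leI add_Suc less_eqE)
    have "insert_at j us v = xs @ a # b # (take k ys @ us @ drop k ys)"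
      by (simp add: insert_at_def k middle(2))
    moreover have "insert_at (j - 1) us (xs @ c # ys) = xs @ c # (take k ys @ us @ drop k ys)" for c
      by (simp add: insert_at_def k)
    ultimately show ?thesis using middle(1,3) by (simp add: face_middle)
  next
    case (last xs x)
    then show ?thesis using assms by simp
  qed
qed

text \<open>Such a face changes only entries behind the block: the position j stays, and the face
  index is shifted by the length of the block.\<close>

lemma face_insert_high:
  assumes "j < i" "i \<le> length v"
  shows "face f (i + length us) (insert_at j us v) = face (\<lambda>v. f (insert_at j us v)) i v"
proof -
  have "i \<le> length v" "v \<noteq> []" using assms by auto
  then show ?thesis
  proof (cases rule: face_cases)
    case (first x xs)
    then show ?thesis using assms by simp
  next
    case (middle xs a b ys)
    then have j: "j \<le> length xs" using assms(1) by simp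
    have "insert_at j us v = (take j xs @ us @ drop j xs) @ a # b # ys"
      using j by (simp add: insert_at_def middle(2))
    moreover have "insert_at j us (xs @ c # ys) = (take j xs @ us @ drop j xs) @ c # ys" for c
      using j by (simp add: insert_at_def)
    moreover have "i + length us = Suc (length (take j xs @ us @ drop j xs))"
      using middle(1) j by simp
    ultimately show ?thesis using middle(3) face_middle[of f "take j xs @ us @ drop j xs" a b ys]
      by (simp add: ac_simps)
  next
    case (last xs x)
    then have j: "j \<le> length xs" using assms(1) by simp
    have "insert_at j us v = (take j xs @ us @ drop j xs) @ [x]"
      using j by (simp add: insert_at_def last(3))
    moreover have "insert_at j us xs = take j xs @ us @ drop j xs" by (simp add: insert_at_def)
    moreover have "i + length us = Suc (length (take j xs @ us @ drop j xs))"
      using last(1,3) j by simp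
    ultimately show ?thesis using last(4) face_last[of f "take j xs @ us @ drop j xs" x]
      by (simp add: ac_simps)
  qed
qed

text \<open>The sign is that of moving a block past j arguments. A block of one element gives the
  bullet operation, and a block of two units gives the contracting homotopy.\<close>

definition insertion :: "'a list \<Rightarrow> ('a list \<Rightarrow> 'm) \<Rightarrow> 'a list \<Rightarrow> 'm" where
  "insertion us f v = (\<Oplus>j\<in>{..length v}. sg M (length us * j) (f (insert_at j us v)))"

text \<open>The faces of the lists \<open>insert_at j us v\<close> that touch \<open>us\<close> are those with index between \<open>j\<close> and
  \<open>j + length us\<close>; all others are insertions of \<open>us\<close> into faces of \<open>v\<close>.\<close>

theorem insertion_alternating:
  assumes us: "set us \<subseteq> carrier A" "us \<noteq> []" and v: "set v \<subseteq> carrier A"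
    and f: "cochain_on (length v + length us - 1) f"
  shows "insertion us (alternating f) v =
    (\<Oplus>j\<in>{..length v}. sg M (length us * j)
       (\<Oplus>i\<in>{j..j + length us}. sg M i (face f i (insert_at j us v))))
    \<oplus> sg M (length us) (if v = [] then \<zero> else alternating (insertion us f) v)"
proof -
  let ?c = "length us" and ?m = "length v"
  let ?w = "\<lambda>j. insert_at j us v"
  \<comment> \<open>The summand of \<open>insertion\<close> at position j, regarded as a cochain of
    its own so that faces can be taken of it.\<close>
  define q where "q j v = sg M (?c * j) (f (insert_at j us v))" for j v
  have len: "?m + ?c = Suc (?m + ?c - 1)" using us(2) by (cases us) simp_all
  have fc: "face f i (?w j) \<in> carrier M" if "i \<le> ?m + ?c" for i j
    using that us v len by (intro face_closed[OF f]) auto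
  have fq: "cochain_on (?m - 1) (\<lambda>v. f (insert_at j us v))" if "v \<noteq> []" for j
    using f us(1) that by (cases v) (auto simp: cochain_on_def)
  have q: "cochain_on (?m - 1) (q j)" if "v \<noteq> []" for j
    using fq[OF that, of j] by (auto simp: cochain_on_def q_def)
  have qc: "face (q j) i v \<in> carrier M" if "i \<le> ?m" "v \<noteq> []" for i j
    using that v by (intro face_closed[OF q]) auto
  have face_q: "face (q j) i v = sg M (?c * j) (face (\<lambda>v. f (insert_at j us v)) i v)"
    if "i \<le> ?m" "v \<noteq> []" for i j
    unfolding q_def using that v by (intro face_sg[OF fq]) auto
  define g where "g i j = sg M i (face (q j) i v)" for i j
  have g: "g i j \<in> carrier M" if "i \<le> ?m" "v \<noteq> []" for i j
    using qc that by (simp add: g_def)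
  have fq_closed: "face (\<lambda>v. f (insert_at j us v)) i v \<in> carrier M" if "i \<le> ?m" "v \<noteq> []" for i j
    using that v by (intro face_closed[OF fq]) auto
  define mid where "mid j = (\<Oplus>i\<in>{j..j + ?c}. sg M i (face f i (?w j)))" for j
  have mid: "mid j \<in> carrier M" if "j \<le> ?m" for j
    unfolding mid_def using that fc by (intro Mod.finsum_closed) auto
  \<comment> \<open>The exponents agree, as c j + i = c + (i + c (j - 1)); the factor (-1)^c pulled
    out here is the same as in \<open>high\<close>.\<close>
  have low: "sg M (?c * j) (\<Oplus>i\<in>{..<j}. sg M i (face f i (?w j))) =
      sg M ?c (\<Oplus>i\<in>{..<j}. g i (j - 1))" if j: "j \<le> ?m" for j
  proof (cases j)
    case 0
    then show ?thesis by simp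
  next
    case (Suc k)
    then have ne: "v \<noteq> []" using j by auto
    have "sg M (?c * j) (\<Oplus>i\<in>{..<j}. sg M i (face f i (?w j))) =
        (\<Oplus>i\<in>{..<j}. sg M (?c * j) (sg M i (face f i (?w j))))"
      using fc j by (intro Mod.sg_finsum) auto
    also have "\<dots> = (\<Oplus>i\<in>{..<j}. sg M ?c (g i (j - 1)))"
    proof (intro Mod.finsum_cong')
      fix i assume i: "i \<in> {..<j}"
      have "sg M ?c (g i (j - 1)) = sg M (?c + (i + ?c * k)) (face (\<lambda>v. f (insert_at k us v)) i v)"
        using i j ne Suc by (simp add: g_def face_q fq_closed Mod.sg_sg add.assoc)
      moreover have "face f i (?w j) = face (\<lambda>v. f (insert_at k us v)) i v"
        using face_insert_low[of i j v f us] i j Suc by simp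
      ultimately show "sg M (?c * j) (sg M i (face f i (?w j))) = sg M ?c (g i (j - 1))"
        using i j ne Suc fq_closed by (simp add: Mod.sg_sg ac_simps)
    qed (use g j ne in auto)
    also have "\<dots> = sg M ?c (\<Oplus>i\<in>{..<j}. g i (j - 1))"
      using g j ne by (intro Mod.sg_finsum[symmetric]) auto
    finally show ?thesis .
  qed
  have high: "sg M (?c * j) (\<Oplus>i\<in>{j<..?m}. sg M (i + ?c) (face f (i + ?c) (?w j))) =
      sg M ?c (\<Oplus>i\<in>{j<..?m}. g i j)" if j: "j \<le> ?m" for j
  proof (cases "v = []")
    case True
    then show ?thesis by simp
  next
    case ne: False
    have "sg M (?c * j) (\<Oplus>i\<in>{j<..?m}. sg M (i + ?c) (face f (i + ?c) (?w j))) =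
        (\<Oplus>i\<in>{j<..?m}. sg M (?c * j) (sg M (i + ?c) (face f (i + ?c) (?w j))))"
      using fc j by (intro Mod.sg_finsum) auto
    also have "\<dots> = (\<Oplus>i\<in>{j<..?m}. sg M ?c (g i j))"
    proof (intro Mod.finsum_cong')
      fix i assume i: "i \<in> {j<..?m}"
      show "sg M (?c * j) (sg M (i + ?c) (face f (i + ?c) (?w j))) = sg M ?c (g i j)"
        using face_insert_high[of j i v f us] i ne fq_closed
        by (simp add: g_def face_q Mod.sg_sg ac_simps)
    qed (use g ne in auto)
    also have "\<dots> = sg M ?c (\<Oplus>i\<in>{j<..?m}. g i j)"
      using g ne by (intro Mod.sg_finsum[symmetric]) auto
    finally show ?thesis .
  qed
  have lowc: "(\<Oplus>i\<in>{..<j}. g i (j - 1)) \<in> carrier M" if "j \<le> ?m" for j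
    using that g by (cases "v = []") (auto intro!: Mod.finsum_closed)
  have highc: "(\<Oplus>i\<in>{j<..?m}. g i j) \<in> carrier M" for j
    using g by (cases "v = []") (auto intro!: Mod.finsum_closed)
  have summand: "sg M (?c * j) (alternating f (?w j)) =
      sg M (?c * j) (mid j) \<oplus> (sg M ?c (\<Oplus>i\<in>{..<j}. g i (j - 1)) \<oplus>
        sg M ?c (\<Oplus>i\<in>{j<..?m}. g i j))" if j: "j \<le> ?m" for j
  proof -
    have 1: "(\<Oplus>i\<in>{..<j}. sg M i (face f i (?w j))) \<in> carrier M"
      "(\<Oplus>i\<in>{j<..?m}. sg M (i + ?c) (face f (i + ?c) (?w j))) \<in> carrier M"
      using fc j by (auto intro!: Mod.finsum_closed)
    have "alternating f (?w j) = (\<Oplus>i\<in>{..<j}. sg M i (face f i (?w j))) \<oplus> mid j \<oplus>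
        (\<Oplus>i\<in>{j<..?m}. sg M (i + ?c) (face f (i + ?c) (?w j)))"
      unfolding alternating_def mid_def length_insert_at using fc j by (intro Mod.finsum_split_middle) auto
    then show ?thesis
      using 1 mid[OF j] lowc[OF j] highc[of j] by (simp add: Mod.sg_add low[OF j] high[OF j] Mod.a_ac)
  qed
  have "insertion us (alternating f) v = (\<Oplus>j\<in>{..?m}. sg M (?c * j) (mid j) \<oplus>
      (sg M ?c (\<Oplus>i\<in>{..<j}. g i (j - 1)) \<oplus> sg M ?c (\<Oplus>i\<in>{j<..?m}. g i j)))"
    unfolding insertion_def using mid lowc highc by (intro Mod.finsum_cong') (auto simp: summand)
  also have "\<dots> = (\<Oplus>j\<in>{..?m}. sg M (?c * j) (mid j)) \<oplus>
      ((\<Oplus>j\<in>{..?m}. sg M ?c (\<Oplus>i\<in>{..<j}. g i (j - 1))) \<oplus>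
       (\<Oplus>j\<in>{..?m}. sg M ?c (\<Oplus>i\<in>{j<..?m}. g i j)))"
    using mid lowc highc by (simp add: Mod.finsum_addf Pi_def)
  also have "\<dots> = (\<Oplus>j\<in>{..?m}. sg M (?c * j) (mid j)) \<oplus>
      sg M ?c ((\<Oplus>j\<in>{..?m}. \<Oplus>i\<in>{..<j}. g i (j - 1)) \<oplus> (\<Oplus>j\<in>{..?m}. \<Oplus>i\<in>{j<..?m}. g i j))"
    using lowc highc by (subst Mod.sg_add, (intro Mod.finsum_closed, simp add: Pi_def)+)
      (subst (1 2) Mod.sg_finsum, auto)
  \<comment> \<open>The faces on either side of the block together run once through all pairs of a
    face of v and a position in that face.\<close>
  also have "(\<Oplus>j\<in>{..?m}. \<Oplus>i\<in>{..<j}. g i (j - 1)) \<oplus> (\<Oplus>j\<in>{..?m}. \<Oplus>i\<in>{j<..?m}. g i j) =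
      (\<Oplus>j\<in>{..<?m}. \<Oplus>i\<in>{..?m}. g i j)"
    by (rule Mod.finsum_low_high) (rule g, auto)
  also have "\<dots> = (if v = [] then \<zero> else alternating (insertion us f) v)"
  proof (cases "v = []")
    case True
    then show ?thesis by simp
  next
    case ne: False
    \<comment> \<open>A face evaluates its cochain at lists one shorter than v, which have
      \<open>length v\<close> insertion positions; this is why j stops below
      \<open>?m\<close>.\<close>
    have face_ins: "face (insertion us f) i v = (\<Oplus>j\<in>{..<?m}. face (q j) i v)" if i: "i \<le> ?m" for i
    proof -
      have "face (insertion us f) i v = face (\<lambda>v. \<Oplus>j\<in>{..<?m}. q j v) i v"
      proof (rule face_cong[where n = "?m - 1"])
        fix x :: "'a list" assume "length x = ?m - 1"
        then have "{..length x} = {..<?m}" using ne by (cases v) auto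
        then show "insertion us f x = (\<Oplus>j\<in>{..<?m}. q j x)" by (simp add: insertion_def q_def)
      qed (use v i ne in auto)
      also have "\<dots> = (\<Oplus>j\<in>{..<?m}. face (q j) i v)"
        by (rule face_finsum[where n = "?m - 1"]) (use q v i ne in auto)
      finally show ?thesis .
    qed
    have "(\<Oplus>j\<in>{..<?m}. \<Oplus>i\<in>{..?m}. g i j) = (\<Oplus>i\<in>{..?m}. \<Oplus>j\<in>{..<?m}. g i j)"
      by (rule Mod.finsum_swap) (use g ne in auto)
    also have "\<dots> = (\<Oplus>i\<in>{..?m}. sg M i (face (insertion us f) i v))"
    proof (intro Mod.finsum_cong')
      show "(\<Oplus>j\<in>{..<?m}. g i j) = sg M i (face (insertion us f) i v)" if "i \<in> {..?m}" for i
        unfolding g_def using qc ne that by (simp add: face_ins Mod.sg_finsum image_subset_iff)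
      show "(\<lambda>i. sg M i (face (insertion us f) i v)) \<in> {..?m} \<rightarrow> carrier M"
        using qc ne by (auto simp: face_ins intro!: Mod.finsum_closed)
    qed simp
    finally show ?thesis using ne by (simp add: alternating_def)
  qed
  finally show ?thesis by (simp add: mid_def)
qed

lemma insertion_closed:
  assumes "set us \<subseteq> carrier A" "set v \<subseteq> carrier A" "cochain_on (length v + length us) f"
  shows "insertion us f v \<in> carrier M"
  unfolding insertion_def using assms by (intro Mod.finsum_closed) (auto simp: cochain_on_def)

lemma alternating_closed:
  assumes "cochain_on n f" "set w \<subseteq> carrier A" "length w = Suc n"
  shows "alternating f w \<in> carrier M"
  unfolding alternating_def using face_closed[OF assms] by (intro Mod.finsum_closed) auto

lemma cochain_on_alternating: "cochain_on n f \<Longrightarrow> cochain_on (Suc n) (alternating f)"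
  by (simp add: cochain_on_def alternating_closed)

lemma alternating_cong:
  assumes "\<And>v. \<lbrakk>set v \<subseteq> carrier A; length v = n\<rbrakk> \<Longrightarrow> f v = g v"
    and "set w \<subseteq> carrier A" "length w = Suc n" "cochain_on n f"
  shows "alternating f w = alternating g w"
  unfolding alternating_def
proof (intro Mod.finsum_cong')
  fix i assume "i \<in> {..length w}"
  then have "face f i w = face g i w" "face f i w \<in> carrier M"
    using face_cong[OF assms(1-3)] face_closed[OF assms(4,2,3)] by simp_all
  then show "sg M i (face f i w) = sg M i (face g i w)" by simp
next
  have "face f i w = face g i w" "face f i w \<in> carrier M" if "i \<le> length w" for i
    using face_cong[OF assms(1-3) that] face_closed[OF assms(4,2,3) that] by simp_all
  then show "(\<lambda>i. sg M i (face g i w)) \<in> {..length w} \<rightarrow> carrier M" by (simp add: Pi_def)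
qed simp

lemma alternating_hom:
  assumes F: "F \<in> add_hom M M" "\<And>a x. \<lbrakk>a \<in> carrier A; x \<in> carrier M\<rbrakk> \<Longrightarrow> F (lact M a x) = lact M a (F x)"
      "\<And>a x. \<lbrakk>a \<in> carrier A; x \<in> carrier M\<rbrakk> \<Longrightarrow> F (ract M x a) = ract M (F x) a"
    and f: "cochain_on n f" "set w \<subseteq> carrier A" "length w = Suc n"
  shows "alternating (\<lambda>v. F (f v)) w = F (alternating f w)"
proof -
  have c: "face f i w \<in> carrier M" if "i \<le> length w" for i by (rule face_closed[OF f that])
  have "F (alternating f w) = (\<Oplus>i\<in>{..length w}. F (sg M i (face f i w)))"
    unfolding alternating_def using c
    by (intro Mod.endo_finsum[OF F(1)]) auto
  also have "\<dots> = alternating (\<lambda>v. F (f v)) w"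
    unfolding alternating_def
    using c face_hom[OF F f] by (intro Mod.finsum_cong') (auto simp: Mod.sg_hom_commute[OF F(1)] add_hom_closed[OF F(1)])
  finally show ?thesis by simp
qed

lemma alternating_add:
  assumes f: "cochain_on n f" and g: "cochain_on n g" and w: "set w \<subseteq> carrier A" "length w = Suc n"
  shows "alternating (\<lambda>v. f v \<oplus> g v) w = alternating f w \<oplus> alternating g w"
proof -
  have c: "face f i w \<in> carrier M" "face g i w \<in> carrier M" if "i \<le> length w" for i
    using face_closed[OF f w that] face_closed[OF g w that] by simp_all
  have add: "face (\<lambda>v. f v \<oplus> g v) i w = face f i w \<oplus> face g i w" if "i \<le> length w" for i
  proof -
    have "w \<noteq> []" using w(2) by auto
    with that show ?thesis
      by (cases rule: face_cases)
        (use f g w in \<open>simp_all add: cochain_on_def Mod.lact_add_right Mod.ract_add_left\<close>)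
  qed
  have "alternating (\<lambda>v. f v \<oplus> g v) w =
      (\<Oplus>i\<in>{..length w}. sg M i (face f i w) \<oplus> sg M i (face g i w))"
    unfolding alternating_def using c by (intro Mod.finsum_cong') (auto simp: add Mod.sg_add)
  also have "\<dots> = alternating f w \<oplus> alternating g w"
    unfolding alternating_def using c by (intro Mod.finsum_addf) auto
  finally show ?thesis .
qed

lemma insertion_add:
  assumes us: "set us \<subseteq> carrier A" and v: "set v \<subseteq> carrier A"
    and f: "cochain_on (length v + length us) f" and g: "cochain_on (length v + length us) g"
    and h: "\<And>x. \<lbrakk>set x \<subseteq> carrier A; length x = length v + length us\<rbrakk> \<Longrightarrow> h x = f x \<oplus> g x"
  shows "insertion us h v = insertion us f v \<oplus> insertion us g v"
proof -
  have c: "f (insert_at j us v) \<in> carrier M" "g (insert_at j us v) \<in> carrier M"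
    "h (insert_at j us v) = f (insert_at j us v) \<oplus> g (insert_at j us v)" for j
    using us v f g h[of "insert_at j us v"] by (auto simp: cochain_on_def)
  show ?thesis
    unfolding insertion_def c(3) using c(1,2) by (simp add: Mod.sg_add Mod.finsum_addf Pi_def)
qed

text \<open>The two faces touching z at position j multiply it into the neighbour on the left and on
  the right, with opposite signs. Since z is central, the sum over j telescopes, and its ends z f(v)
  and f(v) z cancel as z acts symmetrically. Up to sign, insertion of z therefore commutes with the
  differential.\<close>

lemma insertion_central:
  assumes z: "z \<in> carrier A" "\<And>a. a \<in> carrier A \<Longrightarrow> z \<otimes>\<^bsub>A\<^esub> a = a \<otimes>\<^bsub>A\<^esub> z"
      "\<And>x. x \<in> carrier M \<Longrightarrow> lact M z x = ract M x z"
    and v: "set v \<subseteq> carrier A" and f: "cochain_on (length v) f"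
  shows "insertion [z] (alternating f) v = \<ominus> (if v = [] then \<zero> else alternating (insertion [z] f) v)"
proof -
  let ?m = "length v"
  \<comment> \<open>The terms of the telescope: z is multiplied into the j-th entry counted from 1,
    and at both ends it acts on the value of f.\<close>
  define C where "C j = (if j = 0 \<or> j = Suc ?m then lact M z (f v)
     else f (v[j - 1 := (v ! (j - 1)) \<otimes>\<^bsub>A\<^esub> z]))" for j
  have C: "C j \<in> carrier M" if "j \<le> Suc ?m" for j
  proof (cases "j = 0 \<or> j = Suc ?m")
    case True
    then show ?thesis using f v z(1) by (auto simp: C_def cochain_on_def Mod.lact_closed)
  next
    case False
    then have "v ! (j - 1) \<in> carrier A" using that v by (auto intro!: subsetD[OF v] nth_mem)
    then have "set (v[j - 1 := (v ! (j - 1)) \<otimes>\<^bsub>A\<^esub> z]) \<subseteq> carrier A"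
      using z(1) by (intro set_update_subsetI v) simp
    then show ?thesis using False f by (simp add: C_def cochain_on_def)
  qed
  have C0: "C 0 = C (Suc ?m)" by (simp add: C_def)
  have left: "face f j (insert_at j [z] v) = C j" if j: "j \<le> ?m" for j
  proof (cases j)
    case 0
    then show ?thesis by (simp add: insert_at_def face_def C_def)
  next
    case (Suc k)
    then have split: "v = take k v @ v ! k # drop (Suc k) v" and k: "length (take k v) = k"
      using j by (simp_all add: id_take_nth_drop)
    have "insert_at j [z] v = take k v @ v ! k # z # drop (Suc k) v"
      using j Suc by (simp add: insert_at_def take_Suc_conv_app_nth)
    then have "face f j (insert_at j [z] v) = f (take k v @ (v ! k \<otimes>\<^bsub>A\<^esub> z) # drop (Suc k) v)"
      using face_middle[of f "take k v" "v ! k" z "drop (Suc k) v"] Suc k by simp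
    then show ?thesis using Suc j by (simp add: C_def upd_conv_take_nth_drop)
  qed
  have right: "face f (Suc j) (insert_at j [z] v) = C (Suc j)" if j: "j \<le> ?m" for j
  proof (cases "j = ?m")
    case True
    then show ?thesis using z(3)[of "f v"] f v by (simp add: insert_at_def face_def C_def cochain_on_def)
  next
    case False
    then have "v ! j \<in> carrier A" using j v by (auto intro!: subsetD[OF v] nth_mem)
    have "insert_at j [z] v = take j v @ z # v ! j # drop (Suc j) v"
      using j False by (simp add: insert_at_def Cons_nth_drop_Suc)
    then have "face f (Suc j) (insert_at j [z] v) = f (take j v @ (z \<otimes>\<^bsub>A\<^esub> v ! j) # drop (Suc j) v)"
      using face_middle[of f "take j v" z "v ! j" "drop (Suc j) v"] j by simp
    then show ?thesis using False j z(2)[OF \<open>v ! j \<in> carrier A\<close>] by (simp add: C_def upd_conv_take_nth_drop)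
  qed
  have mid: "sg M (length [z] * j) (\<Oplus>i\<in>{j..j + length [z]}. sg M i (face f i (insert_at j [z] v))) =
      C j \<ominus> C (Suc j)" if j: "j \<le> ?m" for j
  proof -
    have set: "{j..j + length [z]} = {j, Suc j}" by auto
    have "(\<Oplus>i\<in>{j, Suc j}. sg M i (face f i (insert_at j [z] v))) =
        sg M j (C j) \<oplus> sg M (Suc j) (C (Suc j))"
      using C j by (simp add: Mod.finsum_insert left right)
    then show ?thesis
      unfolding set using C[of j] C[of "Suc j"] j by (simp add: Mod.sg_add Mod.sg_sg) (simp add: sg_def Mod.minus_eq)
  qed
  have "(\<Oplus>j\<in>{..?m}. C j \<ominus> C (Suc j)) = \<zero>"
    using Mod.finsum_telescope[of ?m C] C C0 by (simp add: Mod.minus_eq Mod.r_neg)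
  moreover have "(\<Oplus>j\<in>{..?m}. sg M (length [z] * j)
       (\<Oplus>i\<in>{j..j + length [z]}. sg M i (face f i (insert_at j [z] v)))) =
      (\<Oplus>j\<in>{..?m}. C j \<ominus> C (Suc j))"
    using C by (intro Mod.finsum_cong' mid) auto
  moreover have "alternating (insertion [z] f) v \<in> carrier M" if "v \<noteq> []"
  proof (rule alternating_closed)
    show "cochain_on (?m - 1) (insertion [z] f)"
      unfolding cochain_on_def using insertion_closed[of "[z]" _ f] f z(1) that by (cases v) auto
  qed (use v that in auto)
  ultimately show ?thesis
    using insertion_alternating[of "[z]" v f] z(1) v f by (auto simp: sg_def)
qed

text \<open>The three faces touching two units at position j multiply one of them into a neighbour
  or the units with each other. All give the insertion of a single unit, with signs +, -, +, so
  exactly one copy remains.\<close>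

lemma insertion_one:
  assumes v: "set v \<subseteq> carrier A" and f: "cochain_on (Suc (length v)) f"
    and cocycle: "\<And>w. \<lbrakk>set w \<subseteq> carrier A; length w = Suc (Suc (length v))\<rbrakk> \<Longrightarrow> alternating f w = \<zero>"
  shows "insertion [\<one>\<^bsub>A\<^esub>] f v =
    \<ominus> (if v = [] then \<zero> else alternating (insertion [\<one>\<^bsub>A\<^esub>, \<one>\<^bsub>A\<^esub>] f) v)"
proof -
  let ?m = "length v" and ?e = "\<one>\<^bsub>A\<^esub>"
  define B where "B j = f (insert_at j [?e] v)" for j
  have B: "B j \<in> carrier M" for j using f v by (simp add: B_def cochain_on_def)
  have 1: "face f j (insert_at j [?e, ?e] v) = B j" if j: "j \<le> ?m" for j
  proof (cases j)
    case 0
    then show ?thesis using B[of 0] by (simp add: insert_at_def face_def B_def Mod.lact_one)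
  next
    case (Suc k)
    then have vk: "v ! k \<in> carrier A" using j v by (auto intro!: subsetD[OF v] nth_mem)
    have "insert_at j [?e, ?e] v = take k v @ v ! k # ?e # ?e # drop j v"
      "insert_at j [?e] v = take k v @ v ! k # ?e # drop j v"
      using j Suc by (simp_all add: insert_at_def take_Suc_conv_app_nth)
    then show ?thesis
      using face_middle[of f "take k v" "v ! k" ?e "?e # drop j v"] Suc j vk by (simp add: B_def)
  qed
  have 2: "face f (Suc j) (insert_at j [?e, ?e] v) = B j" if j: "j \<le> ?m" for j
    using face_middle[of f "take j v" ?e ?e "drop j v"] j by (simp add: insert_at_def B_def)
  have 3: "face f (Suc (Suc j)) (insert_at j [?e, ?e] v) = B j" if j: "j \<le> ?m" for j
  proof (cases "j = ?m")
    case True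
    then show ?thesis using B[of j] face_last[of f "v @ [?e]" ?e] by (simp add: insert_at_def B_def Mod.ract_one)
  next
    case False
    then have vj: "v ! j \<in> carrier A" using j v by (auto intro!: subsetD[OF v] nth_mem)
    have drop: "drop j v = v ! j # drop (Suc j) v" using j False by (simp add: Cons_nth_drop_Suc)
    show ?thesis
      using face_middle[of f "take j v @ [?e]" ?e "v ! j" "drop (Suc j) v"] j vj drop
      by (simp add: insert_at_def B_def)
  qed
  have mid: "(\<Oplus>i\<in>{j..j + length [?e, ?e]}. sg M i (face f i (insert_at j [?e, ?e] v))) = sg M j (B j)"
    if j: "j \<le> ?m" for j
  proof -
    have set: "{j..j + length [?e, ?e]} = {j, Suc j, Suc (Suc j)}" by auto
    show ?thesis
      unfolding set using B[of j] j
      by (simp add: Mod.finsum_insert 1 2 3) (simp add: sg_def Mod.l_neg Mod.r_neg)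
  qed
  \<comment> \<open>The outer sign has the even exponent 2 j, so the remaining sign (-1)^j is that
    of inserting one unit.\<close>
  have ins: "insertion [?e] f v = (\<Oplus>j\<in>{..?m}. sg M (length [?e, ?e] * j)
       (\<Oplus>i\<in>{j..j + length [?e, ?e]}. sg M i (face f i (insert_at j [?e, ?e] v))))"
    unfolding insertion_def
  proof (intro Mod.finsum_cong')
    have mid2: "sg M (length [?e, ?e] * j) (\<Oplus>i\<in>{j..j + length [?e, ?e]}.
        sg M i (face f i (insert_at j [?e, ?e] v))) = sg M j (B j)" if "j \<le> ?m" for j
      unfolding mid[OF that] by (simp add: sg_def)
    show "sg M (length [?e] * j) (f (insert_at j [?e] v)) = sg M (length [?e, ?e] * j)
        (\<Oplus>i\<in>{j..j + length [?e, ?e]}. sg M i (face f i (insert_at j [?e, ?e] v)))"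
      if "j \<in> {..?m}" for j
      using that mid2[of j] by (simp add: B_def)
    show "(\<lambda>j. sg M (length [?e, ?e] * j) (\<Oplus>i\<in>{j..j + length [?e, ?e]}.
        sg M i (face f i (insert_at j [?e, ?e] v)))) \<in> {..?m} \<rightarrow> carrier M"
    proof
      fix j assume "j \<in> {..?m}"
      then show "sg M (length [?e, ?e] * j) (\<Oplus>i\<in>{j..j + length [?e, ?e]}.
          sg M i (face f i (insert_at j [?e, ?e] v))) \<in> carrier M"
        using mid2[of j] B[of j] by simp
    qed
  qed simp
  have zero: "insertion [?e, ?e] (alternating f) v = \<zero>"
    unfolding insertion_def using v cocycle by (subst Mod.finsum_cong'[of _ _ "\<lambda>_. \<zero>"]) auto
  have alt: "(if v = [] then \<zero> else alternating (insertion [?e, ?e] f) v) \<in> carrier M"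
  proof (cases "v = []")
    case False
    then have "alternating (insertion [?e, ?e] f) v \<in> carrier M"
    proof (intro alternating_closed)
      show "cochain_on (?m - 1) (insertion [?e, ?e] f)"
        unfolding cochain_on_def using insertion_closed[of "[?e, ?e]" _ f] f False by (cases v) auto
    qed (use v False in auto)
    then show ?thesis using False by simp
  qed simp
  have insc: "insertion [?e] f v \<in> carrier M" using v f by (intro insertion_closed) auto
  have "\<zero> = insertion [?e] f v \<oplus> (if v = [] then \<zero> else alternating (insertion [?e, ?e] f) v)"
    using insertion_alternating[of "[?e, ?e]" v f] v f unfolding zero ins[symmetric] by (simp add: sg_def)
  then show ?thesis using Mod.minus_equality[OF _ alt insc] by simp
qed

section \<open>From faces and insertions to coboundaries and the bracket\<close>

lemma cochains_cochain_on:
  assumes "f \<in> cochains K A M n" "n = int m"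
  shows "cochain_on m f"
  using assms by (auto simp: cochains_def cochain_on_def tuples_def)

lemma cochainsI:
  assumes "\<And>v. v \<in> tuples A n \<Longrightarrow> f v \<in> carrier M"
    and "\<And>as bs x y. \<lbrakk>as @ x # bs \<in> tuples A n; as @ y # bs \<in> tuples A n\<rbrakk> \<Longrightarrow>
        f (as @ (x \<oplus>\<^bsub>A\<^esub> y) # bs) = f (as @ x # bs) \<oplus> f (as @ y # bs)"
    and "\<And>as bs x k. \<lbrakk>k \<in> carrier K; as @ x # bs \<in> tuples A n\<rbrakk> \<Longrightarrow>
        f (as @ (k \<odot>\<^bsub>A\<^esub> x) # bs) = lact M (k \<odot>\<^bsub>A\<^esub> \<one>\<^bsub>A\<^esub>) (f (as @ x # bs))"
  shows "(\<lambda>v\<in>tuples A n. f v) \<in> cochains K A M n"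
proof -
  have "as @ (x \<oplus>\<^bsub>A\<^esub> y) # bs \<in> tuples A n" if "as @ x # bs \<in> tuples A n" "as @ y # bs \<in> tuples A n" for as bs x y
    using that by (auto simp: tuples_def)
  moreover have "as @ (k \<odot>\<^bsub>A\<^esub> x) # bs \<in> tuples A n" if "as @ x # bs \<in> tuples A n" "k \<in> carrier K" for as bs x k
    using that by (auto simp: tuples_def)
  ultimately show ?thesis using assms by (auto simp: cochains_def)
qed

lemma cochainsD:
  assumes "f \<in> cochains K A M n"
  shows cochains_closed: "v \<in> tuples A n \<Longrightarrow> f v \<in> carrier M"
    and cochains_add_arg: "\<lbrakk>as @ x # bs \<in> tuples A n; as @ y # bs \<in> tuples A n\<rbrakk> \<Longrightarrow>
        f (as @ (x \<oplus>\<^bsub>A\<^esub> y) # bs) = f (as @ x # bs) \<oplus> f (as @ y # bs)"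
    and cochains_smult_arg: "\<lbrakk>k \<in> carrier K; as @ x # bs \<in> tuples A n\<rbrakk> \<Longrightarrow>
        f (as @ (k \<odot>\<^bsub>A\<^esub> x) # bs) = lact M (k \<odot>\<^bsub>A\<^esub> \<one>\<^bsub>A\<^esub>) (f (as @ x # bs))"
  using assms by (auto simp: cochains_def)

lemma scalar_central:
  assumes "k \<in> carrier K" "a \<in> carrier A"
  shows "(k \<odot>\<^bsub>A\<^esub> \<one>\<^bsub>A\<^esub>) \<otimes>\<^bsub>A\<^esub> a = a \<otimes>\<^bsub>A\<^esub> (k \<odot>\<^bsub>A\<^esub> \<one>\<^bsub>A\<^esub>)"
  using assms by (simp add: smult_mult_left smult_mult_right)

lemma scalar_lact_commute:
  assumes "k \<in> carrier K" "a \<in> carrier A" "x \<in> carrier M"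
  shows "lact M (k \<odot>\<^bsub>A\<^esub> \<one>\<^bsub>A\<^esub>) (lact M a x) = lact M a (lact M (k \<odot>\<^bsub>A\<^esub> \<one>\<^bsub>A\<^esub>) x)"
    "lact M (k \<odot>\<^bsub>A\<^esub> \<one>\<^bsub>A\<^esub>) (ract M x a) = ract M (lact M (k \<odot>\<^bsub>A\<^esub> \<one>\<^bsub>A\<^esub>) x) a"
  using assms by (simp_all add: scalar_central Mod.lact_ract flip: Mod.lact_mult)

lemma a_inv_endo: "a_inv M \<in> add_hom M M"
  by (simp add: add_hom_def Mod.minus_add)

lemma a_inv_zero [simp]: "\<ominus> \<zero> = \<zero>"
  by (rule Mod.endo_zero[OF a_inv_endo])

lemma a_inv_action:
  assumes "a \<in> carrier A" "x \<in> carrier M"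
  shows "\<ominus> lact M a x = lact M a (\<ominus> x)" "\<ominus> ract M x a = ract M (\<ominus> x) a"
  using Mod.endo_minus[OF lact_hom[OF assms(1)] assms(2)]
    Mod.endo_minus[OF ract_hom[OF assms(1)] assms(2)]
  by simp_all

lemma cochains_hom:
  assumes F: "F \<in> add_hom M M"
    "\<And>k x. \<lbrakk>k \<in> carrier K; x \<in> carrier M\<rbrakk> \<Longrightarrow> F (lact M (k \<odot>\<^bsub>A\<^esub> \<one>\<^bsub>A\<^esub>) x) = lact M (k \<odot>\<^bsub>A\<^esub> \<one>\<^bsub>A\<^esub>) (F x)"
    and f: "f \<in> cochains K A M n"
  shows "(\<lambda>v\<in>tuples A n. F (f v)) \<in> cochains K A M n"
  by (rule cochainsI) (simp_all add: cochainsD[OF f] F add_hom_closed[OF F(1)] add_hom_add[OF F(1)])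

lemma cochains_add:
  assumes f: "f \<in> cochains K A M n" and g: "g \<in> cochains K A M n"
  shows "(\<lambda>v\<in>tuples A n. f v \<oplus> g v) \<in> cochains K A M n"
  by (rule cochainsI) (simp_all add: cochainsD[OF f] cochainsD[OF g] Mod.lact_add_right Mod.a_ac)

lemma cochains_zero: "(\<lambda>v\<in>tuples A n. \<zero>) \<in> cochains K A M n"
  by (rule cochainsI) (simp_all add: Mod.endo_zero[OF lact_hom])

lemma cochains_insertion:
  assumes f: "f \<in> cochains K A M n" and us: "set us \<subseteq> carrier A"
  shows "(\<lambda>v\<in>tuples A (n - int (length us)). insertion us f v) \<in> cochains K A M (n - int (length us))"
proof (rule cochainsI)
  let ?n = "n - int (length us)"
  have ins: "insert_at j us v \<in> tuples A n" if "v \<in> tuples A ?n" for j v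
    using that us by (auto simp: tuples_def)
  have c: "sg M i (f (insert_at j us v)) \<in> carrier M" if "v \<in> tuples A ?n" for i j v
    using cochains_closed[OF f ins[OF that]] by simp
  show "insertion us f v \<in> carrier M" if "v \<in> tuples A ?n" for v
    unfolding insertion_def using c[OF that] by (intro Mod.finsum_closed) auto
  \<comment> \<open>The block lies entirely on one side of the argument x, so x is still a single
    argument of the longer list and multilinearity of f applies there.\<close>
  have slot: "\<exists>as' bs'. \<forall>x. insert_at j us (as @ x # bs) = as' @ x # bs'" for j as bs
  proof (cases "j \<le> length as")
    case True
    then show ?thesis
      by (intro exI[of _ "insert_at j us as"] exI[of _ bs]) (simp add: insert_at_def)
  next
    case False
    then obtain k where "j = Suc (length as + k)" by (metis add_Suc less_iff_Suc_add not_le)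
    then show ?thesis
      by (intro exI[of _ as] exI[of _ "insert_at k us bs"]) (simp add: insert_at_def)
  qed
  fix as bs x
  assume x: "as @ x # bs \<in> tuples A ?n"
  {
    fix y assume y: "as @ y # bs \<in> tuples A ?n"
    have "f (insert_at j us (as @ (x \<oplus>\<^bsub>A\<^esub> y) # bs)) =
        f (insert_at j us (as @ x # bs)) \<oplus> f (insert_at j us (as @ y # bs))" for j
    proof -
      obtain as' bs' where "\<And>x. insert_at j us (as @ x # bs) = as' @ x # bs'" using slot by blast
      then show ?thesis using cochains_add_arg[OF f] ins[OF x, of j] ins[OF y, of j] by simp
    qed
    then show "insertion us f (as @ (x \<oplus>\<^bsub>A\<^esub> y) # bs) =
        insertion us f (as @ x # bs) \<oplus> insertion us f (as @ y # bs)"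
      unfolding insertion_def using cochains_closed[OF f ins[OF x]] cochains_closed[OF f ins[OF y]]
      by (simp add: Mod.sg_add Mod.finsum_addf Pi_def)
  next
    fix k assume k: "k \<in> carrier K"
    have "f (insert_at j us (as @ (k \<odot>\<^bsub>A\<^esub> x) # bs)) =
        lact M (k \<odot>\<^bsub>A\<^esub> \<one>\<^bsub>A\<^esub>) (f (insert_at j us (as @ x # bs)))" for j
    proof -
      obtain as' bs' where "\<And>x. insert_at j us (as @ x # bs) = as' @ x # bs'" using slot by blast
      then show ?thesis using cochains_smult_arg[OF f k] ins[OF x, of j] by simp
    qed
    then show "insertion us f (as @ (k \<odot>\<^bsub>A\<^esub> x) # bs) =
        lact M (k \<odot>\<^bsub>A\<^esub> \<one>\<^bsub>A\<^esub>) (insertion us f (as @ x # bs))"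
      unfolding insertion_def using cochains_closed[OF f ins[OF x]] k
      by (subst Mod.endo_finsum[OF lact_hom])
        (auto simp: sg_lact)
  }
qed

text \<open>\<open>coboundary\<close> separates the outer faces and counts the inner ones from 0;
  splitting the first and last terms off the sum over all faces matches the two forms. The empty
  list occurs only in degree -1.\<close>

lemma coboundary_eq_alternating:
  assumes f: "f \<in> cochains K A M n" and w: "w \<in> tuples A (n + 1)"
  shows "coboundary A M n f w = (if w = [] then \<zero> else alternating f w)"
proof (cases "w = []")
  case True
  then show ?thesis using w by (simp add: coboundary_def)
next
  case False
  then obtain m where m: "length w = Suc m" by (cases w) auto
  then have n: "n = int m" and wA: "set w \<subseteq> carrier A" using w by (auto simp: tuples_def)
  note c = face_closed[OF cochains_cochain_on[OF f n] wA m]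
  have low: "(\<Oplus>i\<in>{..m}. sg M i (face f i w)) =
      face f 0 w \<oplus> (\<Oplus>i\<in>{..<m}. sg M (Suc i) (face f (Suc i) w))"
  proof (cases m)
    case 0
    then show ?thesis using c[of 0] by (simp add: sg_def)
  next
    case (Suc k)
    have "(\<Oplus>i\<in>{..Suc k}. sg M i (face f i w)) =
        (\<Oplus>i\<in>{..k}. sg M (Suc i) (face f (Suc i) w)) \<oplus> sg M 0 (face f 0 w)"
      using c m Suc by (intro Mod.finsum_Suc2) auto
    moreover have "(\<Oplus>i\<in>{..k}. sg M (Suc i) (face f (Suc i) w)) \<in> carrier M"
      using c m Suc by (intro Mod.finsum_closed) auto
    ultimately show ?thesis using c[of 0] Suc by (simp add: Mod.sg_even lessThan_Suc_atMost Mod.a_comm)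
  qed
  have "alternating f w = sg M (Suc m) (face f (Suc m) w) \<oplus> (\<Oplus>i\<in>{..m}. sg M i (face f i w))"
    unfolding alternating_def m using c m by (intro Mod.finsum_Suc) auto
  moreover have sumc: "(\<Oplus>i\<in>{..<m}. sg M (Suc i) (face f (Suc i) w)) \<in> carrier M"
    using c m by (intro Mod.finsum_closed) auto
  ultimately have alt: "alternating f w = face f 0 w \<oplus>
      (\<Oplus>i\<in>{..<m}. sg M (Suc i) (face f (Suc i) w)) \<oplus> sg M (Suc m) (face f (Suc m) w)"
    using c[of 0] c[of "Suc m"] m low by (simp add: Mod.a_ac)
  have mid: "f (take i w @ (w ! i \<otimes>\<^bsub>A\<^esub> w ! Suc i) # drop (i + 2) w) = face f (Suc i) w" if "i < m" for i
    using that m by (simp add: face_def)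
  have "(\<Oplus>i\<in>{..<length w - 1}. add_pow M ((-1) ^ Suc i :: int)
        (f (take i w @ (w ! i \<otimes>\<^bsub>A\<^esub> w ! Suc i) # drop (i + 2) w))) =
      (\<Oplus>i\<in>{..<m}. sg M (Suc i) (face f (Suc i) w))"
  proof (intro Mod.finsum_cong')
    show "add_pow M ((-1) ^ Suc i :: int) (f (take i w @ (w ! i \<otimes>\<^bsub>A\<^esub> w ! Suc i) # drop (i + 2) w)) =
        sg M (Suc i) (face f (Suc i) w)" if "i \<in> {..<m}" for i
    proof -
      have i: "i < m" using that by simp
      show ?thesis unfolding mid[OF i] using c[of "Suc i"] i m by (intro Mod.add_pow_minus_one) simp
    qed
  qed (use c m in auto)
  moreover have "ract M (f (butlast w)) (last w) = face f (Suc m) w" "lact M (hd w) (f (tl w)) = face f 0 w"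
    using m by (simp_all add: face_def)
  ultimately show ?thesis
    using w False c[of "Suc m"] m by (simp add: coboundary_def alt Mod.add_pow_minus_one del: power_Suc)
qed

lemma bullet_eq_insertion:
  assumes f: "\<And>v. v \<in> tuples A n \<Longrightarrow> f v \<in> carrier M" and z: "z \<in> carrier A" and v: "v \<in> tuples A (n - 1)"
  shows "bullet A M n f z v = insertion [z] f v"
proof -
  have "f (insert_at i [z] v) \<in> carrier M" for i
    using v z by (intro f) (auto simp: tuples_def)
  then show ?thesis using v
    by (simp add: bullet_def insertion_def insert_at_def Mod.add_pow_minus_one)
qed

lemma coboundary_closed:
  assumes f: "f \<in> cochains K A M n" and w: "w \<in> tuples A (n + 1)"
  shows "coboundary A M n f w \<in> carrier M"
proof (cases w)
  case (Cons a as)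
  then have "n = int (length as)" "set w \<subseteq> carrier A" "length w = Suc (length as)"
    using w by (auto simp: tuples_def)
  then show ?thesis
    unfolding coboundary_eq_alternating[OF f w] using alternating_closed[OF cochains_cochain_on[OF f]] by simp
qed (unfold coboundary_eq_alternating[OF f w], simp)

text \<open>On a nonempty list the faces evaluate f only at tuples of the right degree, where the
  restriction is invisible.\<close>

lemma coboundary_restrict:
  assumes f: "(\<lambda>v\<in>tuples A n. f v) \<in> cochains K A M n" and w: "w \<in> tuples A (n + 1)"
  shows "coboundary A M n (\<lambda>v\<in>tuples A n. f v) w = (if w = [] then \<zero> else alternating f w)"
proof (cases w)
  case (Cons a as)
  then have n: "n = int (length as)" and wA: "set w \<subseteq> carrier A" "length w = Suc (length as)"
    using w by (auto simp: tuples_def)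
  have "alternating (\<lambda>v\<in>tuples A n. f v) w = alternating f w"
    by (rule alternating_cong[OF _ wA cochains_cochain_on[OF f n]]) (simp add: tuples_def n)
  then show ?thesis unfolding coboundary_eq_alternating[OF f w] by simp
qed (unfold coboundary_eq_alternating[OF f w], simp)

lemma coboundary_hom:
  assumes F: "F \<in> add_hom M M" "\<And>a x. \<lbrakk>a \<in> carrier A; x \<in> carrier M\<rbrakk> \<Longrightarrow> F (lact M a x) = lact M a (F x)"
      "\<And>a x. \<lbrakk>a \<in> carrier A; x \<in> carrier M\<rbrakk> \<Longrightarrow> F (ract M x a) = ract M (F x) a"
    and f: "f \<in> cochains K A M n" and w: "w \<in> tuples A (n + 1)"
  shows "coboundary A M n (\<lambda>v\<in>tuples A n. F (f v)) w = F (coboundary A M n f w)"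
proof -
  have cob: "coboundary A M n (\<lambda>v\<in>tuples A n. F (f v)) w =
      (if w = [] then \<zero> else alternating (\<lambda>v. F (f v)) w)"
    by (intro coboundary_restrict cochains_hom F f w) simp
  show ?thesis
  proof (cases w)
    case (Cons a as)
    then have "n = int (length as)" "set w \<subseteq> carrier A" "length w = Suc (length as)"
      using w by (auto simp: tuples_def)
    then show ?thesis
      unfolding cob coboundary_eq_alternating[OF f w]
      using alternating_hom[OF F cochains_cochain_on[OF f]] Cons by simp
  qed (unfold cob coboundary_eq_alternating[OF f w], simp add: Mod.endo_zero[OF F(1)])
qed

lemma coboundary_add:
  assumes f: "f \<in> cochains K A M n" and g: "g \<in> cochains K A M n" and w: "w \<in> tuples A (n + 1)"
  shows "coboundary A M n (\<lambda>v\<in>tuples A n. f v \<oplus> g v) w =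
    coboundary A M n f w \<oplus> coboundary A M n g w"
proof -
  note cob = coboundary_restrict[OF cochains_add[OF f g] w]
    coboundary_eq_alternating[OF f w] coboundary_eq_alternating[OF g w]
  show ?thesis
  proof (cases w)
    case (Cons a as)
    then have "n = int (length as)" "set w \<subseteq> carrier A" "length w = Suc (length as)"
      using w by (auto simp: tuples_def)
    then show ?thesis
      unfolding cob using alternating_add[OF cochains_cochain_on[OF f] cochains_cochain_on[OF g]] Cons by simp
  qed (unfold cob, simp)
qed

text \<open>The cochain inserted into is a general member of the class of \<open>f0\<close>. On its
  coboundary part insertion of z commutes with the differential up to sign; on \<open>f0\<close> the
  scalar is pulled out by multilinearity, which leaves the insertion of the unit.\<close>

lemma bullet_scalar_coboundary:
  assumes k: "k \<in> carrier K" and f0: "f0 \<in> cochains K A M (int n)"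
    and cocycle: "coboundary A M (int n) f0 = (\<lambda>as\<in>tuples A (int n + 1). \<zero>)"
    and g: "g \<in> cochains K A M (int n - 1)"
  defines "z \<equiv> k \<odot>\<^bsub>A\<^esub> \<one>\<^bsub>A\<^esub>"
  shows "bullet A M (int n) (\<lambda>as\<in>tuples A (int n). coboundary A M (int n - 1) g as \<oplus> f0 as) z
    \<in> coboundaries K A M (int n - 1)"
proof -
  let ?n = "int n" and ?e = "\<one>\<^bsub>A\<^esub>"
  define f where "f = (\<lambda>as\<in>tuples A ?n. coboundary A M (?n - 1) g as \<oplus> f0 as)"
  have z: "z \<in> carrier A" using k by (simp add: z_def)
  have zl: "lact M z \<in> add_hom M M" by (rule lact_hom[OF z])
  have z_lact: "lact M z (lact M a x) = lact M a (lact M z x)" "lact M z (ract M x a) = ract M (lact M z x) a"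
    if "a \<in> carrier A" "x \<in> carrier M" for a x
    unfolding z_def by (rule scalar_lact_commute[OF k that])+
  \<comment> \<open>The primitive is minus the sum of the insertion of z into g and z times the
    insertion of two units into \<open>f0\<close>; it is built up one operation at a time so that
    each step is a cochain.\<close>
  define h1 where "h1 = (\<lambda>v\<in>tuples A (?n - 2). insertion [z] g v)"
  define h2 where "h2 = (\<lambda>v\<in>tuples A (?n - 2). insertion [?e, ?e] f0 v)"
  define h3 where "h3 = (\<lambda>v\<in>tuples A (?n - 2). lact M z (h2 v))"
  define h4 where "h4 = (\<lambda>v\<in>tuples A (?n - 2). h1 v \<oplus> h3 v)"
  define h where "h = (\<lambda>v\<in>tuples A (?n - 2). \<ominus> h4 v)"
  have h1: "h1 \<in> cochains K A M (?n - 2)"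
    using cochains_insertion[OF g, of "[z]"] z by (simp add: h1_def)
  have h2: "h2 \<in> cochains K A M (?n - 2)"
    using cochains_insertion[OF f0, of "[?e, ?e]"] by (simp add: h2_def)
  have h3: "h3 \<in> cochains K A M (?n - 2)"
    unfolding h3_def by (rule cochains_hom[OF zl _ h2]) (simp add: z_lact)
  have h4: "h4 \<in> cochains K A M (?n - 2)"
    unfolding h4_def by (rule cochains_add[OF h1 h3])
  have h: "h \<in> cochains K A M (?n - 2)"
    unfolding h_def by (rule cochains_hom[OF a_inv_endo _ h4]) (simp add: a_inv_action)
  have "bullet A M ?n f z = coboundary A M (?n - 2) h"
  proof (rule extensionalityI[where A = "tuples A (?n - 1)"])
    show "bullet A M ?n f z \<in> extensional (tuples A (?n - 1))" by (simp add: bullet_def)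
    show "coboundary A M (?n - 2) h \<in> extensional (tuples A (?n - 1))" by (simp add: coboundary_def)
    fix v assume v: "v \<in> tuples A (?n - 1)"
    \<comment> \<open>A list of length n - 1 exists only for positive n; in degree 0 both sides are
      extensional on the empty set.\<close>
    then have vA: "set v \<subseteq> carrier A" and len: "n = Suc (length v)" by (auto simp: tuples_def)
    have v': "v \<in> tuples A (?n - 2 + 1)" using v by (simp add: algebra_simps)
    have gc: "cochain_on (length v) g" by (rule cochains_cochain_on[OF g]) (simp add: len)
    have f0c: "cochain_on (Suc (length v)) f0" by (rule cochains_cochain_on[OF f0]) (simp add: len)
    have fv: "f w = alternating g w \<oplus> f0 w" if "set w \<subseteq> carrier A" "length w = length v + length [z]" for w
    proof -
      have w: "w \<in> tuples A ?n" "w \<in> tuples A (?n - 1 + 1)" "w \<noteq> []" using that len by (auto simp: tuples_def)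
      then show ?thesis using coboundary_eq_alternating[OF g w(2)] by (simp add: f_def)
    qed
    have altg: "cochain_on (length v + length [z]) (alternating g)"
      using cochain_on_alternating[OF gc] by simp
    have f0c': "cochain_on (length v + length [z]) f0" using f0c by simp
    have "bullet A M ?n f z v = insertion [z] f v"
    proof (rule bullet_eq_insertion[OF _ z v])
      show "f w \<in> carrier M" if "w \<in> tuples A ?n" for w
        using that fv[of w] altg f0c' len by (auto simp: tuples_def cochain_on_def)
    qed
    also have "\<dots> = insertion [z] (alternating g) v \<oplus> insertion [z] f0 v"
      using z vA by (intro insertion_add altg f0c' fv) auto
    also have "insertion [z] (alternating g) v = \<ominus> (if v = [] then \<zero> else alternating (insertion [z] g) v)"
      using k by (intro insertion_central z vA gc) (simp_all add: z_def scalar_central scalar_symmetric)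
    also have "(if v = [] then \<zero> else alternating (insertion [z] g) v) = coboundary A M (?n - 2) h1 v"
      unfolding h1_def by (rule coboundary_restrict[OF h1[unfolded h1_def] v', symmetric])
    \<comment> \<open>Each inserted z is k times the unit, so linearity in that argument takes the
      scalar out of the whole sum.\<close>
    also have "insertion [z] f0 v = lact M z (insertion [?e] f0 v)"
    proof -
      have c: "f0 (insert_at j [?e] v) \<in> carrier M" for j
        using f0c vA by (simp add: cochain_on_def)
      have "f0 (insert_at j [z] v) = lact M z (f0 (insert_at j [?e] v))" for j
      proof -
        have "take j v @ ?e # drop j v \<in> tuples A ?n"
          using vA len set_take_subset[of j v] set_drop_subset[of j v] by (auto simp: tuples_def)
        from cochains_smult_arg[OF f0 k this] show ?thesis by (simp add: insert_at_def z_def)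
      qed
      then show ?thesis
        unfolding insertion_def using c z by (subst Mod.endo_finsum[OF zl]) (auto simp: sg_lact)
    qed
    also have "insertion [?e] f0 v = \<ominus> (if v = [] then \<zero> else alternating (insertion [?e, ?e] f0) v)"
    proof (rule insertion_one[OF vA f0c])
      fix w assume "set w \<subseteq> carrier A" "length w = Suc (Suc (length v))"
      then have w: "w \<in> tuples A (?n + 1)" "w \<noteq> []" using len by (auto simp: tuples_def)
      then show "alternating f0 w = \<zero>"
        using coboundary_eq_alternating[OF f0 w(1)] cocycle by simp
    qed
    also have "(if v = [] then \<zero> else alternating (insertion [?e, ?e] f0) v) = coboundary A M (?n - 2) h2 v"
      unfolding h2_def by (rule coboundary_restrict[OF h2[unfolded h2_def] v', symmetric])
    also have "\<ominus> coboundary A M (?n - 2) h1 v \<oplus> lact M z (\<ominus> coboundary A M (?n - 2) h2 v) =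
        \<ominus> (coboundary A M (?n - 2) h1 v \<oplus> lact M z (coboundary A M (?n - 2) h2 v))"
      using coboundary_closed[OF h1 v'] coboundary_closed[OF h2 v'] z
      by (simp add: Mod.minus_add a_inv_action Mod.lact_closed)
    also have "lact M z (coboundary A M (?n - 2) h2 v) = coboundary A M (?n - 2) h3 v"
      unfolding h3_def by (rule coboundary_hom[OF zl z_lact h2 v', symmetric])
    also have "coboundary A M (?n - 2) h1 v \<oplus> coboundary A M (?n - 2) h3 v = coboundary A M (?n - 2) h4 v"
      unfolding h4_def by (rule coboundary_add[OF h1 h3 v', symmetric])
    also have "\<ominus> coboundary A M (?n - 2) h4 v = coboundary A M (?n - 2) h v"
      unfolding h_def by (rule coboundary_hom[OF a_inv_endo a_inv_action h4 v', symmetric])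
    finally show "bullet A M ?n f z v = coboundary A M (?n - 2) h v" .
  qed
  then show ?thesis using h by (simp add: f_def coboundaries_def)
qed

text \<open>Proved from closure of the coboundaries under sums and negatives: to reach x, add b to x
  plus the coboundary of the negative of a primitive of b.\<close>

lemma coboundaries_translate:
  assumes b: "b \<in> coboundaries K A M n"
  shows "coboundaries K A M n #>\<^bsub>cocycle_group K A M n\<^esub> b = coboundaries K A M n"
proof -
  let ?n = "n - 1" and ?\<delta> = "coboundary A M (n - 1)"
  have add: "(\<lambda>v\<in>tuples A n. ?\<delta> x v \<oplus> ?\<delta> y v) \<in> coboundaries K A M n"
    if "x \<in> cochains K A M ?n" "y \<in> cochains K A M ?n" for x y
    unfolding coboundaries_def
  proof (rule image_eqI[OF _ cochains_add[OF that]], rule extensionalityI[where A = "tuples A n"])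
    show "?\<delta> (\<lambda>v\<in>tuples A ?n. x v \<oplus> y v) \<in> extensional (tuples A n)" by (simp add: coboundary_def)
    show "(\<lambda>v\<in>tuples A n. ?\<delta> x v \<oplus> ?\<delta> y v) v = ?\<delta> (\<lambda>v\<in>tuples A ?n. x v \<oplus> y v) v"
      if "v \<in> tuples A n" for v
      using coboundary_add[OF \<open>x \<in> _\<close> \<open>y \<in> _\<close>, of v] that by simp
  qed simp
  obtain g where g: "g \<in> cochains K A M ?n" "b = ?\<delta> g"
    using b by (auto simp: coboundaries_def)
  define g' where "g' = (\<lambda>v\<in>tuples A ?n. \<ominus> g v)"
  have g': "g' \<in> cochains K A M ?n"
    unfolding g'_def by (rule cochains_hom[OF a_inv_endo _ g(1)]) (simp add: a_inv_action)
  have neg_g: "?\<delta> g' v = \<ominus> ?\<delta> g v" if "v \<in> tuples A n" for v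
    unfolding g'_def by (rule coboundary_hom[OF a_inv_endo a_inv_action g(1)]) (use that in simp_all)
  have coset: "coboundaries K A M n #>\<^bsub>cocycle_group K A M n\<^esub> b =
      (\<lambda>x. \<lambda>v\<in>tuples A n. x v \<oplus> b v) ` coboundaries K A M n"
    by (auto simp: r_coset_def cocycle_group_def)
  show ?thesis
    unfolding coset
  proof (intro equalityI subsetI)
    fix x assume "x \<in> coboundaries K A M n"
    then obtain y where y: "y \<in> cochains K A M ?n" "x = ?\<delta> y" by (auto simp: coboundaries_def)
    have "x = (\<lambda>v\<in>tuples A n. (\<lambda>v\<in>tuples A n. ?\<delta> y v \<oplus> ?\<delta> g' v) v \<oplus> b v)"
    proof (rule extensionalityI[where A = "tuples A n"])
      show "x \<in> extensional (tuples A n)" by (simp add: y(2) coboundary_def)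
      show "x v = (\<lambda>v\<in>tuples A n. (\<lambda>v\<in>tuples A n. ?\<delta> y v \<oplus> ?\<delta> g' v) v \<oplus> b v) v"
        if "v \<in> tuples A n" for v
        using that neg_g coboundary_closed[OF y(1), of v] coboundary_closed[OF g(1), of v]
        by (simp add: y g Mod.a_assoc Mod.l_neg)
    qed simp
    then show "x \<in> (\<lambda>x. \<lambda>v\<in>tuples A n. x v \<oplus> b v) ` coboundaries K A M n"
      using add[OF y(1) g'] by blast
  qed (use add g in \<open>auto simp: coboundaries_def\<close>)
qed

theorem bracket_scalar:
  assumes k: "k \<in> carrier K" and \<phi>: "\<phi> \<in> carrier (HH K A M (int n))"
  shows "bracket K A M (int n) \<phi> (k \<odot>\<^bsub>A\<^esub> \<one>\<^bsub>A\<^esub>) = \<one>\<^bsub>HH K A M (int n - 1)\<^esub>"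
proof -
  let ?G = "cocycle_group K A M (int n)"
  obtain f0 where f0: "f0 \<in> carrier ?G" "\<phi> = coboundaries K A M (int n) #>\<^bsub>?G\<^esub> f0"
    using \<phi> by (auto simp: HH_def FactGroup_def RCOSETS_def)
  have coset: "\<phi> = (\<lambda>h. \<lambda>v\<in>tuples A (int n). h v \<oplus> f0 v) ` coboundaries K A M (int n)"
    unfolding f0(2) by (auto simp: r_coset_def cocycle_group_def)
  \<comment> \<open>The bracket is a union of cosets over the members of the class. All of them
    equal the trivial coset, and there has to be at least one.\<close>
  have "\<phi> \<noteq> {}"
    using cochains_zero[of "int n - 1"] by (auto simp: coset coboundaries_def)
  moreover have "coboundaries K A M (int n - 1) #>\<^bsub>cocycle_group K A M (int n - 1)\<^esub>
      bullet A M (int n) f (k \<odot>\<^bsub>A\<^esub> \<one>\<^bsub>A\<^esub>) = coboundaries K A M (int n - 1)" if "f \<in> \<phi>" for f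
  proof (rule coboundaries_translate)
    obtain g where g: "g \<in> cochains K A M (int n - 1)"
      "f = (\<lambda>v\<in>tuples A (int n). coboundary A M (int n - 1) g v \<oplus> f0 v)"
      using \<open>f \<in> \<phi>\<close> by (auto simp: coset coboundaries_def)
    show "bullet A M (int n) f (k \<odot>\<^bsub>A\<^esub> \<one>\<^bsub>A\<^esub>) \<in> coboundaries K A M (int n - 1)"
      unfolding g(2) using f0(1)
      by (intro bullet_scalar_coboundary k g(1)) (simp_all add: cocycle_group_def)
  qed
  ultimately show ?thesis by (simp add: bracket_def HH_def FactGroup_def)
qed

end

section \<open>The equivalences\<close>

lemma center_commute:
  "\<lbrakk>z \<in> carrier (center A); a \<in> carrier A\<rbrakk> \<Longrightarrow> z \<otimes>\<^bsub>A\<^esub> a = a \<otimes>\<^bsub>A\<^esub> z"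
  by (simp add: center_def)

lemma assoc_algebra_center:
  fixes A (structure)
  assumes "assoc_algebra K A"
  shows "assoc_algebra K (center A)"
proof -
  interpret assoc_algebra K A by fact
  let ?Z = "center A"
  have Z: "carrier ?Z = {z \<in> carrier A. \<forall>a\<in>carrier A. z \<otimes> a = a \<otimes> z}"
    "monoid.mult ?Z = monoid.mult A" "add ?Z = add A" "\<one>\<^bsub>?Z\<^esub> = \<one>" "\<zero>\<^bsub>?Z\<^esub> = \<zero>" "smult ?Z = smult A"
    by (simp_all add: center_def)
  have sub: "x \<in> carrier A" if "x \<in> carrier ?Z" for x
    using that unfolding Z(1) by blast
  have mult: "x \<otimes> y \<in> carrier ?Z" if "x \<in> carrier ?Z" "y \<in> carrier ?Z" for x y
  proof -
    have "x \<otimes> y \<otimes> a = a \<otimes> (x \<otimes> y)" if a: "a \<in> carrier A" for a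
    proof -
      have c: "x \<in> carrier A" "y \<in> carrier A" "x \<otimes> a = a \<otimes> x" "y \<otimes> a = a \<otimes> y"
        using \<open>x \<in> carrier ?Z\<close> \<open>y \<in> carrier ?Z\<close> a by (auto simp: Z)
      have "x \<otimes> y \<otimes> a = (x \<otimes> a) \<otimes> y" using c(1,2,4) a by (simp add: A.m_assoc)
      also have "\<dots> = a \<otimes> (x \<otimes> y)" unfolding c(3) using c(1,2) a by (simp add: A.m_assoc)
      finally show ?thesis .
    qed
    moreover have "x \<otimes> y \<in> carrier A" using that by (intro A.m_closed sub)
    ultimately show ?thesis unfolding Z(1) by blast
  qed
  have neg: "\<ominus> x \<in> carrier ?Z" if "x \<in> carrier ?Z" for x
    using that by (simp add: Z A.l_minus A.r_minus)
  have comm: "x \<otimes> a = a \<otimes> x" if "x \<in> carrier ?Z" "a \<in> carrier A" for x a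
    using that unfolding Z(1) by blast
  have memI: "x \<in> carrier ?Z" if "x \<in> carrier A" "\<And>a. a \<in> carrier A \<Longrightarrow> x \<otimes> a = a \<otimes> x" for x
    using that unfolding Z(1) by blast
  have add: "x \<oplus> y \<in> carrier ?Z" if "x \<in> carrier ?Z" "y \<in> carrier ?Z" for x y
    by (rule memI) (simp_all add: sub that A.l_distr A.r_distr comm[OF that(1)] comm[OF that(2)])
  have ab: "abelian_group ?Z"
  proof (rule abelian_groupI; unfold Z(3,5))
    show "\<exists>y\<in>carrier ?Z. y \<oplus> x = \<zero>" if "x \<in> carrier ?Z" for x
      using neg[OF that] sub[OF that] by (intro bexI[of _ "\<ominus> x"]) (simp_all add: M.l_neg)
    show "\<zero> \<in> carrier ?Z" by (rule memI) simp_all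
  qed (simp_all add: add sub M.a_ac)
  have one: "\<one> \<in> carrier ?Z" by (rule memI) simp_all
  have ring: "ring ?Z"
    by (intro ringI ab monoidI) (simp_all add: Z(2-4) mult one sub A.m_assoc A.l_distr A.r_distr)
  have smult: "k \<odot> x \<in> carrier ?Z" if "k \<in> carrier K" "x \<in> carrier ?Z" for k x
    by (rule memI) (simp_all add: that sub smult_mult_left smult_mult_right comm)
  have "module K ?Z"
    by (intro moduleI R.cring_axioms ab)
      (simp_all add: Z(3,6) sub smult smult_l_distr smult_r_distr smult_assoc1)
  then show ?thesis
    using ring by (intro assoc_algebra.intro assoc_algebra_axioms.intro)
      (simp_all add: Z(2,6) sub smult_mult_left smult_mult_right)
qed

lemma ev_module_restrict_center:
  assumes "assoc_algebra K A" "ev_module K A M"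
  shows "ev_module K (center A) M"
proof -
  interpret assoc_algebra K A by fact
  interpret Z: assoc_algebra K "center A" using assms(1) by (rule assoc_algebra_center)
  interpret M: bimodule A A M using assms(2) by (simp add: ev_module_def)
  have sub: "z \<in> carrier (center A) \<Longrightarrow> z \<in> carrier A" for z by (simp add: center_def)
  have ops: "monoid.mult (center A) = monoid.mult A" "add (center A) = add A"
    "\<one>\<^bsub>center A\<^esub> = \<one>\<^bsub>A\<^esub>" "smult (center A) = smult A"
    by (simp_all add: center_def)
  have "bimodule (center A) (center A) M"
    by (intro bimodule.intro bimodule_axioms.intro Z.A.ring_axioms M.abelian_group_axioms)
      (simp_all add: ops sub M.lact_closed M.ract_closed M.lact_add_left M.lact_add_right M.ract_add_left
        M.ract_add_right M.lact_mult M.ract_mult M.lact_one M.ract_one M.lact_ract)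
  then show ?thesis using assms(2) by (simp add: ev_module_def ops)
qed

text \<open>The implications shown are (1) \<longleftrightarrow> (2), (2) \<longrightarrow> (3)
  \<longrightarrow> (1), (3) \<longrightarrow> (4) \<longrightarrow> (1) and (3) \<longrightarrow>
  (5). Projectivity enters through \<open>scalar\<close>, which derives from (3) that the center
  consists of scalars.\<close>

theorem corollary5p13:
  fixes K :: "'k ring" and A :: "('k, 'a) module"
  assumes "assoc_algebra K A"
    and "infinite (UNIV :: 'u set)"
    and "carrier K \<lesssim> (UNIV :: 'u set)"
    and "carrier A \<lesssim> (UNIV :: 'u set)"
    and "projective_module TYPE('u) K A"
  shows "let
      S1 = (\<forall>M :: ('a, 'a, 'u) bimod. ev_module K A M \<longrightarrow> HH0 (center A) M = carrier M);
      S2 = (\<forall>M :: ('a, 'a, 'u) bimod. ev_module K A M \<longrightarrow>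
              carrier (center A) = relative_center A M);
      S3 = (carrier (center A) = relative_center A (outer_bimod K A));
      S4 = (\<exists>c :: ('a, 'a, 'u) bimod \<Rightarrow> ('a, 'a, 'u) bimod \<Rightarrow> 'u \<Rightarrow> 'u.
              braided_monoidal_category (bimod_category K (center A)) c);
      S5 = (\<forall>M :: ('a, 'a, 'u) bimod. ev_module K A M \<longrightarrow>
              (\<forall>n :: nat. \<forall>\<phi>\<in>carrier (HH K A M (int n)). \<forall>z\<in>relative_center A M.
                 bracket K A M (int n) \<phi> z = \<one>\<^bsub>HH K A M (int n - 1)\<^esub>))
    in (S1 \<longleftrightarrow> S2) \<and> (S2 \<longleftrightarrow> S3) \<and> (S3 \<longleftrightarrow> S4) \<and> (S4 \<longrightarrow> S5)"
proof -
  let ?Z = "center A"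
  define S1 where "S1 \<longleftrightarrow> (\<forall>M :: ('a, 'a, 'u) bimod. ev_module K A M \<longrightarrow> HH0 ?Z M = carrier M)"
  define S2 where "S2 \<longleftrightarrow> (\<forall>M :: ('a, 'a, 'u) bimod. ev_module K A M \<longrightarrow> carrier ?Z = relative_center A M)"
  define S3 where "S3 \<longleftrightarrow> carrier ?Z = relative_center A (outer_bimod K A)"
  define S4 where "S4 \<longleftrightarrow> (\<exists>c :: ('a, 'a, 'u) bimod \<Rightarrow> ('a, 'a, 'u) bimod \<Rightarrow> 'u \<Rightarrow> 'u.
      braided_monoidal_category (bimod_category K ?Z) c)"
  define S5 where "S5 \<longleftrightarrow> (\<forall>M :: ('a, 'a, 'u) bimod. ev_module K A M \<longrightarrow>
      (\<forall>n :: nat. \<forall>\<phi>\<in>carrier (HH K A M (int n)). \<forall>z\<in>relative_center A M.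
         bracket K A M (int n) \<phi> z = \<one>\<^bsub>HH K A M (int n - 1)\<^esub>))"
  interpret assoc_algebra K A by fact
  have ZA: "carrier ?Z \<subseteq> carrier A" by (auto simp: center_def)
  interpret Z: bimodule_category K ?Z "TYPE('u)"
    using assms(1,2) lepoll_trans[OF subset_imp_lepoll[OF ZA] assms(4)]
    by (intro bimodule_category.intro assoc_algebra_center bimodule_category_axioms.intro)
  have scalar: "\<exists>k\<in>carrier K. z = k \<odot>\<^bsub>A\<^esub> \<one>\<^bsub>A\<^esub>" if S3 "z \<in> carrier ?Z" for z
  proof -
    have "z \<in> relative_center A (outer_bimod K A)" using that by (simp add: S3_def)
    then show ?thesis
      using relative_center_outer_scalar[OF assms(1,5,2,3,4)] by blast
  qed
  have 12: "S1 \<longleftrightarrow> S2" 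
    unfolding S1_def S2_def HH0_def relative_center_def by blast
  have 23: S3 if S2
  proof -
    \<comment> \<open>Statement (2) ranges over bimodules in the universe, so it is applied to a
      copy of A \<otimes> A, and the result is pulled back along the injection.\<close>
    let ?O = "outer_bimod K A" and ?C = "univ_copy (outer_bimod K A) :: ('a, 'a, 'u) bimod"
    have le: "carrier ?O \<lesssim> (UNIV :: 'u set)" by (rule outer_small[OF assms(1,2,4)])
    note ev = ev_module_outer[OF assms(1)]
    interpret O: bimodule A A ?O using ev by (simp add: ev_module_def)
    have "ev_module K A ?C" by (rule ev_module_univ_copy[OF assms(1) ev le])
    then have C: "carrier ?Z = relative_center A ?C" using that unfolding S2_def by blast
    have "lact ?O z X = ract ?O X z" if z: "z \<in> carrier ?Z" and X: "X \<in> carrier ?O" for z X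
    proof -
      have "z \<in> relative_center A ?C" using z C by simp
      then have "lact ?C z (to_univ ?O X) = ract ?C (to_univ ?O X) z"
        using X unfolding relative_center_def carrier_univ_copy[OF le] by blast
      then have "(to_univ ?O (lact ?O z X) :: 'u) = to_univ ?O (ract ?O X z)"
        by (simp add: lact_univ_copy[OF le X] ract_univ_copy[OF le X])
      then show ?thesis
        using inj_onD[OF inj_on_to_univ[OF le]] O.lact_closed[of z X] O.ract_closed[of z X] X z ZA by blast
    qed
    then show S3 by (auto simp: S3_def relative_center_def)
  qed
  have 31: S1 if S3
    unfolding S1_def
  proof (intro allI impI)
    fix M :: "('a, 'a, 'u) bimod" assume M: "ev_module K A M"
    have "lact M z x = ract M x z" if "z \<in> carrier ?Z" "x \<in> carrier M" for z x
      using scalar[OF \<open>S3\<close> that(1)] M that(2) by (auto simp: ev_module_def)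
    then show "HH0 ?Z M = carrier M" by (auto simp: HH0_def)
  qed
  have 34: S4 if S3
    unfolding S4_def
  proof (rule Z.braided_if_symmetric)
    fix M :: "('a, 'a, 'u) bimod" and a x
    assume M: "ev_module K ?Z M" and a: "a \<in> carrier ?Z" and x: "x \<in> carrier M"
    obtain k where k: "k \<in> carrier K" "a = k \<odot>\<^bsub>A\<^esub> \<one>\<^bsub>A\<^esub>" using scalar[OF \<open>S3\<close> a] by blast
    \<comment> \<open>M is an arbitrary bimodule over the center here, and its symmetric K-action is
      stated in terms of the unit of the center, which is that of A.\<close>
    have "k \<odot>\<^bsub>?Z\<^esub> \<one>\<^bsub>?Z\<^esub> = a" by (simp add: k center_def)
    then show "lact M a x = ract M x a" using M k(1) x by (auto simp: ev_module_def)
  qed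
  have 41: S1 if S4
    unfolding S1_def
  proof (intro allI impI)
    fix M :: "('a, 'a, 'u) bimod" assume M: "ev_module K A M"
    obtain c :: "('a, 'a, 'u) bimod \<Rightarrow> ('a, 'a, 'u) bimod \<Rightarrow> 'u \<Rightarrow> 'u"
      where c: "braided_monoidal_category (bimod_category K ?Z) c"
      using \<open>S4\<close> by (auto simp: S4_def)
    have "lact M z x = ract M x z" if z: "z \<in> carrier ?Z" and x: "x \<in> carrier M" for z x
    \<comment> \<open>Restriction of scalars makes M an object of the braided category without
      changing its record, so the conclusion concerns the original actions.\<close>
    proof (rule Z.symmetric_if_braided[OF c ev_module_restrict_center[OF assms(1) M] x z])
      show "z \<otimes>\<^bsub>?Z\<^esub> a = a \<otimes>\<^bsub>?Z\<^esub> z" if "a \<in> carrier ?Z" for a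
        using center_commute[OF z subsetD[OF ZA that]] by (simp add: center_def)
    qed
    then show "HH0 ?Z M = carrier M" by (auto simp: HH0_def)
  qed
  have 35: S5 if S3
    unfolding S5_def
  proof (intro allI impI ballI)
    fix M :: "('a, 'a, 'u) bimod" and n \<phi> z
    assume M: "ev_module K A M" and \<phi>: "\<phi> \<in> carrier (HH K A M (int n))" and z: "z \<in> relative_center A M"
    interpret hochschild M K A
      using assms(1) M by (intro hochschild.intro hochschild_axioms.intro) (simp_all add: ev_module_def)
    obtain k where "k \<in> carrier K" "z = k \<odot>\<^bsub>A\<^esub> \<one>\<^bsub>A\<^esub>"
      using scalar[OF \<open>S3\<close>] z by (auto simp: relative_center_def)
    then show "bracket K A M (int n) \<phi> z = \<one>\<^bsub>HH K A M (int n - 1)\<^esub>"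
      using bracket_scalar[OF _ \<phi>] by simp
  qed
  have "(S1 \<longleftrightarrow> S2) \<and> (S2 \<longleftrightarrow> S3) \<and> (S3 \<longleftrightarrow> S4) \<and> (S4 \<longrightarrow> S5)"
    using 12 23 31 34 41 35 by blast
  then show ?thesis
    unfolding Let_def S1_def S2_def S3_def S4_def S5_def .
qed

end
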